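(* Let $\tau_{2n}(c) = (-1)^n \frac{d^{2n}}{dx^{2n}} + c x^{-2n}$ on $(0,\infty)$, $n\in\mathbb{N}$, $c\in\mathbb{R}$, and for $d\in(0,\infty)$ let $\#\big(\tau_{2n}(c)|_{(0,d)}\big)$ be the number of linearly independent solutions of $\tau_{2n}(c)y=\mu y$ on $(0,d)$ lying in $L^2((0,d);dx)$ (this number does not depend on $\mu\in\mathbb{C}$; equivalently, it equals the number of indices $j\in\{1,\dots,2n\}$, counted with multiplicity, such that the root $\alpha_j(c)$ of $D_{2n}(z;c)=\prod_{j=1}^{2n}[z-(j-1)]+(-1)^nc$ satisfies $\Re(\alpha_j(c))>-1/2$). (i) For every $n\in\mathbb{N}$, $n\geq 2$, there exist $n$ real constants $c_n^{(1)}<c_n^{(2)}<\cdots<c_n^{(n)}$ such that: (a) For $c\in\mathbb{R}$, $d\in(0,\infty)$, \[ \#\big(\tau_{2n}(c)|_{(0,d)}\big)=\begin{cases} n, & c\geq c_n^{(n)},\\ n+2(n-k), & c_n^{(k)}\leq c< c_n^{(k+1)} \text{ and } \lfloor n/2\rfloor<k\leq n-1,\\ 2n, & c_n^{(k)}< c< c_n^{(k+1)} \text{ and } k=\lfloor n/2\rfloor,\\ n+2k+1, & c_n^{(k)}< c\leq c_n^{(k+1)} \text{ and } 1\leq k<\lfloor n/2\rfloor,\\ n+1, & c\leq c_n^{(1)}. \end{cases} \] (b) $c_n^{(\lceil n/2\rceil)} = (-1)^{n-1}\,(4n-1)!!/2^{2n}$. (c) The constants $c_n^{(k)}$, $k\in\{1,\dots,n\}\setminus\{\lceil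 n/2\rceil\}$, are the roots of the polynomial $h_{n-1}$ of degree $n-1$ with rational coefficients defined below. In addition, \[ c_n^{(n)} \geq \frac{(4n-1)!!}{2^{2n}} \underset{n\to\infty}{=} 2^{1/2}(2/e)^{2n} n^{2n}[1+O(1/n)]. \] (ii) For $n=1$: $\#\big(\tau_2(c)|_{(0,d)}\big)=1$ if $c\geq 3/4$, and $=2$ if $c<3/4$.
   Context: Definition of $h_{n-1}$: write $D_{2n}(z-(1/2);c) = q_{2n}z^{2n}+\cdots+q_1z+[q_0+(-1)^nc]$ (so $q_0=(4n-1)!!/2^{2n}$); set $a_k=q_k$ for $1\leq k\leq 2n$, $a_0=q_0+(-1)^nc$, $a_k=0$ otherwise; let $H_{2n}(c)$ be the $2n\times2n$ matrix with entries $a_{2n-2j+i}$ ($1\le i,j\le 2n$); then $h_{n-1}(c)$ is the determinant of the upper-left $(2n-1)\times(2n-1)$ submatrix of $H_{2n}(c)$, so $\det H_{2n}(c)=[q_0+(-1)^nc]h_{n-1}(c)$. $\lfloor\cdot\rfloor,\lceil\cdot\rceil$ denote floor and ceiling. *)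

theory Defs
  imports "HOL-Analysis.Analysis" "HOL-Computational_Algebra.Polynomial"
          "HOL-Library.Landau_Symbols"
begin

fun dfact :: "nat \<Rightarrow> nat" where
  "dfact 0 = 1"
| "dfact (Suc 0) = 1"
| "dfact (Suc (Suc m)) = (m + 2) * dfact m"

definition is_tau_solution :: "nat \<Rightarrow> real \<Rightarrow> real \<Rightarrow> complex \<Rightarrow> (real \<Rightarrow> complex) \<Rightarrow> bool" where
  "is_tau_solution n c d \<mu> y \<longleftrightarrow>
     (\<exists>Y :: nat \<Rightarrow> real \<Rightarrow> complex.
        (\<forall>x\<in>{0<..<d}. Y 0 x = y x) \<and>
        (\<forall>k<2*n. \<forall>x\<in>{0<..<d}. (Y k has_vector_derivative Y (Suc k) x) (at x)) \<and>
        (\<forall>x\<in>{0<..<d}. (-1)^n * Y (2*n) x + complex_of_real (c / x^(2*n)) * y x = \<mu> * y x))"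

definition is_L2_on :: "real \<Rightarrow> (real \<Rightarrow> complex) \<Rightarrow> bool" where
  "is_L2_on d y \<longleftrightarrow> (\<lambda>x. (cmod (y x))^2) integrable_on {0<..<d}"

definition has_indep_L2_sols :: "nat \<Rightarrow> real \<Rightarrow> real \<Rightarrow> complex \<Rightarrow> nat \<Rightarrow> bool" where
  "has_indep_L2_sols n c d \<mu> k \<longleftrightarrow>
     (\<exists>ys :: nat \<Rightarrow> real \<Rightarrow> complex.
        (\<forall>i<k. is_tau_solution n c d \<mu> (ys i) \<and> is_L2_on d (ys i)) \<and>
        (\<forall>a :: nat \<Rightarrow> complex.
           (\<forall>x\<in>{0<..<d}. (\<Sum>i<k. a i * ys i x) = 0) \<longrightarrow> (\<forall>i<k. a i = 0)))"

definition num_L2_sols :: "nat \<Rightarrow> real \<Rightarrow> real \<Rightarrow> complex \<Rightarrow> nat" where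
  "num_L2_sols n c d \<mu> = (GREATEST k. has_indep_L2_sols n c d \<mu> k)"

text \<open>D_{2n}(z - 1/2; 0) = prod_{j=1}^{2n} (z - 1/2 - (j-1)), a polynomial in z.\<close>
definition Dshift :: "nat \<Rightarrow> real poly" where
  "Dshift n = (\<Prod>j\<in>{1..2*n}. [: -(1/2) - real (j - 1), 1 :])"

text \<open>q_k = coefficient of z^k in D_{2n}(z - 1/2; c) for k \<ge> 1; q_0 = constant term at c = 0.\<close>
definition qcoeff :: "nat \<Rightarrow> nat \<Rightarrow> real" where
  "qcoeff n k = coeff (Dshift n) k"

text \<open>a_k as a polynomial in the variable c.\<close>
definition acoeff :: "nat \<Rightarrow> int \<Rightarrow> real poly" where
  "acoeff n k = (if k = 0 then [: qcoeff n 0, (-1)^n :]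
                 else if 1 \<le> k \<and> k \<le> 2 * int n then [: qcoeff n (nat k) :]
                 else 0)"

text \<open>Entry (i,j) (1-based, 1 \<le> i,j \<le> 2n) of H_{2n}(c) is a_{2n-2j+i}.\<close>
definition Hentry :: "nat \<Rightarrow> nat \<Rightarrow> nat \<Rightarrow> real poly" where
  "Hentry n i j = acoeff n (2 * int n - 2 * int j + int i)"

definition det_nat :: "nat \<Rightarrow> (nat \<Rightarrow> nat \<Rightarrow> 'a::comm_ring_1) \<Rightarrow> 'a" where
  "det_nat m A = (\<Sum>p | p permutes {1..m}. of_int (sign p) * (\<Prod>i\<in>{1..m}. A i (p i)))"

text \<open>h_{n-1}(c): determinant of the upper-left (2n-1) x (2n-1) submatrix of H_{2n}(c),
  as a polynomial in c.\<close>
definition hpoly :: "nat \<Rightarrow> real poly" where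
  "hpoly n = det_nat (2 * n - 1) (Hentry n)"

end

(*
  In the variable t = ln x the equation becomes D(d/dt) y = (-1)^n mu exp(2nt) y, a perturbation
  of a constant-coefficient equation that decays as t tends to -infinity.  Logarithmic Frobenius
  series give a fundamental system with leading terms exp(alpha t) t^m, where alpha runs over the
  roots of D with m below the multiplicity.  A solution is square integrable near 0 exactly if it only
  involves roots with real part above -1/2: a nonzero quasi-polynomial with growth rate at most
  -1/2 is reduced, by differences f(t - h) - exp(-i w h) f(t), to a single oscillation, which
  is not square integrable.

  The roots are counted in the shifted variable, where they solve p0(z) = (-1)^(n-1) c with
  p0(z) = prod (j + 1/2 - z).  On Re z <= 0 the function log p0 = sum Ln(j + 1/2 - z) has a derivative
  with negative real part, so it is injective, and its image is the region to the right of the image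
  of the imaginary axis.  Thus the roots in the closed left half plane correspond to the integers
  m with |m| < n and suitable parity for which |p0| at the point of the imaginary axis with
  phase m pi is at most |c|.  These values of |p0|, with signs, are the constants c_n^(k).
  The Hurwitz determinant vanishes at those with m nonzero, since the roots iy and -iy then give a
  kernel vector, and it has degree n - 1, so it has no other zeros.
*)

theory Submission
  imports Defs "HOL-Computational_Algebra.Fundamental_Theorem_Algebra"
begin


section \<open>Constant-coefficient operators on polynomials\<close>

text \<open>The fundamental system never has to be proved complete. Independence of the Frobenius
  solutions bounds the number of square-integrable solutions from below. For the upper bound, k
  independent square-integrable solutions are pooled with the Frobenius solutions for roots of real
  part at most -1/2. If these were more than 2n functions, their initial data at d/2 would be
  dependent, and uniqueness for the Cauchy problem would give a linear relation from which first the
  second kind and then the first drops out. The parameter \<mu> enters only through exp(2nt), so it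
  does not affect leading terms. Roots are counted on the left only and subtracted from 2n: multiple
  roots can occur, but only with real part above -1/2, where subtraction counts them correctly. As c
  passes the constant for m \<noteq> 0, the roots for m and -m reach the critical line together, as
  iy and -iy, and the count jumps by two. For m = 0 a single real root arrives at 0; there is no
  pair iy, -iy. This is why the constant with the double factorial stands apart from the zeros of
  h_{n-1}.\<close>

definition dop :: "complex \<Rightarrow> complex poly \<Rightarrow> complex poly" where
  "dop a Q = smult a Q + pderiv Q"

text \<open>With the weights i! differentiation does not increase the norm, and evaluation at t costs only
  exp |t|, so the degrees of the polynomials in the series need not be controlled.\<close>

definition pnorm :: "complex poly \<Rightarrow> real" where
  "pnorm P = (\<Sum>i\<le>degree P. cmod (coeff P i) * fact i)"

lemma pnorm_eq:
  assumes "degree P \<le> N"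
  shows "pnorm P = (\<Sum>i\<le>N. cmod (coeff P i) * fact i)"
  unfolding pnorm_def
  by (rule sum.mono_neutral_left) (use assms in \<open>auto simp: coeff_eq_0\<close>)

lemma pnorm_nonneg [simp]: "pnorm P \<ge> 0"
  unfolding pnorm_def by (intro sum_nonneg) auto

lemma pnorm_add: "pnorm (P + Q) \<le> pnorm P + pnorm Q"
proof -
  define N where "N = max (degree P) (degree Q)"
  have "degree (P + Q) \<le> N" unfolding N_def by (rule degree_add_le_max)
  hence "pnorm (P + Q) = (\<Sum>i\<le>N. cmod (coeff (P + Q) i) * fact i)" by (rule pnorm_eq)
  also have "\<dots> \<le> (\<Sum>i\<le>N. cmod (coeff P i) * fact i + cmod (coeff Q i) * fact i)"
    by (intro sum_mono)
      (auto simp flip: distrib_right intro!: mult_right_mono norm_triangle_ineq)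
  also have "\<dots> = pnorm P + pnorm Q"
    using pnorm_eq[of P N] pnorm_eq[of Q N] by (simp add: sum.distrib N_def)
  finally show ?thesis .
qed

lemma pnorm_smult: "pnorm (smult c P) = cmod c * pnorm P"
proof -
  have "pnorm (smult c P) = (\<Sum>i\<le>degree P. cmod (coeff (smult c P) i) * fact i)"
    by (rule pnorm_eq) (rule degree_smult_le)
  thus ?thesis by (simp add: pnorm_def sum_distrib_left norm_mult mult.assoc)
qed

lemma pnorm_pderiv: "pnorm (pderiv P) \<le> pnorm P"
proof -
  have "pnorm (pderiv P) = (\<Sum>i\<le>degree P. cmod (coeff (pderiv P) i) * fact i)"
    by (rule pnorm_eq) (simp add: degree_pderiv)
  also have "\<dots> = (\<Sum>i\<le>degree P. cmod (coeff P (Suc i)) * fact (Suc i))"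
    by (intro sum.cong) (auto simp: coeff_pderiv norm_mult mult_ac simp del: of_nat_Suc)
  also have "\<dots> = (\<Sum>i\<in>Suc ` {..degree P}. cmod (coeff P i) * fact i)"
    by (subst sum.reindex) auto
  also have "\<dots> \<le> (\<Sum>i\<le>Suc (degree P). cmod (coeff P i) * fact i)"
    by (rule sum_mono2) auto
  also have "\<dots> = pnorm P" by (rule pnorm_eq[symmetric]) simp
  finally show ?thesis .
qed

lemma pnorm_dop: "pnorm (dop a P) \<le> (cmod a + 1) * pnorm P"
  unfolding dop_def
  using pnorm_add[of "smult a P" "pderiv P"] pnorm_pderiv[of P]
  by (simp add: pnorm_smult algebra_simps)

text \<open>Differentiation does not increase the weighted norm, so for large |a| the scalar part
  dominates. This is the source of the decay of the Frobenius coefficients.\<close>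

lemma pnorm_dop_lower: "(cmod a - 1) * pnorm Q \<le> pnorm (dop a Q)"
proof -
  have "smult a Q = dop a Q + smult (- 1) (pderiv Q)" by (simp add: dop_def)
  hence "pnorm (smult a Q) \<le> pnorm (dop a Q) + pnorm (smult (-1) (pderiv Q))"
    using pnorm_add by metis
  hence "cmod a * pnorm Q \<le> pnorm (dop a Q) + pnorm (pderiv Q)"
    by (simp only: pnorm_smult) simp
  thus ?thesis using pnorm_pderiv[of Q] by (simp add: algebra_simps)
qed

lemma norm_poly_le_pnorm: "cmod (poly P t) \<le> pnorm P * exp (cmod t)"
proof -
  have "cmod (poly P t) \<le> (\<Sum>i\<le>degree P. cmod (coeff P i) * cmod t ^ i)"
    unfolding poly_altdef by (rule order.trans[OF norm_sum]) (simp add: norm_mult norm_power)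
  also have "\<dots> \<le> (\<Sum>i\<le>degree P. cmod (coeff P i) * fact i * exp (cmod t))"
  proof (intro sum_mono)
    fix i
    have "cmod t ^ i / fact i \<le> exp (cmod t)"
      using sum_le_suminf[OF summable_exp[of "cmod t"], of "{i}"]
      by (auto simp: exp_def scaleR_conv_of_real field_simps)
    hence "cmod t ^ i \<le> fact i * exp (cmod t)" by (simp add: field_simps)
    thus "cmod (coeff P i) * cmod t ^ i \<le> cmod (coeff P i) * fact i * exp (cmod t)"
      by (simp add: mult.assoc mult_left_mono)
  qed
  also have "\<dots> = pnorm P * exp (cmod t)" by (simp add: pnorm_def sum_distrib_right)
  finally show ?thesis .
qed

lemma pderiv_surj: "\<exists>Q::complex poly. pderiv Q = P"
proof (induction "degree P" arbitrary: P rule: less_induct)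
  case less
  define n where "n = degree P"
  define M where "M = monom (lead_coeff P / of_nat (Suc n)) (Suc n)"
  have M: "pderiv M = monom (lead_coeff P) n"
    by (simp add: M_def pderiv_monom del: of_nat_Suc)
  show ?case
  proof (cases "n = 0")
    case True
    hence "P = pderiv M" using M by (metis degree_0_id monom_0 n_def)
    thus ?thesis by metis
  next
    case False
    define R where "R = P - pderiv M"
    have "degree R < n"
    proof (rule degree_lessI)
      show "R \<noteq> 0 \<or> n > 0" using False by simp
      show "\<forall>k\<ge>n. coeff R k = 0"
        by (auto simp: R_def M n_def coeff_eq_0 le_less)
    qed
    then obtain Q where "pderiv Q = R" using less n_def by blast
    hence "pderiv (Q + M) = P" by (simp add: R_def pderiv_add)
    thus ?thesis by blast
  qed
qed

text \<open>For a \<noteq> 0 the inverse is a terminating Neumann series in the derivative, unrolled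
  by induction on the degree. For a = 0, the resonant case, P is integrated; this raises the degree
  and creates powers of the logarithm.\<close>

lemma dop_surj: "\<exists>Q. dop a Q = P"
proof (cases "a = 0")
  case True
  thus ?thesis using pderiv_surj by (simp add: dop_def)
next
  case False
  show ?thesis
  proof (induction "degree P" arbitrary: P rule: less_induct)
    case less
    have "\<exists>R. dop a R = smult (1/a) (pderiv P)"
    proof (cases "degree P = 0")
      case True
      hence "pderiv P = 0" by (simp add: pderiv_eq_0_iff)
      thus ?thesis by (intro exI[of _ 0]) (simp add: dop_def)
    next
      case False
      thus ?thesis by (intro less) (auto simp: degree_pderiv intro: le_less_trans[OF degree_smult_le])
    qed
    then obtain R where R: "dop a R = smult (1/a) (pderiv P)" ..
    have "dop a (smult (1/a) P - R) = P + smult (1/a) (pderiv P) - dop a R"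
      using \<open>a \<noteq> 0\<close> by (simp add: dop_def smult_diff_right pderiv_diff pderiv_smult)
    thus ?case using R by auto
  qed
qed

lemma dop_add: "dop a (P + Q) = dop a P + dop a Q"
  by (simp add: dop_def smult_add_right pderiv_add)

lemma dop_smult: "dop a (smult c P) = smult c (dop a P)"
  by (simp add: dop_def pderiv_smult smult_add_right mult.commute)

lemma dop_shift: "dop (w - b) P = dop w P - smult b P"
  by (simp add: dop_def smult_diff_left)

text \<open>Since \<open>dop a Q\<close> is exp(-at) times the derivative of exp(at) Q(t), this is
  the product of the operators d/dt - a over the list, conjugated by exp(wt).\<close>

definition dopl :: "complex \<Rightarrow> complex list \<Rightarrow> complex poly \<Rightarrow> complex poly" where
  "dopl w as P = foldr (\<lambda>a. dop (w - a)) as P"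

lemma dopl_simps [simp]:
  "dopl w [] P = P" "dopl w (a # as) P = dop (w - a) (dopl w as P)"
  by (simp_all add: dopl_def)

lemma dopl_surj: "\<exists>Q. dopl w as Q = P"
proof (induction as arbitrary: P)
  case (Cons a as)
  obtain Q where "dop (w - a) Q = P" using dop_surj by blast
  thus ?case using Cons[of Q] by auto
qed simp

text \<open>One factor supplies the gain R; each of the others at least preserves the norm because R
  \<ge> 1.\<close>

lemma pnorm_dopl_lower:
  assumes "\<And>a. a \<in> set as \<Longrightarrow> cmod (w - a) \<ge> R + 1" "R \<ge> 1" "as \<noteq> []"
  shows "R * pnorm Q \<le> pnorm (dopl w as Q)"
proof -
  have *: "pnorm Q \<le> pnorm (dopl w bs Q)" if "set bs \<subseteq> set as" for bs
    using that
  proof (induction bs)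
    case (Cons b bs)
    have "1 * pnorm (dopl w bs Q) \<le> (cmod (w - b) - 1) * pnorm (dopl w bs Q)"
      using assms(1)[of b] assms(2) Cons.prems by (intro mult_right_mono) auto
    also have "\<dots> \<le> pnorm (dopl w (b # bs) Q)" by (simp add: pnorm_dop_lower)
    finally show ?case using Cons by simp
  qed simp
  obtain a bs where as: "as = a # bs" using assms(3) by (cases as) auto
  have "R * pnorm Q \<le> R * pnorm (dopl w bs Q)"
    using *[of bs] assms(2) as by (intro mult_left_mono) auto
  also have "\<dots> \<le> (cmod (w - a) - 1) * pnorm (dopl w bs Q)"
    using assms(1)[of a] as by (intro mult_right_mono) auto
  also have "\<dots> \<le> pnorm (dopl w as Q)" by (simp add: pnorm_dop_lower as)
  finally show ?thesis .
qed

text \<open>Horner evaluation of q at the operator \<open>dop w\<close>, applied to P. Being linear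
  in q, it allows the factorization over the roots of \<open>Dpoly\<close> to be compared with the
  one over 0, ..., 2n-1 plus a constant.\<close>

definition popp :: "complex \<Rightarrow> complex poly \<Rightarrow> complex poly \<Rightarrow> complex poly" where
  "popp w P q = fold_coeffs (\<lambda>a R. smult a P + dop w R) q 0"

lemma popp_0 [simp]: "popp w P 0 = 0"
  by (simp add: popp_def)

lemma popp_pCons [simp]: "popp w P (pCons a q) = smult a P + dop w (popp w P q)"
  by (cases "pCons a q = 0") (auto simp: popp_def dop_def)

lemma popp_add: "popp w P (q + r) = popp w P q + popp w P r"
  by (induction q r rule: poly_induct2) (simp_all add: smult_add_left dop_add)

lemma popp_smult: "popp w P (smult c q) = smult c (popp w P q)"
  by (induction q) (simp_all add: dop_smult smult_add_right)

lemma popp_linear_mult: "popp w P ([:-b, 1:] * q) = dop (w - b) (popp w P q)"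
proof -
  have "[:-b, 1:] * q = pCons 0 q + smult (-b) q" by simp
  hence "popp w P ([:-b, 1:] * q) = dop w (popp w P q) + smult (-b) (popp w P q)"
    by (simp only: popp_add popp_smult popp_pCons) simp
  thus ?thesis by (simp add: dop_shift)
qed

lemma dopl_eq_popp: "dopl w as P = popp w P (\<Prod>a\<leftarrow>as. [:-a, 1:])"
proof (induction as)
  case Nil
  thus ?case by (simp add: one_pCons dop_def)
next
  case (Cons a as)
  thus ?case by (simp only: list.map prod_list.Cons popp_linear_mult dopl_simps)
qed

text \<open>A factor with root w is plain differentiation and lowers the degree bound by one; the
  other factors keep it. Hence everything of degree below the multiplicity of w is
  annihilated.\<close>

lemma dopl_zero:
  assumes "\<forall>i\<ge>count_list as w. coeff P i = 0"
  shows "dopl w as P = 0"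
proof -
  have "\<forall>i\<ge>count_list as w - count_list bs w. coeff (dopl w bs P) i = 0"
    if "count_list bs w \<le> count_list as w" for bs
    using that
  proof (induction bs)
    case (Cons b bs)
    show ?case
    proof (cases "b = w")
      case True
      thus ?thesis using Cons by (auto simp: dop_def coeff_pderiv)
    next
      case False
      thus ?thesis using Cons by (auto simp: dop_def coeff_pderiv)
    qed
  qed (use assms in auto)
  from this[of as] show ?thesis by (auto intro!: poly_eqI)
qed

section \<open>Logarithmic Frobenius series\<close>

text \<open>Decay faster than every geometric sequence: for |t| \<le> B the k-th term of the series
  below grows at most like the k-th power of exp(sB), and B is arbitrary.\<close>

definition rapid :: "(nat \<Rightarrow> complex poly) \<Rightarrow> bool" where
  "rapid P \<longleftrightarrow> (\<forall>r\<ge>1. summable (\<lambda>k. pnorm (P k) * r ^ k))"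

text \<open>The variable t is complex, so that the sum is holomorphic and can be composed with
  \<open>Ln\<close>.\<close>

definition fser :: "complex \<Rightarrow> nat \<Rightarrow> (nat \<Rightarrow> complex poly) \<Rightarrow> complex \<Rightarrow> complex" where
  "fser z s P t = (\<Sum>k. exp ((z + of_nat (s * k)) * t) * poly (P k) t)"

lemma rapid_dop:
  assumes "rapid P"
  shows "rapid (\<lambda>k. dop (z + of_nat (s * k) - b) (P k))"
  unfolding rapid_def
proof (intro allI impI)
  fix r :: real assume r: "r \<ge> 1"
  define c where "c = cmod (z - b) + real s + 1"
  have c: "c \<ge> 0" by (simp add: c_def)
  \<comment> \<open>Evaluating at 2r leaves a spare factor 2^k, which absorbs the linear growth of z
    + sk.\<close>
  have "summable (\<lambda>k. c * (pnorm (P k) * (2 * r) ^ k))"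
    using assms[unfolded rapid_def, rule_format, of "2 * r"] r by (intro summable_mult) simp
  thus "summable (\<lambda>k. pnorm (dop (z + of_nat (s * k) - b) (P k)) * r ^ k)"
  proof (rule summable_comparison_test'[where N = 0])
    fix k :: nat
    have "cmod (z + of_nat (s * k) - b) + 1 \<le> cmod (z - b) + cmod (of_nat (s * k)) + 1"
      using norm_triangle_ineq[of "z - b" "of_nat (s * k)"] by (simp add: algebra_simps)
    also have "\<dots> = cmod (z - b) * 1 + real s * real k + 1"
      by (simp add: norm_mult)
    also have "\<dots> \<le> cmod (z - b) * 2 ^ k + real s * 2 ^ k + 2 ^ k"
      using of_nat_less_two_power[of k, where 'a = real]
      by (intro add_mono mult_left_mono) auto
    also have "\<dots> = c * 2 ^ k" by (simp add: c_def algebra_simps)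
    finally have *: "cmod (z + of_nat (s * k) - b) + 1 \<le> c * 2 ^ k" .
    have "pnorm (dop (z + of_nat (s * k) - b) (P k)) \<le> (cmod (z + of_nat (s * k) - b) + 1) * pnorm (P k)"
      by (rule pnorm_dop)
    also have "\<dots> \<le> (c * 2 ^ k) * pnorm (P k)"
      by (rule mult_right_mono[OF *]) simp
    finally have "pnorm (dop (z + of_nat (s * k) - b) (P k)) * r ^ k \<le> (c * 2 ^ k) * pnorm (P k) * r ^ k"
      using r by (intro mult_right_mono) auto
    thus "norm (pnorm (dop (z + of_nat (s * k) - b) (P k)) * r ^ k) \<le> c * (pnorm (P k) * (2 * r) ^ k)"
      using r by (simp add: power_mult_distrib mult_ac)
  qed
qed

lemma fser_term_bound:
  assumes "cmod t \<le> B"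
  shows "cmod (exp ((z + of_nat (s * k)) * t) * poly (P k) t) \<le>
         exp (cmod z * B + B) * (pnorm (P k) * exp (real s * B) ^ k)"
proof -
  have "cmod (exp ((z + of_nat (s * k)) * t)) = exp (Re ((z + of_nat (s * k)) * t))" by simp
  also have "Re ((z + of_nat (s * k)) * t) \<le> cmod ((z + of_nat (s * k)) * t)"
    by (rule complex_Re_le_cmod)
  also have "\<dots> \<le> (cmod z + real (s * k)) * B"
    unfolding norm_mult using norm_triangle_ineq[of z "of_nat (s * k)"] assms
    by (intro mult_mono) (simp_all add: norm_mult)
  finally have 1: "cmod (exp ((z + of_nat (s * k)) * t)) \<le> exp ((cmod z + real (s * k)) * B)" by simp
  have "cmod (poly (P k) t) \<le> pnorm (P k) * exp (cmod t)" by (rule norm_poly_le_pnorm)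
  also have "\<dots> \<le> pnorm (P k) * exp B" using assms by (intro mult_left_mono) auto
  finally have 2: "cmod (poly (P k) t) \<le> pnorm (P k) * exp B" .
  have "cmod (exp ((z + of_nat (s * k)) * t) * poly (P k) t) \<le>
        exp ((cmod z + real (s * k)) * B) * (pnorm (P k) * exp B)"
    unfolding norm_mult by (intro mult_mono 1 2) auto
  also have "\<dots> = exp (cmod z * B + B) * (pnorm (P k) * exp (real s * B) ^ k)"
    by (simp add: exp_add exp_of_nat_mult[symmetric] algebra_simps)
  finally show ?thesis .
qed

lemma rapid_majorant:
  assumes "rapid P" "B \<ge> 0"
  shows "summable (\<lambda>k. exp (cmod z * B + B) * (pnorm (P k) * exp (real s * B) ^ k))"
  using assms unfolding rapid_def by (intro summable_mult) auto

lemma fser_summable: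
  assumes "rapid P"
  shows "summable (\<lambda>k. exp ((z + of_nat (s * k)) * t) * poly (P k) t)"
  by (rule summable_comparison_test'[OF rapid_majorant[OF assms, of "cmod t" z s], where N = 0])
     (auto intro!: fser_term_bound simp del: of_nat_mult)

lemma has_field_derivative_fser:
  assumes "rapid P"
  shows "(fser z s P has_field_derivative fser z s (\<lambda>k. dop (z + of_nat (s * k)) (P k)) t) (at t)"
proof -
  define B where "B = cmod t + 1"
  have B: "B \<ge> 0" by (simp add: B_def)
  have rap: "rapid (\<lambda>k. dop (z + of_nat (s * k)) (P k))"
    using rapid_dop[OF assms, of z s 0] by simp
  show ?thesis unfolding fser_def[abs_def]
  proof (rule has_field_derivative_series'(2)[where S = "cball 0 B" and ?x0.0 = t])
    fix k and u :: complex
    have "((\<lambda>u. exp ((z + of_nat (s * k)) * u) * poly (P k) u) has_field_derivative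
           exp ((z + of_nat (s * k)) * u) * poly (dop (z + of_nat (s * k)) (P k)) u) (at u)"
      by (auto intro!: derivative_eq_intros poly_DERIV simp: dop_def algebra_simps)
    thus "((\<lambda>u. exp ((z + of_nat (s * k)) * u) * poly (P k) u) has_field_derivative
           exp ((z + of_nat (s * k)) * u) * poly (dop (z + of_nat (s * k)) (P k)) u) (at u within cball 0 B)"
      by (rule DERIV_subset) simp
  next
    show "uniformly_convergent_on (cball 0 B)
       (\<lambda>n x. \<Sum>k<n. exp ((z + of_nat (s * k)) * x) * poly (dop (z + of_nat (s * k)) (P k)) x)"
      by (rule Weierstrass_m_test'[OF _ rapid_majorant[OF rap B, of z s]])
         (rule fser_term_bound, simp)
  next
    show "summable (\<lambda>n. exp ((z + of_nat (s * n)) * t) * poly (P n) t)"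
      by (rule fser_summable[OF assms])
  qed (auto simp: B_def interior_cball)
qed

lemma fser_dop_shift:
  assumes "rapid P"
  shows "fser z s (\<lambda>k. dop (z + of_nat (s * k) - b) (P k)) t =
         fser z s (\<lambda>k. dop (z + of_nat (s * k)) (P k)) t - b * fser z s P t"
proof -
  have rap: "rapid (\<lambda>k. dop (z + of_nat (s * k)) (P k))"
    using rapid_dop[OF assms, of z s 0] by simp
  show ?thesis
    unfolding fser_def suminf_mult[OF fser_summable[OF assms], symmetric]
      suminf_diff[OF fser_summable[OF rap] summable_mult[OF fser_summable[OF assms]]]
    by (intro suminf_cong) (simp add: dop_shift algebra_simps)
qed

text \<open>For t \<le> 0 the terms with k \<ge> 1 carry at least exp(st), and bounding a polynomial
  by exp |t| = exp(-t) takes one unit back; hence s - 1.\<close>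

lemma fser_remainder:
  assumes "rapid P" "s \<ge> 1"
  shows "\<exists>B. \<forall>t\<le>0. cmod (fser z s P (of_real t) - exp (z * of_real t) * poly (P 0) (of_real t))
                 \<le> B * exp ((Re z + (real s - 1)) * t)"
proof (intro exI allI impI)
  fix t :: real assume t: "t \<le> 0"
  let ?f = "\<lambda>k. exp ((z + of_nat (s * k)) * of_real t) * poly (P k) (of_real t)"
  have "summable (\<lambda>k. pnorm (P k) * 1 ^ k)" using assms(1) unfolding rapid_def by blast
  hence sm: "summable (\<lambda>k. pnorm (P k))" by simp
  have sum1: "summable (\<lambda>k. pnorm (P (Suc k)))" using sm by (subst summable_Suc_iff)
  have "fser z s P (of_real t) = (\<Sum>k. ?f (Suc k)) + ?f 0"
    unfolding fser_def using suminf_split_head[OF fser_summable[OF assms(1), of z s "of_real t"]]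
    by (simp del: of_nat_mult mult_Suc_right)
  hence "cmod (fser z s P (of_real t) - exp (z * of_real t) * poly (P 0) (of_real t)) =
         cmod (\<Sum>k. ?f (Suc k))" by simp
  also have "\<dots> \<le> (\<Sum>k. pnorm (P (Suc k)) * exp ((Re z + (real s - 1)) * t))"
  proof (rule norm_suminf_le)
    fix k
    have "cmod (?f (Suc k)) = exp ((Re z + real s * real (Suc k)) * t) * cmod (poly (P (Suc k)) (of_real t))"
      by (simp add: norm_mult algebra_simps)
    also have "\<dots> \<le> exp ((Re z + real s) * t) * (pnorm (P (Suc k)) * exp (cmod (of_real t)))"
    proof (intro mult_mono norm_poly_le_pnorm)
      have "real s * real (Suc k) \<ge> real s * 1" by (intro mult_left_mono) auto
      hence "(Re z + real s * real (Suc k)) * t \<le> (Re z + real s) * t"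
        using t by (intro mult_right_mono_neg) auto
      thus "exp ((Re z + real s * real (Suc k)) * t) \<le> exp ((Re z + real s) * t)" by simp
    qed auto
    also have "\<dots> = pnorm (P (Suc k)) * exp ((Re z + (real s - 1)) * t)"
      using t by (simp add: algebra_simps flip: exp_add)
    finally show "cmod (?f (Suc k)) \<le> pnorm (P (Suc k)) * exp ((Re z + (real s - 1)) * t)" .
  qed (intro summable_mult2 sum1)
  also have "\<dots> = (\<Sum>k. pnorm (P (Suc k))) * exp ((Re z + (real s - 1)) * t)"
    by (rule suminf_mult2[symmetric, OF sum1])
  finally show "cmod (fser z s P (of_real t) - exp (z * of_real t) * poly (P 0) (of_real t))
                 \<le> (\<Sum>k. pnorm (P (Suc k))) * exp ((Re z + (real s - 1)) * t)" .
qed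

text \<open>Each coefficient is chosen as a preimage under a surjective operator, so resonances,
  where z + sk is again a root, call for no separate treatment. Only finitely many k escape the norm
  estimate.\<close>

lemma frobenius_coeffs:
  assumes "m < count_list as z" "s \<ge> 1"
  obtains P where "P 0 = monom 1 m" "rapid P"
    "\<And>k. dopl (z + of_nat (s * k)) as (P k) = (if k = 0 then 0 else smult \<epsilon> (P (k - 1)))"
proof -
  have "\<exists>P. P 0 = monom 1 m \<and> (\<forall>k. dopl (z + of_nat (s * Suc k)) as (P (Suc k)) = smult \<epsilon> (P k))"
  proof -
    define P where "P = rec_nat (monom 1 m) (\<lambda>k Q. SOME R. dopl (z + of_nat (s * Suc k)) as R = smult \<epsilon> Q)"
    have "dopl (z + of_nat (s * Suc k)) as (P (Suc k)) = smult \<epsilon> (P k)" for k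
      unfolding P_def using someI_ex[OF dopl_surj, of "z + of_nat (s * Suc k)" as] by simp
    thus ?thesis by (intro exI[of _ P]) (simp add: P_def)
  qed
  then obtain P where P0: "P 0 = monom 1 m"
    and PS: "\<And>k. dopl (z + of_nat (s * Suc k)) as (P (Suc k)) = smult \<epsilon> (P k)" by blast
  have as: "as \<noteq> []" using assms by auto
  have "rapid P" unfolding rapid_def
  proof (intro allI impI)
    fix r :: real assume r: "r \<ge> 1"
    \<comment> \<open>A gain of at least 2 |\<epsilon>| r per step makes the ratio of consecutive
      terms at most 1/2; the summand 1 ensures R \<ge> 1.\<close>
    define R where "R = 2 * cmod \<epsilon> * r + 1"
    have R: "R \<ge> 1" using r by (simp add: R_def)
    \<comment> \<open>From this index on, z + s(k+1) is at distance at least R + 1 from every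
      root.\<close>
    define K where "K = nat \<lceil>R + 1 + (\<Sum>a\<leftarrow>as. cmod (z - a))\<rceil>"
    show "summable (\<lambda>k. pnorm (P k) * r ^ k)"
    proof (rule summable_ratio_test[of "1/2" K])
      fix k assume k: "k \<ge> K"
      have "R * pnorm (P (Suc k)) \<le> pnorm (dopl (z + of_nat (s * Suc k)) as (P (Suc k)))"
      proof (rule pnorm_dopl_lower[OF _ R as])
        fix a assume a: "a \<in> set as"
        have "cmod (z - a) \<le> (\<Sum>a\<leftarrow>as. cmod (z - a))"
          using a by (intro member_le_sum_list) auto
        hence "R + 1 + cmod (z - a) \<le> real K" unfolding K_def by linarith
        also have "\<dots> \<le> real (s * Suc k)" 
        proof -
          have "K \<le> 1 * Suc k" using k by simp
          also have "\<dots> \<le> s * Suc k" using assms(2) by (intro mult_right_mono) auto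
          finally show ?thesis by (simp only: of_nat_le_iff)
        qed
        also have "\<dots> = cmod (of_nat (s * Suc k))" by (simp only: norm_of_nat)
        also have "\<dots> \<le> cmod (z + of_nat (s * Suc k) - a) + cmod (z - a)"
          using norm_triangle_ineq4[of "z + of_nat (s * Suc k) - a" "z - a"] by (simp add: algebra_simps)
        finally show "R + 1 \<le> cmod (z + of_nat (s * Suc k) - a)" by simp
      qed
      also have "\<dots> = cmod \<epsilon> * pnorm (P k)" by (simp only: PS pnorm_smult)
      finally have "R * pnorm (P (Suc k)) \<le> cmod \<epsilon> * pnorm (P k)" .
      hence "2 * r * (R * pnorm (P (Suc k))) \<le> 2 * r * (cmod \<epsilon> * pnorm (P k))"
        using r by (intro mult_left_mono) auto
      also have "\<dots> \<le> R * pnorm (P k)" by (simp add: R_def algebra_simps)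
      finally have "R * (2 * r * pnorm (P (Suc k))) \<le> R * pnorm (P k)" by (simp add: mult_ac)
      hence "2 * r * pnorm (P (Suc k)) \<le> pnorm (P k)" using R by simp
      hence "2 * r * pnorm (P (Suc k)) * r ^ k \<le> pnorm (P k) * r ^ k" by (rule mult_right_mono) (use r in simp)
      thus "norm (pnorm (P (Suc k)) * r ^ Suc k) \<le> 1/2 * norm (pnorm (P k) * r ^ k)"
        using r by (simp add: abs_mult mult_ac)
    qed simp
  qed
  moreover have "dopl z as (P 0) = 0"
    by (rule dopl_zero) (use assms P0 in auto)
  hence "dopl (z + of_nat (s * k)) as (P k) = (if k = 0 then 0 else smult \<epsilon> (P (k - 1)))" for k
    using PS[of "k - 1"] by (cases k) auto
  ultimately show ?thesis using that P0 by blast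
qed

section \<open>Solutions of the differential equation\<close>

text \<open>The derivatives are kept as explicit data, so that initial values at a point can be
  combined linearly.\<close>

definition tau_chain :: "nat \<Rightarrow> real \<Rightarrow> real \<Rightarrow> complex \<Rightarrow> (nat \<Rightarrow> real \<Rightarrow> complex) \<Rightarrow> bool" where
  "tau_chain n c d \<mu> Y \<longleftrightarrow>
     (\<forall>k<2*n. \<forall>x\<in>{0<..<d}. (Y k has_vector_derivative Y (Suc k) x) (at x)) \<and>
     (\<forall>x\<in>{0<..<d}. (-1)^n * Y (2*n) x + complex_of_real (c / x^(2*n)) * Y 0 x = \<mu> * Y 0 x)"

lemma is_tau_solution_altdef:
  "is_tau_solution n c d \<mu> y \<longleftrightarrow> (\<exists>Y. (\<forall>x\<in>{0<..<d}. Y 0 x = y x) \<and> tau_chain n c d \<mu> Y)"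
  unfolding is_tau_solution_def tau_chain_def by (intro ex_cong1) auto

definition Dpoly :: "nat \<Rightarrow> real \<Rightarrow> complex poly" where
  "Dpoly n c = (\<Prod>j<2*n. [:- of_nat j, 1:]) + [:(-1) ^ n * of_real c:]"

text \<open>Multiplication by exp(st) shifts the index by one; this turns the recursion for the
  coefficients into the differential equation.\<close>

lemma fser_shift:
  assumes "rapid P"
  shows "fser z s (\<lambda>k. (if k = 0 then 0 else smult \<epsilon> (P (k - 1))) - smult \<kappa> (P k)) t =
         (\<epsilon> * exp (of_nat s * t) - \<kappa>) * fser z s P t"
proof -
  let ?f = "\<lambda>k. exp ((z + of_nat (s * k)) * t) * poly (P k) t"
  let ?g = "\<lambda>k. exp ((z + of_nat (s * k)) * t) * poly (if k = 0 then 0 else smult \<epsilon> (P (k - 1))) t"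
  have f: "?f sums fser z s P t"
    unfolding fser_def using fser_summable[OF assms] by (rule summable_sums)
  hence "(\<lambda>k. \<epsilon> * exp (of_nat s * t) * ?f k) sums (\<epsilon> * exp (of_nat s * t) * fser z s P t)"
    by (rule sums_mult)
  moreover have "(\<lambda>k. \<epsilon> * exp (of_nat s * t) * ?f k) = (\<lambda>k. ?g (Suc k))"
  proof
    fix k
    have "exp (of_nat s * t) * exp ((z + of_nat (s * k)) * t) = exp ((z + of_nat (s * Suc k)) * t)"
      by (simp add: algebra_simps flip: exp_add)
    thus "\<epsilon> * exp (of_nat s * t) * ?f k = ?g (Suc k)"
      by (simp only: nat.simps if_False poly_smult diff_Suc_1 mult_ac)
  qed
  ultimately have "(\<lambda>k. ?g (Suc k)) sums (\<epsilon> * exp (of_nat s * t) * fser z s P t)" by (simp only:)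
  hence "?g sums (\<epsilon> * exp (of_nat s * t) * fser z s P t + ?g 0)"
    by (rule sums_Suc)
  hence "?g sums (\<epsilon> * exp (of_nat s * t) * fser z s P t)" by simp
  from sums_diff[OF this sums_mult[OF f, of \<kappa>]]
  have "(\<lambda>k. exp ((z + of_nat (s * k)) * t) *
           poly ((if k = 0 then 0 else smult \<epsilon> (P (k - 1))) - smult \<kappa> (P k)) t) sums
        ((\<epsilon> * exp (of_nat s * t) - \<kappa>) * fser z s P t)"
    by (simp add: algebra_simps)
  thus ?thesis unfolding fser_def by (rule sums_unique[symmetric])
qed

lemma frobenius_solution:
  assumes n: "n \<ge> 1" and as: "Dpoly n c = (\<Prod>a\<leftarrow>as. [:-a, 1:])" and m: "m < count_list as z"
  obtains Y B where "\<And>d. tau_chain n c d \<mu> Y"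
    "\<And>t. t \<le> 0 \<Longrightarrow> cmod (Y 0 (exp t) - exp (z * of_real t) * of_real t ^ m) \<le> B * exp ((Re z + 1) * t)"
proof -
  define \<epsilon> where "\<epsilon> = (-1) ^ n * \<mu>"
  define \<kappa> where "\<kappa> = (-1) ^ n * complex_of_real c"
  define s where "s = 2 * n"
  have s: "s \<ge> 1" "s \<ge> 2" using n by (auto simp: s_def)
  obtain P where P0: "P 0 = monom 1 m" and rap: "rapid P"
    and rec: "\<And>k. dopl (z + of_nat (s * k)) as (P k) = (if k = 0 then 0 else smult \<epsilon> (P (k - 1)))"
    using frobenius_coeffs[OF m s(1)] by blast
  define L where "L j = rev (map of_nat [0..<j] :: complex list)" for j :: nat
  \<comment> \<open>With \<theta> = x d/dx, the j-th derivative times x^j is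
    \<theta>(\<theta>-1)...(\<theta>-j+1). So \<open>R j\<close> is the coefficient sequence of x^j
    times the j-th derivative. The list is reversed to make the newest factor outermost.\<close>
  define R where "R j k = dopl (z + of_nat (s * k)) (L j) (P k)" for j k
  have RS: "R (Suc j) = (\<lambda>k. dop (z + of_nat (s * k) - of_nat j) (R j k))" for j
    by (simp add: R_def L_def fun_eq_iff)
  have rapR: "rapid (R j)" for j
  proof (induction j)
    case 0
    thus ?case using rap by (simp add: R_def[abs_def] L_def)
  next
    case (Suc j)
    show ?case unfolding RS by (rule rapid_dop[OF Suc])
  qed
  have R0: "R 0 = P" by (simp add: R_def L_def fun_eq_iff)
  \<comment> \<open>\<open>Dpoly\<close> differs from the product over 0, ..., 2n-1 by the constant
    \<kappa> only, so the recursion for the full operator determines the top derivative.\<close>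
  have Rn: "R s = (\<lambda>k. (if k = 0 then 0 else smult \<epsilon> (P (k - 1))) - smult \<kappa> (P k))"
  proof
    fix k
    have prod: "(\<Prod>a\<leftarrow>L j. [:-a, 1:]) = (\<Prod>i<j. [:- of_nat i, 1 :: complex:])" for j
      by (induction j) (simp_all add: L_def mult.commute)
    have "dopl (z + of_nat (s * k)) as (P k) =
          popp (z + of_nat (s * k)) (P k) ((\<Prod>a\<leftarrow>L s. [:-a, 1:]) + [:\<kappa>:])"
      by (simp only: dopl_eq_popp as[symmetric] Dpoly_def prod s_def \<kappa>_def)
    also have "\<dots> = R s k + smult \<kappa> (P k)"
      unfolding popp_add R_def dopl_eq_popp by (simp add: dop_def)
    finally show "R s k = (if k = 0 then 0 else smult \<epsilon> (P (k - 1))) - smult \<kappa> (P k)"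
      using rec[of k] by (simp only: eq_diff_eq)
  qed
  \<comment> \<open>The j-th derivative as a holomorphic function on the slit plane; its restriction
    to the positive axis gives the chain.\<close>
  define F where "F j u = inverse u ^ j * fser z s (R j) (Ln u)" for j u
  define Y where "Y j x = F j (complex_of_real x)" for j x
  have dF: "(F j has_field_derivative F (Suc j) u) (at u)" if u: "u \<notin> \<real>\<^sub>\<le>\<^sub>0" for j u
  proof -
    have u0: "u \<noteq> 0" using u by auto
    have d1: "((\<lambda>u. fser z s (R j) (Ln u)) has_field_derivative
           fser z s (\<lambda>k. dop (z + of_nat (s * k)) (R j k)) (Ln u) * inverse u) (at u)"
      by (rule DERIV_chain2[OF has_field_derivative_fser[OF rapR] has_field_derivative_Ln[OF u]])
    have d2: "((\<lambda>u. inverse u ^ j) has_field_derivative (- of_nat j * inverse u ^ Suc j)) (at u)"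
      by (rule DERIV_cong[OF DERIV_power[OF DERIV_inverse[OF u0], of j]]) (cases j; simp add: algebra_simps)
    have "(F j has_field_derivative
            inverse u ^ j * (fser z s (\<lambda>k. dop (z + of_nat (s * k)) (R j k)) (Ln u) * inverse u)
            + (- of_nat j * inverse u ^ Suc j) * fser z s (R j) (Ln u)) (at u)"
      unfolding F_def[abs_def] by (rule DERIV_mult'[OF d2 d1])
    also have "inverse u ^ j * (fser z s (\<lambda>k. dop (z + of_nat (s * k)) (R j k)) (Ln u) * inverse u)
            + (- of_nat j * inverse u ^ Suc j) * fser z s (R j) (Ln u) = F (Suc j) u"
      unfolding F_def RS fser_dop_shift[OF rapR] by (simp add: algebra_simps)
    finally show ?thesis .
  qed
  have chain: "tau_chain n c d \<mu> Y" for d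
    unfolding tau_chain_def
  proof safe
    fix k x assume "x \<in> {0<..<d}"
    hence "complex_of_real x \<notin> \<real>\<^sub>\<le>\<^sub>0" by (auto simp: complex_nonpos_Reals_iff)
    from has_vector_derivative_real_field[OF dF[OF this]]
    show "(Y k has_vector_derivative Y (Suc k) x) (at x)" by (simp add: Y_def[abs_def])
  next
    fix x assume "x \<in> {0<..<d}"
    hence x: "x > 0" by simp
    have e: "exp (of_nat s * Ln (of_real x)) = complex_of_real x ^ s"
      using x by (simp add: exp_of_nat_mult)
    have m1: "(-1 :: complex) ^ n * (-1) ^ n = 1" by (simp flip: power_add)
    have "Y s x = inverse (of_real x) ^ s * ((\<epsilon> * of_real x ^ s - \<kappa>) * Y 0 x)"
      unfolding Y_def F_def R0 Rn fser_shift[OF rap] e by simp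
    also have "\<dots> = (-1) ^ n * ((\<mu> - complex_of_real (c / x ^ s)) * Y 0 x)"
      using x by (simp add: \<epsilon>_def \<kappa>_def field_simps)
    finally have "(-1) ^ n * Y s x = ((-1) ^ n * (-1) ^ n) * ((\<mu> - complex_of_real (c / x ^ s)) * Y 0 x)"
      by (simp add: mult.assoc)
    thus "(- 1) ^ n * Y (2 * n) x + complex_of_real (c / x ^ (2 * n)) * Y 0 x = \<mu> * Y 0 x"
      unfolding m1 s_def by (simp add: algebra_simps)
  qed
  obtain B where B: "\<And>t. t \<le> 0 \<Longrightarrow> cmod (fser z s P (of_real t) - exp (z * of_real t) * poly (P 0) (of_real t))
                 \<le> B * exp ((Re z + (real s - 1)) * t)"
    using fser_remainder[OF rap s(1), of z] by blast
  have B0: "B \<ge> 0" using order.trans[OF norm_ge_zero B[of 0]] by simp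
  have "cmod (Y 0 (exp t) - exp (z * of_real t) * of_real t ^ m) \<le> B * exp ((Re z + 1) * t)"
    if t: "t \<le> 0" for t
  proof -
    have "Y 0 (exp t) = fser z s P (of_real t)"
      by (simp add: Y_def F_def R0 Ln_of_real)
    hence "cmod (Y 0 (exp t) - exp (z * of_real t) * of_real t ^ m) \<le> B * exp ((Re z + (real s - 1)) * t)"
      using B[OF t] by (simp add: P0 poly_monom)
    \<comment> \<open>Here s = 2n \<ge> 2, so the gain s - 1 is at least 1 whatever n is.\<close>
    also have "\<dots> \<le> B * exp ((Re z + 1) * t)"
      using t s(2) B0 by (intro mult_left_mono) (auto intro!: mult_right_mono_neg)
    finally show ?thesis .
  qed
  thus ?thesis using that chain by blast
qed

lemma tau_chain_lincomb:
  assumes "finite J" "\<And>j. j \<in> J \<Longrightarrow> tau_chain n c d \<mu> (Y j)"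
  shows "tau_chain n c d \<mu> (\<lambda>k x. \<Sum>j\<in>J. a j * Y j k x)"
  unfolding tau_chain_def
proof safe
  fix k x assume "k < 2 * n" "x \<in> {0<..<d}"
  hence "\<And>j. j \<in> J \<Longrightarrow> (Y j k has_vector_derivative Y j (Suc k) x) (at x)"
    using assms(2) unfolding tau_chain_def by blast
  thus "((\<lambda>x. \<Sum>j\<in>J. a j * Y j k x) has_vector_derivative (\<Sum>j\<in>J. a j * Y j (Suc k) x)) (at x)"
    by (intro has_vector_derivative_sum has_vector_derivative_mult_right) auto
next
  fix x assume "x \<in> {0<..<d}"
  hence *: "(-1)^n * Y j (2*n) x + complex_of_real (c / x^(2*n)) * Y j 0 x = \<mu> * Y j 0 x" if "j \<in> J" for j
    using assms(2)[OF that] unfolding tau_chain_def by blast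
  have gen: "u * (\<Sum>j\<in>J. a j * f j) + v * (\<Sum>j\<in>J. a j * g j) = (\<Sum>j\<in>J. a j * (u * f j + v * g j))"
    for u v :: complex and f g
    by (simp add: sum_distrib_left sum.distrib[symmetric] algebra_simps)
  have "(- 1) ^ n * (\<Sum>j\<in>J. a j * Y j (2 * n) x) + complex_of_real (c / x ^ (2 * n)) * (\<Sum>j\<in>J. a j * Y j 0 x) =
        (\<Sum>j\<in>J. a j * ((-1)^n * Y j (2*n) x + complex_of_real (c / x^(2*n)) * Y j 0 x))"
    by (rule gen)
  also have "\<dots> = \<mu> * (\<Sum>j\<in>J. a j * Y j 0 x)"
    by (simp only: * sum_distrib_left cong: sum.cong) (simp add: mult_ac)
  finally show "(- 1) ^ n * (\<Sum>j\<in>J. a j * Y j (2 * n) x) +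
       complex_of_real (c / x ^ (2 * n)) * (\<Sum>j\<in>J. a j * Y j 0 x) = \<mu> * (\<Sum>j\<in>J. a j * Y j 0 x)" .
qed

text \<open>A Gronwall argument in both directions from x0 for the sum E of the squared moduli of
  the derivatives. Between x and x0 the singular coefficient is bounded, because both points are at
  least l > 0.\<close>

lemma tau_chain_unique:
  assumes Y: "tau_chain n c d \<mu> Y" and x0: "x0 \<in> {0<..<d}" and zero: "\<And>k. k < 2 * n \<Longrightarrow> Y k x0 = 0"
    and x: "x \<in> {0<..<d}" and n: "n \<ge> 1"
  shows "Y 0 x = 0"
proof -
  define E where "E x = (\<Sum>k<2*n. (cmod (Y k x))\<^sup>2)" for x
  define E' where "E' x = (\<Sum>k<2*n. 2 * (Y k x \<bullet> Y (Suc k) x))" for x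
  define l where "l = min x x0"
  have l: "l > 0" using x x0 by (auto simp: l_def)
  define M where "M = cmod \<mu> + \<bar>c\<bar> / l ^ (2 * n)"
  \<comment> \<open>The 2 comes from 2ab \<le> a^2 + b^2 for consecutive derivatives; M bounds the
    derivative of order 2n through the equation.\<close>
  define K where "K = 2 + M\<^sup>2"
  have dE: "(E has_real_derivative E' t) (at t)" if t: "t \<in> {0<..<d}" for t
    unfolding E_def[abs_def] E'_def
  proof (rule DERIV_sum)
    fix k assume "k \<in> {..<2*n}"
    hence "(Y k has_vector_derivative Y (Suc k) t) (at t)"
      using Y t unfolding tau_chain_def by blast
    hence D: "(Y k has_derivative (\<lambda>h. h *\<^sub>R Y (Suc k) t)) (at t)"
      by (simp add: has_vector_derivative_def)
    show "((\<lambda>t. (cmod (Y k t))\<^sup>2) has_real_derivative 2 * (Y k t \<bullet> Y (Suc k) t)) (at t)"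
      unfolding power2_norm_eq_inner has_field_derivative_def
      by (rule has_derivative_eq_rhs[OF has_derivative_inner[OF D D]])
         (auto simp: inner_commute)
  qed
  have bound: "\<bar>E' t\<bar> \<le> K * E t" if t: "t \<in> {0<..<d}" "t \<ge> l" for t
  proof -
    have "\<bar>2 * (Y k t \<bullet> Y (Suc k) t)\<bar> \<le> (cmod (Y k t))\<^sup>2 + (cmod (Y (Suc k) t))\<^sup>2" for k
    proof -
      have "\<bar>Y k t \<bullet> Y (Suc k) t\<bar> \<le> cmod (Y k t) * cmod (Y (Suc k) t)" by (rule Cauchy_Schwarz_ineq2)
      moreover have "2 * (cmod (Y k t) * cmod (Y (Suc k) t)) \<le> (cmod (Y k t))\<^sup>2 + (cmod (Y (Suc k) t))\<^sup>2"
        using sum_squares_bound[of "cmod (Y k t)" "cmod (Y (Suc k) t)"] by (simp add: mult.assoc)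
      ultimately show ?thesis by simp
    qed
    hence "\<bar>E' t\<bar> \<le> (\<Sum>k<2*n. (cmod (Y k t))\<^sup>2 + (cmod (Y (Suc k) t))\<^sup>2)"
      unfolding E'_def by (intro order.trans[OF sum_abs] sum_mono)
    also have "\<dots> = E t + (\<Sum>k<2*n. (cmod (Y (Suc k) t))\<^sup>2)" by (simp add: sum.distrib E_def)
    also have "(\<Sum>k<2*n. (cmod (Y (Suc k) t))\<^sup>2) = (E t + (cmod (Y (2*n) t))\<^sup>2) - (cmod (Y 0 t))\<^sup>2"
      unfolding E_def using sum.lessThan_Suc_shift[of "\<lambda>k. (cmod (Y k t))\<^sup>2" "2*n"] by simp
    finally have 1: "\<bar>E' t\<bar> \<le> 2 * E t + (cmod (Y (2*n) t))\<^sup>2"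
      using zero_le_power2[of "cmod (Y 0 t)"] by linarith
    have "cmod (Y (2*n) t) \<le> M * cmod (Y 0 t)"
    proof -
      have "(-1)^n * Y (2*n) t = (\<mu> - complex_of_real (c / t^(2*n))) * Y 0 t"
        using Y t unfolding tau_chain_def by (simp add: algebra_simps)
      hence "cmod ((-1)^n * Y (2*n) t) = cmod (\<mu> - complex_of_real (c / t^(2*n))) * cmod (Y 0 t)"
        by (simp add: norm_mult)
      hence "cmod (Y (2*n) t) = cmod (\<mu> - complex_of_real (c / t^(2*n))) * cmod (Y 0 t)"
        by (simp add: norm_mult norm_power)
      also have "cmod (\<mu> - complex_of_real (c / t^(2*n))) \<le> cmod \<mu> + cmod (complex_of_real (c / t^(2*n)))"
        by (rule norm_triangle_ineq4)
      also have "cmod (complex_of_real (c / t^(2*n))) = \<bar>c\<bar> / t^(2*n)"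
        using t by (simp only: norm_of_real) (simp add: abs_divide)
      also have "\<bar>c\<bar> / t^(2*n) \<le> \<bar>c\<bar> / l^(2*n)"
        using t l by (intro divide_left_mono power_mono mult_pos_pos) auto
      finally show ?thesis by (simp add: M_def mult_right_mono)
    qed
    hence "(cmod (Y (2*n) t))\<^sup>2 \<le> (M * cmod (Y 0 t))\<^sup>2" by (intro power_mono) auto
    also have "\<dots> = M\<^sup>2 * (cmod (Y 0 t))\<^sup>2" by (simp add: power_mult_distrib)
    also have "\<dots> \<le> M\<^sup>2 * E t" unfolding E_def
      using n by (intro mult_left_mono member_le_sum[of 0 "{..<2*n}" "\<lambda>k. (cmod (Y k t))\<^sup>2"]) auto
    finally show ?thesis using 1 by (simp add: K_def algebra_simps)
  qed
  have E0: "E x0 = 0" unfolding E_def using zero by simp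
  have "E x \<le> 0"
  proof (cases "x0 \<le> x")
    case True
    have "exp (-K * x) * E x \<le> exp (-K * x0) * E x0"
    proof (rule DERIV_nonpos_imp_nonincreasing[where f = "\<lambda>t. exp (-K * t) * E t"])
      fix t assume t: "x0 \<le> t" "t \<le> x"
      hence t': "t \<in> {0<..<d}" "t \<ge> l" using x x0 by (auto simp: l_def)
      have "((\<lambda>t. exp (-K * t) * E t) has_real_derivative exp (-K * t) * (E' t - K * E t)) (at t)"
        by (auto intro!: derivative_eq_intros dE[OF t'(1)] simp: algebra_simps)
      moreover have "exp (-K * t) * (E' t - K * E t) \<le> 0"
        using bound[OF t'] by (intro mult_nonneg_nonpos) auto
      ultimately show "\<exists>y. ((\<lambda>t. exp (-K * t) * E t) has_real_derivative y) (at t) \<and> y \<le> 0" by blast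
    qed fact
    thus ?thesis using E0 by (simp add: mult_le_0_iff)
  next
    case False
    have "exp (K * x) * E x \<le> exp (K * x0) * E x0"
    proof (rule DERIV_nonneg_imp_nondecreasing[where f = "\<lambda>t. exp (K * t) * E t"])
      fix t assume t: "x \<le> t" "t \<le> x0"
      hence t': "t \<in> {0<..<d}" "t \<ge> l" using x x0 by (auto simp: l_def)
      have "((\<lambda>t. exp (K * t) * E t) has_real_derivative exp (K * t) * (E' t + K * E t)) (at t)"
        by (auto intro!: derivative_eq_intros dE[OF t'(1)] simp: algebra_simps)
      moreover have "exp (K * t) * (E' t + K * E t) \<ge> 0"
        using bound[OF t'] by (intro mult_nonneg_nonneg) auto
      ultimately show "\<exists>y. ((\<lambda>t. exp (K * t) * E t) has_real_derivative y) (at t) \<and> y \<ge> 0" by blast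
    qed (use False in simp)
    thus ?thesis using E0 by (simp add: mult_le_0_iff)
  qed
  moreover have "(cmod (Y 0 x))\<^sup>2 \<le> E x" unfolding E_def
    using n by (intro member_le_sum[of 0 "{..<2*n}" "\<lambda>k. (cmod (Y k x))\<^sup>2"]) auto
  ultimately have "(cmod (Y 0 x))\<^sup>2 \<le> 0" by linarith
  thus ?thesis by simp
qed

lemma tau_chain_continuous:
  assumes "tau_chain n c d \<mu> Y" "n \<ge> 1"
  shows "continuous_on {0<..<d} (Y 0)"
proof -
  have "isCont (Y 0) x" if "x \<in> {0<..<d}" for x
  proof -
    have "(Y 0 has_vector_derivative Y (Suc 0) x) (at x)"
      using assms that unfolding tau_chain_def by auto
    thus ?thesis by (rule has_vector_derivative_continuous)
  qed
  thus ?thesis by (intro continuous_at_imp_continuous_on) auto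
qed

section \<open>Quasi-polynomials and square integrability\<close>

text \<open>Continuity supplies measurability, so an integrable majorant suffices.\<close>

lemma square_integrable_bound:
  fixes f :: "real \<Rightarrow> complex" and g :: "real \<Rightarrow> real"
  assumes "continuous_on S f" "S \<in> sets lebesgue" "g integrable_on S"
    "\<And>x. x \<in> S \<Longrightarrow> (cmod (f x))\<^sup>2 \<le> g x"
  shows "(\<lambda>x. (cmod (f x))\<^sup>2) integrable_on S"
proof (rule measurable_bounded_by_integrable_imp_integrable)
  show "(\<lambda>x. (cmod (f x))\<^sup>2) \<in> borel_measurable (lebesgue_on S)"
    by (rule continuous_imp_measurable_on_sets_lebesgue) (use assms in \<open>auto intro!: continuous_intros\<close>)
qed (use assms in auto)

lemma norm_add_squared_le: "(cmod (a * x + b * y))\<^sup>2 \<le> 2 * (cmod a)\<^sup>2 * (cmod x)\<^sup>2 + 2 * (cmod b)\<^sup>2 * (cmod y)\<^sup>2"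
proof -
  define u v where "u = cmod (a * x)" and "v = cmod (b * y)"
  have "(cmod (a * x + b * y))\<^sup>2 \<le> (u + v)\<^sup>2"
    unfolding u_def v_def by (intro power_mono norm_triangle_ineq) auto
  also have "\<dots> \<le> 2 * u\<^sup>2 + 2 * v\<^sup>2"
    using sum_squares_bound[of u v] by (simp add: power2_sum)
  finally show ?thesis by (simp add: u_def v_def norm_mult power_mult_distrib)
qed

lemma square_integrable_lincomb2:
  fixes f g :: "real \<Rightarrow> complex"
  assumes "continuous_on S f" "continuous_on S g" "S \<in> sets lebesgue"
    "(\<lambda>x. (cmod (f x))\<^sup>2) integrable_on S" "(\<lambda>x. (cmod (g x))\<^sup>2) integrable_on S"
  shows "(\<lambda>x. (cmod (a * f x + b * g x))\<^sup>2) integrable_on S"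
proof (rule square_integrable_bound)
  show "(\<lambda>x. 2 * (cmod a)\<^sup>2 * (cmod (f x))\<^sup>2 + 2 * (cmod b)\<^sup>2 * (cmod (g x))\<^sup>2) integrable_on S"
    using assms(4,5) by (intro integrable_add integrable_on_mult_right)
qed (use assms in \<open>auto intro!: continuous_intros norm_add_squared_le\<close>)

lemma square_integrable_lincomb:
  fixes f :: "'i \<Rightarrow> real \<Rightarrow> complex"
  assumes "finite J" "S \<in> sets lebesgue" "\<And>j. j \<in> J \<Longrightarrow> continuous_on S (f j)"
    "\<And>j. j \<in> J \<Longrightarrow> (\<lambda>x. (cmod (f j x))\<^sup>2) integrable_on S"
  shows "(\<lambda>x. (cmod (\<Sum>j\<in>J. a j * f j x))\<^sup>2) integrable_on S"
  using assms
proof (induction J rule: finite_induct)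
  case (insert j J)
  have "(\<lambda>x. (cmod (a j * f j x + 1 * (\<Sum>j\<in>J. a j * f j x)))\<^sup>2) integrable_on S"
    by (rule square_integrable_lincomb2) (use insert in \<open>auto intro!: continuous_intros\<close>)
  thus ?case using insert by simp
qed (simp add: integrable_0)

section \<open>Functions of the logarithmic variable on a left half line\<close>

definition L2t :: "real \<Rightarrow> (real \<Rightarrow> complex) \<Rightarrow> bool" where
  "L2t T f \<longleftrightarrow> continuous_on {..<T} f \<and> (\<lambda>t. (cmod (f t))\<^sup>2) integrable_on {..<T}"

definition exp_decay :: "real \<Rightarrow> (real \<Rightarrow> complex) \<Rightarrow> bool" where
  "exp_decay T r \<longleftrightarrow> (\<exists>\<delta>>0. \<exists>B. \<forall>t<T. cmod (r t) \<le> B * exp (\<delta> * t))"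

lemma L2t_shift:
  assumes "L2t T f" "h \<ge> 0"
  shows "L2t T (\<lambda>t. f (t - h))"
  unfolding L2t_def
proof
  show "continuous_on {..<T} (\<lambda>t. f (t - h))"
    by (rule continuous_on_compose2[of "{..<T}" f])
       (use assms in \<open>auto simp: L2t_def intro!: continuous_intros\<close>)
  have "(\<lambda>t. (cmod (f t))\<^sup>2) absolutely_integrable_on {..<T}"
    using assms unfolding L2t_def by (intro nonnegative_absolutely_integrable_1) auto
  hence "(\<lambda>t. (cmod (f t))\<^sup>2) absolutely_integrable_on {..<T - h}"
    by (rule set_integrable_subset) (use assms in auto)
  also have "{..<T - h} = (\<lambda>t. t - h) ` {..<T}"
  proof (intro equalityI subsetI)
    fix x assume "x \<in> {..<T - h}"
    thus "x \<in> (\<lambda>t. t - h) ` {..<T}" by (intro image_eqI[of _ _ "x + h"]) auto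
  qed auto
  finally have "(\<lambda>t. \<bar>1\<bar> *\<^sub>R (cmod (f (t - h)))\<^sup>2) absolutely_integrable_on {..<T}"
    by (subst (asm) absolutely_integrable_change_of_variables_real[where h = "\<lambda>_. 1"])
       (auto intro!: derivative_eq_intros simp: inj_on_def)
  thus "(\<lambda>t. (cmod (f (t - h)))\<^sup>2) integrable_on {..<T}"
    by (simp add: set_lebesgue_integral_eq_integral(1))
qed

lemma L2t_lincomb2:
  assumes "L2t T f" "L2t T g"
  shows "L2t T (\<lambda>t. a * f t + b * g t)"
  using assms unfolding L2t_def
  by (auto intro!: continuous_intros square_integrable_lincomb2)

lemma exp_decay_add:
  assumes "exp_decay T f" "exp_decay T g" "T \<le> 0"
  shows "exp_decay T (\<lambda>t. f t + g t)"
proof -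
  obtain \<delta>1 B1 where 1: "\<delta>1 > 0" "\<And>t. t < T \<Longrightarrow> cmod (f t) \<le> B1 * exp (\<delta>1 * t)"
    using assms(1) unfolding exp_decay_def by blast
  obtain \<delta>2 B2 where 2: "\<delta>2 > 0" "\<And>t. t < T \<Longrightarrow> cmod (g t) \<le> B2 * exp (\<delta>2 * t)"
    using assms(2) unfolding exp_decay_def by blast
  define \<delta> where "\<delta> = min \<delta>1 \<delta>2"
  have "cmod (f t + g t) \<le> (\<bar>B1\<bar> + \<bar>B2\<bar>) * exp (\<delta> * t)" if "t < T" for t
  proof -
    have "cmod (f t + g t) \<le> B1 * exp (\<delta>1 * t) + B2 * exp (\<delta>2 * t)"
      using 1(2)[OF that] 2(2)[OF that] norm_triangle_ineq[of "f t" "g t"] by linarith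
    also have "\<dots> \<le> \<bar>B1\<bar> * exp (\<delta> * t) + \<bar>B2\<bar> * exp (\<delta> * t)"
      using that assms(3) by (intro add_mono mult_mono) (auto simp: \<delta>_def intro!: mult_right_mono_neg)
    finally show ?thesis by (simp add: distrib_right)
  qed
  moreover have "\<delta> > 0" using 1 2 by (simp add: \<delta>_def)
  ultimately show ?thesis unfolding exp_decay_def by blast
qed

lemma exp_decay_cmult:
  assumes "exp_decay T f"
  shows "exp_decay T (\<lambda>t. a * f t)"
proof -
  obtain \<delta> B where 1: "\<delta> > 0" "\<And>t. t < T \<Longrightarrow> cmod (f t) \<le> B * exp (\<delta> * t)"
    using assms(1) unfolding exp_decay_def by blast
  have "cmod (a * f t) \<le> (cmod a * B) * exp (\<delta> * t)" if "t < T" for t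
    using mult_left_mono[OF 1(2)[OF that], of "cmod a"] by (simp add: norm_mult mult_ac)
  thus ?thesis using 1(1) unfolding exp_decay_def by blast
qed

lemma exp_decay_shift:
  assumes "exp_decay T f" "h \<ge> 0"
  shows "exp_decay T (\<lambda>t. f (t - h))"
proof -
  obtain \<delta> B where 1: "\<delta> > 0" "\<And>t. t < T \<Longrightarrow> cmod (f t) \<le> B * exp (\<delta> * t)"
    using assms(1) unfolding exp_decay_def by blast
  have "cmod (f (t - h)) \<le> (B * exp (- \<delta> * h)) * exp (\<delta> * t)" if "t < T" for t
    using 1(2)[of "t - h"] that assms(2) by (simp add: algebra_simps exp_diff exp_minus field_simps)
  thus ?thesis using 1(1) unfolding exp_decay_def by blast
qed

lemma exp_decay_sum:
  assumes "finite J" "\<And>j. j \<in> J \<Longrightarrow> exp_decay T (f j)" "T \<le> 0"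
  shows "exp_decay T (\<lambda>t. \<Sum>j\<in>J. f j t)"
  using assms
proof (induction J rule: finite_induct)
  case empty
  show ?case unfolding exp_decay_def by (intro exI[of _ 1] conjI exI[of _ 0]) auto
qed (simp add: exp_decay_add)

text \<open>Far to the left the remainder is below |b|/2, so |f| stays above |b|/2 on an infinite
  half line.\<close>

lemma oscillation_not_L2t:
  assumes f: "\<And>t. t < T \<Longrightarrow> f t = b * exp (\<i> * of_real (\<omega> * t)) + r t"
    and L2: "L2t T f" and r: "exp_decay T r"
  shows "b = 0"
proof (rule ccontr)
  assume b: "b \<noteq> 0"
  obtain \<delta> B where B: "\<delta> > 0" "\<And>t. t < T \<Longrightarrow> cmod (r t) \<le> B * exp (\<delta> * t)"
    using r unfolding exp_decay_def by blast
  \<comment> \<open>Chosen so that (|B| + 1) q = |b|/2; \<open>t2\<close> is then a point left of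
    which exp(\<delta> t) \<le> q.\<close>
  define q where "q = cmod b / (2 * (\<bar>B\<bar> + 1))"
  have q: "q > 0" using b by (simp add: q_def)
  define t2 where "t2 = min (T - 1) (ln q / \<delta>)"
  define m where "m = (cmod b / 2)\<^sup>2"
  have m: "m > 0" using b by (simp add: m_def)
  have low: "m \<le> (cmod (f t))\<^sup>2" if "t \<le> t2" for t
  proof -
    have t: "t < T" "\<delta> * t \<le> ln q"
      using that B(1) by (auto simp: t2_def field_simps)
    have "cmod (r t) \<le> B * exp (\<delta> * t)" by (rule B(2)[OF t(1)])
    also have "\<dots> \<le> (\<bar>B\<bar> + 1) * q"
      using t(2) q by (intro mult_mono) (auto simp: ln_ge_iff)
    also have "\<dots> = cmod b / 2"
    proof -
      have *: "w * (x / (2 * w)) = x / 2" if "w \<noteq> 0" for w x :: real using that by simp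
      have "\<bar>B\<bar> + 1 \<noteq> 0" by linarith
      from *[OF this, of "cmod b"] show ?thesis by (simp only: q_def)
    qed
    finally have "cmod (r t) \<le> cmod b / 2" .
    moreover have "cmod b = cmod (b * exp (\<i> * of_real (\<omega> * t)))"
      by (simp add: norm_mult)
    hence "cmod b \<le> cmod (f t) + cmod (r t)"
      using norm_triangle_ineq4[of "f t" "r t"] f[OF t(1)] by simp
    ultimately have "cmod b / 2 \<le> cmod (f t)" by simp
    thus ?thesis unfolding m_def by (intro power_mono) auto
  qed
  define I where "I = integral {..<T} (\<lambda>t. (cmod (f t))\<^sup>2)"
  have int: "(\<lambda>t. (cmod (f t))\<^sup>2) integrable_on {..<T}" using L2 by (simp add: L2t_def)
  have I: "I \<ge> 0" unfolding I_def by (rule integral_nonneg[OF int]) simp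
  \<comment> \<open>An interval of this length left of \<open>t2\<close> already contributes I + 1,
    more than the whole integral I.\<close>
  define K where "K = (I + 1) / m"
  have K: "K > 0" using I m by (simp add: K_def)
  have sub: "{t2 - K..t2} \<subseteq> {..<T}" by (auto simp: t2_def)
  have cont: "continuous_on {t2 - K..t2} (\<lambda>t. (cmod (f t))\<^sup>2)"
    using L2 sub unfolding L2t_def by (intro continuous_intros) (auto intro: continuous_on_subset)
  have int2: "(\<lambda>t. (cmod (f t))\<^sup>2) integrable_on {t2 - K..t2}"
    by (rule integrable_continuous_real[OF cont])
  have "I + 1 = integral {t2 - K..t2} (\<lambda>_. m)" using K m by (simp add: K_def)
  also have "\<dots> \<le> integral {t2 - K..t2} (\<lambda>t. (cmod (f t))\<^sup>2)"
    by (rule integral_le[OF _ int2]) (use low in auto)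
  also have "\<dots> \<le> I" unfolding I_def
    by (rule integral_subset_le[OF sub int2 int]) simp
  finally show False by simp
qed

text \<open>The value at 0 is taken at every point -kh, hence infinitely often.\<close>

lemma poly_shift_invariant:
  fixes p :: "complex poly"
  assumes "pcompose p [:- h, 1:] = p" "h \<noteq> 0"
  shows "p = [:poly p 0:]"
proof (rule ccontr)
  assume "p \<noteq> [:poly p 0:]"
  hence fin: "finite {x. poly (p - [:poly p 0:]) x = 0}"
    by (intro poly_roots_finite) auto
  have step: "poly p (x - h) = poly p x" for x
    using arg_cong[OF assms(1), of "\<lambda>q. poly q x"] by (simp add: poly_pcompose)
  have "poly p (- of_nat k * h) = poly p 0" for k
  proof (induction k)
    case (Suc k)
    have "- of_nat (Suc k) * h = - of_nat k * h - h" by (simp add: algebra_simps)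
    thus ?case using Suc step[of "- of_nat k * h"] by (simp only:)
  qed simp
  hence "range (\<lambda>k::nat. - of_nat k * h) \<subseteq> {x. poly (p - [:poly p 0:]) x = 0}" by auto
  moreover have "inj (\<lambda>k::nat. - of_nat k * h)" using assms(2) by (auto simp: inj_def)
  ultimately show False using fin finite_subset range_inj_infinite by blast
qed

lemma distinct_frequencies:
  fixes W :: "real set"
  assumes "finite W"
  obtains h :: real where "h > 0"
    "\<And>\<omega> \<omega>'. \<omega> \<in> W \<Longrightarrow> \<omega>' \<in> W \<Longrightarrow>
       exp (- \<i> * of_real (\<omega> * h)) = exp (- \<i> * of_real (\<omega>' * h)) \<Longrightarrow> \<omega> = \<omega>'"
proof -
  define S where "S = (\<Sum>\<omega>\<in>W. \<bar>\<omega>\<bar>)"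
  have S: "S \<ge> 0" "\<And>\<omega>. \<omega> \<in> W \<Longrightarrow> \<bar>\<omega>\<bar> \<le> S"
    using assms by (auto simp: S_def intro!: sum_nonneg member_le_sum)
  \<comment> \<open>With this step all |\<omega>| h are below 1, so two phases differ by less than 2
    and cannot differ by a nonzero multiple of 2 pi.\<close>
  define h where "h = 1 / (1 + S)"
  have h: "h > 0" "h * S < 1" using S by (auto simp: h_def)
  have "\<omega> = \<omega>'" if "\<omega> \<in> W" "\<omega>' \<in> W"
    "exp (- \<i> * of_real (\<omega> * h)) = exp (- \<i> * of_real (\<omega>' * h))" for \<omega> \<omega>'
  proof -
    from that(3) obtain n :: int where n: "- \<i> * of_real (\<omega> * h) = - \<i> * of_real (\<omega>' * h) + of_int (2 * n) * pi * \<i>"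
      unfolding exp_eq by auto
    have eq: "- (\<omega> * h) = - (\<omega>' * h) + 2 * of_int n * pi" using arg_cong[OF n, of Im] by simp
    have "\<bar>\<omega> * h\<bar> \<le> S * h" "\<bar>\<omega>' * h\<bar> \<le> S * h"
      using mult_right_mono[OF S(2)[OF that(1)], of h] mult_right_mono[OF S(2)[OF that(2)], of h] h(1)
      by (simp_all add: abs_mult)
    hence "\<bar>\<omega> * h\<bar> < 1" "\<bar>\<omega>' * h\<bar> < 1" using h(2) by (simp_all add: mult.commute)
    hence "\<bar>2 * of_int n * pi\<bar> < 2" using eq by linarith
    hence "\<bar>of_int n\<bar> * pi < 1" by (simp add: abs_mult)
    have "n = 0"
    proof (rule ccontr)
      assume "n \<noteq> 0"
      hence "\<bar>real_of_int n\<bar> \<ge> 1" by linarith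
      hence "\<bar>of_int n\<bar> * pi \<ge> 1 * pi" by (intro mult_right_mono) auto
      thus False using \<open>\<bar>of_int n\<bar> * pi < 1\<close> pi_gt3 by linarith
    qed
    thus ?thesis using eq h by simp
  qed
  thus ?thesis using that h by blast
qed

text \<open>The difference f(t - h) - e(\<omega>0) f(t) stays square integrable up to a decaying
  remainder. It lowers the degree at \<omega>0 and multiplies the leading coefficient at any other
  \<omega> by e(\<omega>) - e(\<omega>0), so the total size of the polynomials drops and induction
  applies to it.\<close>

lemma quasi_polynomial_not_L2t:
  assumes "finite W" "T \<le> 0"
    and "\<And>t. t < T \<Longrightarrow> f t = (\<Sum>\<omega>\<in>W. exp (\<i> * of_real (\<omega> * t)) * poly (Q \<omega>) (of_real t)) + r t"
    and "L2t T f" "exp_decay T r"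
  shows "\<forall>\<omega>\<in>W. Q \<omega> = 0"
  using assms(3-)
proof (induction "\<Sum>\<omega>\<in>W. if Q \<omega> = 0 then 0 else Suc (degree (Q \<omega>))" arbitrary: f Q r rule: less_induct)
  case (less Q f r)
  show ?case
  proof (rule ccontr)
    assume "\<not> (\<forall>\<omega>\<in>W. Q \<omega> = 0)"
    then obtain \<omega>0 where \<omega>0: "\<omega>0 \<in> W" "Q \<omega>0 \<noteq> 0" by blast
    obtain h where h: "h > 0" and inj: "\<And>\<omega> \<omega>'. \<omega> \<in> W \<Longrightarrow> \<omega>' \<in> W \<Longrightarrow>
       exp (- \<i> * of_real (\<omega> * h)) = exp (- \<i> * of_real (\<omega>' * h)) \<Longrightarrow> \<omega> = \<omega>'"
      using distinct_frequencies[OF assms(1)] by blast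
    define e where "e \<omega> = exp (- \<i> * of_real (\<omega> * h))" for \<omega>
    have e0: "e \<omega> \<noteq> 0" for \<omega> by (simp add: e_def)
    define S where "S p = pcompose p [:- complex_of_real h, 1:]" for p
    define Q2 where "Q2 \<omega> = smult (e \<omega>) (S (Q \<omega>)) - smult (e \<omega>0) (Q \<omega>)" for \<omega>
    define f2 where "f2 t = 1 * f (t - h) + (- e \<omega>0) * f t" for t
    define r2 where "r2 t = r (t - h) + (- e \<omega>0) * r t" for t
    have top: "coeff (S p) (degree p) = lead_coeff p" "degree (S p) = degree p" for p
      unfolding S_def using lead_coeff_comp[of "[:- complex_of_real h, 1:]" p]
      by (simp_all add: degree_pcompose)
    have deg2: "degree (Q2 \<omega>) \<le> degree (Q \<omega>)" for \<omega>
      unfolding Q2_def by (intro degree_diff_le order.trans[OF degree_smult_le]) (simp_all add: top)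
    have coeff2: "coeff (Q2 \<omega>) (degree (Q \<omega>)) = (e \<omega> - e \<omega>0) * lead_coeff (Q \<omega>)" for \<omega>
      unfolding Q2_def by (simp add: top algebra_simps)
    have le: "(if Q2 \<omega> = 0 then 0 else Suc (degree (Q2 \<omega>))) \<le> (if Q \<omega> = 0 then 0 else Suc (degree (Q \<omega>)))" for \<omega>
      using deg2[of \<omega>] by (auto simp: Q2_def S_def)
    have "Q2 \<omega>0 \<noteq> 0 \<Longrightarrow> degree (Q2 \<omega>0) \<noteq> degree (Q \<omega>0)"
      using coeff2[of \<omega>0] by (metis diff_self leading_coeff_0_iff mult_zero_left)
    hence lt: "(if Q2 \<omega>0 = 0 then 0 else Suc (degree (Q2 \<omega>0))) < (if Q \<omega>0 = 0 then 0 else Suc (degree (Q \<omega>0)))"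
      using deg2[of \<omega>0] \<omega>0 by auto
    have "\<forall>\<omega>\<in>W. Q2 \<omega> = 0"
    proof (rule less.hyps)
      show "(\<Sum>\<omega>\<in>W. if Q2 \<omega> = 0 then 0 else Suc (degree (Q2 \<omega>)))
            < (\<Sum>\<omega>\<in>W. if Q \<omega> = 0 then 0 else Suc (degree (Q \<omega>)))"
        by (rule sum_strict_mono_ex1) (use assms(1) le lt \<omega>0 in auto)
      show "L2t T f2" unfolding f2_def
        by (rule L2t_lincomb2[OF L2t_shift]) (use less.prems h in auto)
      show "exp_decay T r2" unfolding r2_def
        by (intro exp_decay_add exp_decay_shift exp_decay_cmult assms less.prems) (use h in auto)
      fix t assume t: "t < T"
      have fh: "f (t - h) = (\<Sum>\<omega>\<in>W. exp (\<i> * of_real (\<omega> * t)) * (e \<omega> * poly (S (Q \<omega>)) (of_real t))) + r (t - h)"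
      proof -
        have "exp (\<i> * of_real (\<omega> * (t - h))) = exp (\<i> * of_real (\<omega> * t)) * e \<omega>" for \<omega>
          by (simp add: e_def algebra_simps flip: exp_add)
        moreover have "poly (S p) (of_real t) = poly p (of_real (t - h))" for p
          by (simp add: S_def poly_pcompose)
        ultimately show ?thesis using less.prems(1)[of "t - h"] t h
          by (simp only: mult.assoc)
      qed
      thus "f2 t = (\<Sum>\<omega>\<in>W. exp (\<i> * of_real (\<omega> * t)) * poly (Q2 \<omega>) (of_real t)) + r2 t"
      proof -
        have "(\<Sum>\<omega>\<in>W. exp (\<i> * of_real (\<omega> * t)) * poly (Q2 \<omega>) (of_real t)) =
              (\<Sum>\<omega>\<in>W. exp (\<i> * of_real (\<omega> * t)) * (e \<omega> * poly (S (Q \<omega>)) (of_real t)) -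
                e \<omega>0 * (exp (\<i> * of_real (\<omega> * t)) * poly (Q \<omega>) (of_real t)))"
          by (intro sum.cong refl) (simp add: Q2_def right_diff_distrib mult.left_commute)
        also have "\<dots> = (f (t - h) - r (t - h)) - e \<omega>0 * (f t - r t)"
          unfolding sum_subtractf sum_distrib_left[symmetric] using fh less.prems(1)[OF t] by simp
        finally show ?thesis by (simp add: f2_def r2_def algebra_simps)
      qed
    qed
    hence Q20: "Q2 \<omega> = 0" if "\<omega> \<in> W" for \<omega> using that by blast
    \<comment> \<open>For \<omega> \<noteq> \<omega>0 the factor e(\<omega>) - e(\<omega>0) is
      nonzero, so vanishing of \<open>Q2\<close> forces the leading coefficient of \<open>Q\<close>
      to vanish. Only the frequency \<omega>0 survives, with a shift-invariant and hence constant
      polynomial.\<close>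
    have Q0: "Q \<omega> = 0" if "\<omega> \<in> W" "\<omega> \<noteq> \<omega>0" for \<omega>
      using coeff2[of \<omega>] Q20[OF that(1)] inj[OF that(1) \<omega>0(1)] that(2) by (auto simp: e_def)
    have "S (Q \<omega>0) = Q \<omega>0" using Q20[OF \<omega>0(1)] e0[of \<omega>0]
      by (simp add: Q2_def flip: smult_diff_right)
    hence const: "Q \<omega>0 = [:poly (Q \<omega>0) 0:]"
      unfolding S_def by (rule poly_shift_invariant) (use h in simp)
    have "poly (Q \<omega>0) 0 = 0"
    proof (rule oscillation_not_L2t[where f = f and T = T and r = r and \<omega> = \<omega>0])
      fix t assume t: "t < T"
      have "(\<Sum>\<omega>\<in>W. exp (\<i> * of_real (\<omega> * t)) * poly (Q \<omega>) (of_real t)) =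
            (\<Sum>\<omega>\<in>{\<omega>0}. exp (\<i> * of_real (\<omega> * t)) * poly (Q \<omega>) (of_real t))"
        by (rule sum.mono_neutral_right) (use assms(1) \<omega>0 Q0 in auto)
      also have "\<dots> = poly (Q \<omega>0) 0 * exp (\<i> * of_real (\<omega>0 * t))"
        using arg_cong[OF const, of "\<lambda>p. poly p (of_real t)"] by simp
      finally show "f t = poly (Q \<omega>0) 0 * exp (\<i> * of_real (\<omega>0 * t)) + r t"
        using less.prems(1)[OF t] by simp
    qed (use less.prems in auto)
    thus False using const \<omega>0 by simp
  qed
qed

section \<open>Independence and integrability of Frobenius solutions\<close>

text \<open>Gaussian elimination, one equation at a time: the last equation is solved for an unknown
  j0 with nonzero coefficient, and \<open>u\<close> holds the reduced system.\<close>

lemma homogeneous_system_nontrivial: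
  fixes v :: "'j \<Rightarrow> nat \<Rightarrow> complex"
  assumes "finite J" "M < card J"
  shows "\<exists>a. (\<exists>j\<in>J. a j \<noteq> 0) \<and> (\<forall>i<M. (\<Sum>j\<in>J. a j * v j i) = 0)"
  using assms
proof (induction M arbitrary: J v)
  case 0
  hence "J \<noteq> {}" by auto
  thus ?case by (intro exI[of _ "\<lambda>_. 1"]) auto
next
  case (Suc M)
  show ?case
  proof (cases "\<forall>j\<in>J. v j M = 0")
    case True
    obtain a where "\<exists>j\<in>J. a j \<noteq> 0" "\<forall>i<M. (\<Sum>j\<in>J. a j * v j i) = 0"
      using Suc.IH[of J v] Suc.prems by auto
    thus ?thesis using True by (intro exI[of _ a]) (auto simp: less_Suc_eq)
  next
    case False
    then obtain j0 where j0: "j0 \<in> J" "v j0 M \<noteq> 0" by blast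
    define u where "u j i = v j i - v j M / v j0 M * v j0 i" for j i
    have "M < card (J - {j0})" using Suc.prems j0 by simp
    then obtain a where a: "\<exists>j\<in>J - {j0}. a j \<noteq> 0" "\<forall>i<M. (\<Sum>j\<in>J - {j0}. a j * u j i) = 0"
      using Suc.IH[of "J - {j0}" u] Suc.prems by auto
    define b where "b = a(j0 := - (\<Sum>j\<in>J - {j0}. a j * (v j M / v j0 M)))"
    have eq: "(\<Sum>j\<in>J. b j * v j i) = (\<Sum>j\<in>J - {j0}. a j * u j i)" for i
    proof -
      have "(\<Sum>j\<in>J. b j * v j i) = b j0 * v j0 i + (\<Sum>j\<in>J - {j0}. b j * v j i)"
        using Suc.prems j0 by (intro sum.remove) auto
      also have "(\<Sum>j\<in>J - {j0}. b j * v j i) = (\<Sum>j\<in>J - {j0}. a j * v j i)"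
        by (intro sum.cong) (auto simp: b_def)
      also have "b j0 * v j0 i = - (\<Sum>j\<in>J - {j0}. a j * (v j M / v j0 M * v j0 i))"
        by (simp add: b_def sum_distrib_right mult.assoc)
      finally show ?thesis by (simp add: u_def right_diff_distrib sum_subtractf)
    qed
    have "u j M = 0" for j using j0 by (simp add: u_def)
    hence "\<forall>i<Suc M. (\<Sum>j\<in>J. b j * v j i) = 0"
      using a(2) by (auto simp: eq less_Suc_eq)
    moreover have "\<exists>j\<in>J. b j \<noteq> 0" using a(1) by (auto simp: b_def)
    ultimately show ?thesis by blast
  qed
qed

lemma power_le_exp:
  fixes \<eta> t :: real
  assumes "\<eta> > 0" "t \<le> 0"
  shows "\<bar>t\<bar> ^ m \<le> fact m / \<eta> ^ m * exp (- \<eta> * t)"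
proof -
  have "(- \<eta> * t) ^ m / fact m \<le> exp (- \<eta> * t)"
    using sum_le_suminf[OF summable_exp[of "- \<eta> * t"], of "{m}"] assms
    by (auto simp: exp_def scaleR_conv_of_real field_simps mult_nonneg_nonpos)
  moreover have "(- \<eta> * t) ^ m = \<eta> ^ m * \<bar>t\<bar> ^ m"
    using assms by (simp flip: power_mult_distrib)
  ultimately show ?thesis using assms by (simp add: field_simps)
qed

text \<open>The power of t costs an arbitrarily small part of the exponent.\<close>

lemma quasi_monomial_bound:
  assumes Y: "\<And>t. t \<le> 0 \<Longrightarrow> cmod (y t - exp (z * of_real t) * of_real t ^ m) \<le> B * exp ((Re z + 1) * t)"
    and \<rho>: "\<rho> < Re z"
  shows "\<exists>C. \<forall>t\<le>0. cmod (y t) \<le> C * exp (\<rho> * t)"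
proof -
  define \<eta> where "\<eta> = Re z - \<rho>"
  have \<eta>: "\<eta> > 0" using \<rho> by (simp add: \<eta>_def)
  have "cmod (y t) \<le> (fact m / \<eta> ^ m + \<bar>B\<bar>) * exp (\<rho> * t)" if t: "t \<le> 0" for t
  proof -
    have "cmod (y t) \<le> cmod (exp (z * of_real t) * of_real t ^ m) + B * exp ((Re z + 1) * t)"
      using Y[OF t] norm_triangle_ineq2[of "y t" "exp (z * of_real t) * of_real t ^ m"] by linarith
    also have "cmod (exp (z * of_real t) * of_real t ^ m) = exp (Re z * t) * \<bar>t\<bar> ^ m"
      by (simp add: norm_mult norm_power)
    also have "\<dots> \<le> exp (Re z * t) * (fact m / \<eta> ^ m * exp (- \<eta> * t))"
      by (intro mult_left_mono power_le_exp \<eta> t) auto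
    also have "\<dots> = fact m / \<eta> ^ m * exp (\<rho> * t)"
      by (simp add: \<eta>_def algebra_simps flip: exp_add)
    also have "B * exp ((Re z + 1) * t) \<le> \<bar>B\<bar> * exp (\<rho> * t)"
      using t \<rho> by (intro mult_mono) (auto intro!: mult_right_mono_neg)
    finally show ?thesis by (simp add: distrib_right)
  qed
  thus ?thesis by blast
qed

text \<open>The form of the last hypothesis serves two purposes: a combination that vanishes
  satisfies it trivially, which gives independence, and a square-integrable combination satisfies it
  when all Re z \<le> -1/2. Take the least real part \<rho> among the nonzero coefficients and
  divide by exp(\<rho> t): the leading terms with Re z = \<rho> form a quasi-polynomial with real
  frequencies, and everything else decays.\<close>

lemma frobenius_independent:
  fixes Y :: "complex \<times> nat \<Rightarrow> real \<Rightarrow> complex" and a :: "complex \<times> nat \<Rightarrow> complex"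
  assumes J: "finite J" and T: "T \<le> 0"
    and asym: "\<And>z m. (z, m) \<in> J \<Longrightarrow> \<exists>B. \<forall>t\<le>0. cmod (Y (z, m) (exp t) - exp (z * of_real t) * of_real t ^ m)
                 \<le> B * exp ((Re z + 1) * t)"
    and L2: "\<And>z m. (z, m) \<in> J \<Longrightarrow> L2t T (\<lambda>t. exp (- of_real (Re z * t)) * (\<Sum>j\<in>J. a j * Y j (exp t)))"
  shows "\<forall>j\<in>J. a j = 0"
proof (rule ccontr)
  assume "\<not> (\<forall>j\<in>J. a j = 0)"
  define J' where "J' = {j \<in> J. a j \<noteq> 0}"
  have J': "finite J'" "J' \<noteq> {}" "J' \<subseteq> J" using J \<open>\<not> _\<close> by (auto simp: J'_def)
  define \<rho> where "\<rho> = Min ((\<lambda>j. Re (fst j)) ` J')"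
  have \<rho>_le: "\<rho> \<le> Re (fst j)" if "j \<in> J'" for j
    using J' that by (auto simp: \<rho>_def)
  have "\<rho> \<in> (\<lambda>j. Re (fst j)) ` J'" unfolding \<rho>_def using J' by (intro Min_in) auto
  then obtain z0 m0 where j0: "(z0, m0) \<in> J'" "Re z0 = \<rho>" by force
  define J1 where "J1 = {j \<in> J'. Re (fst j) = \<rho>}"
  have J1: "finite J1" using J' by (simp add: J1_def)
  define W where "W = (\<lambda>j. Im (fst j)) ` J1"
  define Q where "Q \<omega> = (\<Sum>j\<in>{j \<in> J1. Im (fst j) = \<omega>}. monom (a j) (snd j))" for \<omega>
  define f where "f t = exp (- of_real (\<rho> * t)) * (\<Sum>j\<in>J. a j * Y j (exp t))" for t :: real
  define lead where "lead j t = (if Re (fst j) = \<rho> then exp (\<i> * of_real (Im (fst j) * t)) * of_real t ^ snd j else 0)"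
    for j :: "complex \<times> nat" and t :: real
  define r where "r t = (\<Sum>j\<in>J'. a j * (exp (- of_real (\<rho> * t)) * Y j (exp t) - lead j t))" for t :: real
  have lead_sum: "(\<Sum>j\<in>J'. a j * lead j t) = (\<Sum>\<omega>\<in>W. exp (\<i> * of_real (\<omega> * t)) * poly (Q \<omega>) (of_real t))" for t
  proof -
    have "(\<Sum>j\<in>J'. a j * lead j t) = (\<Sum>j\<in>J1. a j * (exp (\<i> * of_real (Im (fst j) * t)) * of_real t ^ snd j))"
      using J' by (intro sum.mono_neutral_cong_right) (auto simp: J1_def lead_def)
    also have "\<dots> = (\<Sum>\<omega>\<in>W. \<Sum>j\<in>{j \<in> J1. Im (fst j) = \<omega>}. a j * (exp (\<i> * of_real (Im (fst j) * t)) * of_real t ^ snd j))"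
      by (rule sum.group[symmetric]) (use J1 in \<open>auto simp: W_def\<close>)
    also have "\<dots> = (\<Sum>\<omega>\<in>W. exp (\<i> * of_real (\<omega> * t)) * poly (Q \<omega>) (of_real t))"
      unfolding Q_def poly_sum poly_monom sum_distrib_left by (intro sum.cong refl) (auto simp: mult_ac)
    finally show ?thesis .
  qed
  have "\<forall>\<omega>\<in>W. Q \<omega> = 0"
  proof (rule quasi_polynomial_not_L2t)
    show "finite W" using J1 by (simp add: W_def)
    show "L2t T f" using L2[of z0 m0] j0 J' unfolding f_def[abs_def] by auto
    show "exp_decay T r" unfolding r_def[abs_def]
    proof (intro exp_decay_sum exp_decay_cmult)
      fix j assume j: "j \<in> J'"
      obtain z m where zm: "j = (z, m)" by (cases j)
      obtain B where B: "\<And>t. t \<le> 0 \<Longrightarrow> cmod (Y j (exp t) - exp (z * of_real t) * of_real t ^ m) \<le> B * exp ((Re z + 1) * t)"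
        using asym[of z m] j J' zm by blast
      show "exp_decay T (\<lambda>t. exp (- of_real (\<rho> * t)) * Y j (exp t) - lead j t)"
      proof (cases "Re z = \<rho>")
        case True
        have "cmod (exp (- of_real (\<rho> * t)) * Y j (exp t) - lead j t) \<le> B * exp (1 * t)" if "t < T" for t
        proof -
          have "- of_real (\<rho> * t) + z * of_real t = \<i> * of_real (Im z * t)"
            using True by (simp add: complex_eq_iff)
          hence "exp (- of_real (\<rho> * t)) * exp (z * of_real t) = exp (\<i> * of_real (Im z * t))"
            by (simp only: exp_add[symmetric])
          hence "exp (- of_real (\<rho> * t)) * Y j (exp t) - lead j t =
                exp (- of_real (\<rho> * t)) * (Y j (exp t) - exp (z * of_real t) * of_real t ^ m)"
            using True by (simp add: lead_def zm right_diff_distrib flip: mult.assoc)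
          hence "cmod (exp (- of_real (\<rho> * t)) * Y j (exp t) - lead j t) =
                exp (- \<rho> * t) * cmod (Y j (exp t) - exp (z * of_real t) * of_real t ^ m)"
            by (simp add: norm_mult)
          also have "\<dots> \<le> exp (- \<rho> * t) * (B * exp ((Re z + 1) * t))"
            using that T by (intro mult_left_mono B) auto
          also have "\<dots> = B * exp (1 * t)" using True by (simp add: algebra_simps flip: exp_add)
          finally show ?thesis .
        qed
        thus ?thesis unfolding exp_decay_def by (intro exI[of _ 1] conjI exI[of _ B]) auto
      next
        case False
        hence lt: "\<rho> < Re z" using \<rho>_le[OF j] zm by simp
        \<comment> \<open>Half of the gap between Re z and \<rho> pays for the power of t; the other
          half remains as decay.\<close>
        define \<eta> where "\<eta> = (Re z - \<rho>) / 2"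
        have \<eta>: "\<eta> > 0" "\<rho> + \<eta> < Re z" using lt by (simp_all add: \<eta>_def field_simps)
        obtain C where C: "\<And>t. t \<le> 0 \<Longrightarrow> cmod (Y j (exp t)) \<le> C * exp ((\<rho> + \<eta>) * t)"
          using quasi_monomial_bound[of "\<lambda>t. Y j (exp t)" z m B "\<rho> + \<eta>"] B \<eta> by blast
        have "cmod (exp (- of_real (\<rho> * t)) * Y j (exp t) - lead j t) \<le> C * exp (\<eta> * t)" if "t < T" for t
        proof -
          have "cmod (exp (- of_real (\<rho> * t)) * Y j (exp t) - lead j t) = exp (- \<rho> * t) * cmod (Y j (exp t))"
            using False by (simp add: lead_def zm norm_mult)
          also have "\<dots> \<le> exp (- \<rho> * t) * (C * exp ((\<rho> + \<eta>) * t))"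
            using that T by (intro mult_left_mono C) auto
          also have "\<dots> = C * exp (\<eta> * t)" by (simp add: algebra_simps flip: exp_add)
          finally show ?thesis .
        qed
        thus ?thesis using \<eta> unfolding exp_decay_def by blast
      qed
    qed (use J' T in auto)
    fix t assume "t < T"
    have "f t = (\<Sum>j\<in>J. a j * (exp (- of_real (\<rho> * t)) * Y j (exp t)))"
      unfolding f_def sum_distrib_left by (intro sum.cong) (auto simp: mult_ac)
    also have "\<dots> = (\<Sum>j\<in>J'. a j * (exp (- of_real (\<rho> * t)) * Y j (exp t)))"
      using J by (intro sum.mono_neutral_right) (auto simp: J'_def)
    also have "\<dots> = (\<Sum>j\<in>J'. a j * lead j t) + r t"
      unfolding r_def sum.distrib[symmetric] by (intro sum.cong) (auto simp: algebra_simps)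
    finally show "f t = (\<Sum>\<omega>\<in>W. exp (\<i> * of_real (\<omega> * t)) * poly (Q \<omega>) (of_real t)) + r t"
      by (simp add: lead_sum)
  qed (use T in auto)
  moreover have "(z0, m0) \<in> J1" using j0 by (simp add: J1_def)
  ultimately have "Q (Im z0) = 0" unfolding W_def by force
  \<comment> \<open>Within J1 the imaginary part determines the root, and different m give different
    powers, so each coefficient of \<open>Q\<close> is a single value of \<open>a\<close>.\<close>
  hence "0 = coeff (Q (Im z0)) m0" by simp
  also have "\<dots> = (\<Sum>j\<in>{j \<in> J1. Im (fst j) = Im z0}. if snd j = m0 then a j else 0)"
    by (simp add: Q_def coeff_sum)
  also have "\<dots> = (\<Sum>j\<in>{(z0, m0)}. a j)"
    using J' \<open>(z0, m0) \<in> J1\<close> j0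
    by (intro sum.mono_neutral_cong_right) (auto simp: J1_def complex_eq_iff)
  finally show False using j0 by (simp add: J'_def)
qed

text \<open>The threshold -1/2 arises here: dx = exp(t) dt under x = exp(t), and exp(-2 \<rho> t)
  \<le> exp(t) for t \<le> 0 when \<rho> \<le> -1/2.\<close>

lemma L2t_of_is_L2_on:
  assumes y: "continuous_on {0<..<d} y" "is_L2_on d y" and d: "d > 0"
    and \<rho>: "\<rho> \<le> -1/2" and T: "T \<le> 0" "T \<le> ln d"
  shows "L2t T (\<lambda>t. exp (- of_real (\<rho> * t)) * y (exp t))"
proof -
  have sub: "exp t \<in> {0<..<d}" if "t < T" for t
  proof -
    have "exp t < exp (ln d)" using that T by simp
    thus ?thesis using d by simp
  qed
  have img: "exp ` {..<T} = {0<..<exp T}"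
  proof (intro equalityI subsetI)
    fix x assume "x \<in> {0<..<exp T}"
    hence "x > 0" "ln x < ln (exp T)" by (simp_all only: ln_less_cancel_iff greaterThanLessThan_iff exp_gt_zero)
    thus "x \<in> exp ` {..<T}" by (intro image_eqI[of _ _ "ln x"]) auto
  qed auto
  have "(\<lambda>x. (cmod (y x))\<^sup>2) absolutely_integrable_on {0<..<d}"
    using y unfolding is_L2_on_def by (intro nonnegative_absolutely_integrable_1) auto
  hence "(\<lambda>x. (cmod (y x))\<^sup>2) absolutely_integrable_on {0<..<exp T}"
  proof (rule set_integrable_subset)
    have "exp T \<le> d" using T d by (simp add: ln_ge_iff)
    thus "{0<..<exp T} \<subseteq> {0<..<d}" by auto
  qed auto
  hence "(\<lambda>t. \<bar>exp t\<bar> *\<^sub>R (cmod (y (exp t)))\<^sup>2) absolutely_integrable_on {..<T}"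
    unfolding img[symmetric]
    by (subst (asm) absolutely_integrable_change_of_variables_real[where h = exp])
       (auto intro!: derivative_eq_intros simp: inj_on_def)
  hence int: "(\<lambda>t. exp t * (cmod (y (exp t)))\<^sup>2) integrable_on {..<T}"
    by (simp add: set_lebesgue_integral_eq_integral(1))
  have cont: "continuous_on {..<T} (\<lambda>t. exp (- of_real (\<rho> * t)) * y (exp t))"
    using sub by (intro continuous_intros continuous_on_compose2[OF y(1)]) auto
  have "(\<lambda>t. (cmod (exp (- of_real (\<rho> * t)) * y (exp t)))\<^sup>2) integrable_on {..<T}"
  proof (rule square_integrable_bound[OF cont _ int])
    fix t assume t: "t \<in> {..<T}"
    have "(cmod (exp (- of_real (\<rho> * t)) * y (exp t)))\<^sup>2 = exp (2 * (- \<rho> * t)) * (cmod (y (exp t)))\<^sup>2"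
      unfolding exp_double by (simp add: norm_mult power_mult_distrib)
    also have "\<dots> \<le> exp t * (cmod (y (exp t)))\<^sup>2"
    proof -
      have "(- 2 * \<rho>) * t \<le> 1 * t" using t T \<rho> by (intro mult_right_mono_neg) auto
      thus ?thesis by (intro mult_right_mono) auto
    qed
    finally show "(cmod (exp (- of_real (\<rho> * t)) * y (exp t)))\<^sup>2 \<le> exp t * (cmod (y (exp t)))\<^sup>2" .
  qed auto
  thus ?thesis using cont by (simp add: L2t_def)
qed

lemma is_L2_on_frobenius:
  assumes Y: "\<And>d. continuous_on {0<..<d} y"
    and asym: "\<And>t. t \<le> 0 \<Longrightarrow> cmod (y (exp t) - exp (z * of_real t) * of_real t ^ m) \<le> B * exp ((Re z + 1) * t)"
    and z: "Re z > -1/2" and d: "d > 0"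
  shows "is_L2_on d y"
proof -
  \<comment> \<open>The midpoint between Re z and -1/2, so that x^(2 \<rho>) is integrable at
    0.\<close>
  define \<rho> where "\<rho> = (Re z - 1/2) / 2"
  have \<rho>: "\<rho> < Re z" "2 * \<rho> > -1" using z by (auto simp: \<rho>_def field_simps)
  obtain C where C: "\<And>t. t \<le> 0 \<Longrightarrow> cmod (y (exp t)) \<le> C * exp (\<rho> * t)"
    using quasi_monomial_bound[of "\<lambda>t. y (exp t)" z m B \<rho>] asym \<rho> by blast
  \<comment> \<open>Continuity on larger intervals provides a bound up to and including the right
    endpoint d.\<close>
  have "continuous_on {1..d} y" by (rule continuous_on_subset[OF Y[of "d + 1"]]) auto
  hence "bounded (y ` {1..d})" by (intro compact_imp_bounded compact_continuous_image) auto
  then obtain M where M: "\<forall>x\<in>{1..d}. cmod (y x) \<le> M"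
    by (auto simp: bounded_iff)
  define g where "g x = C\<^sup>2 * x powr (2 * \<rho>) + M\<^sup>2" for x
  have "g integrable_on {0..d}" unfolding g_def[abs_def]
    using d \<rho>(2) by (intro integrable_add integrable_on_mult_right integrable_on_powr_from_0) auto
  hence g: "g integrable_on {0<..<d}"
    using integrable_on_open_interval[of g 0 d] by simp
  show ?thesis unfolding is_L2_on_def
  proof (rule square_integrable_bound[OF Y _ g])
    fix x assume x: "x \<in> {0<..<d}"
    show "(cmod (y x))\<^sup>2 \<le> g x"
    proof (cases "x \<le> 1")
      case True
      have "cmod (y x) \<le> C * exp (\<rho> * ln x)" using C[of "ln x"] x True by simp
      hence "(cmod (y x))\<^sup>2 \<le> (C * exp (\<rho> * ln x))\<^sup>2" by (intro power_mono) auto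
      also have "\<dots> = C\<^sup>2 * x powr (2 * \<rho>)" using x
        by (simp add: power_mult_distrib powr_def exp_double[symmetric] mult.assoc)
      finally show ?thesis by (simp add: g_def add_increasing2)
    next
      case False
      have "cmod (y x) \<le> M" using M x False by auto
      hence "(cmod (y x))\<^sup>2 \<le> M\<^sup>2" by (intro power_mono) auto
      thus ?thesis by (simp add: g_def add_increasing)
    qed
  qed auto
qed

section \<open>The number of square-integrable solutions\<close>

lemma prod_linear_monic:
  "degree (\<Prod>j<k. [:- of_nat j, 1 :: complex:]) = k" "lead_coeff (\<Prod>j<k. [:- of_nat j, 1 :: complex:]) = 1"
proof -
  show "degree (\<Prod>j<k. [:- of_nat j, 1 :: complex:]) = k"
    by (subst degree_prod_eq_sum_degree) auto
  show "lead_coeff (\<Prod>j<k. [:- of_nat j, 1 :: complex:]) = 1"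
    by (simp add: lead_coeff_prod)
qed

lemma Dpoly_monic:
  assumes "n \<ge> 1"
  shows "degree (Dpoly n c) = 2 * n" "lead_coeff (Dpoly n c) = 1" "Dpoly n c \<noteq> 0"
proof -
  have lt: "degree [:(-1) ^ n * complex_of_real c:] < degree (\<Prod>j<2*n. [:- of_nat j, 1 :: complex:])"
    using assms by (simp add: prod_linear_monic)
  show deg: "degree (Dpoly n c) = 2 * n"
    unfolding Dpoly_def using degree_add_eq_left[OF lt] by (simp add: prod_linear_monic)
  show "lead_coeff (Dpoly n c) = 1"
  proof -
    have "Dpoly n c = [:(-1) ^ n * complex_of_real c:] + (\<Prod>j<2*n. [:- of_nat j, 1:])"
      unfolding Dpoly_def by (rule add.commute)
    thus ?thesis using lead_coeff_add_le[OF lt] prod_linear_monic(2)[of "2 * n"] by metis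
  qed
  thus "Dpoly n c \<noteq> 0" by auto
qed

definition frob_index :: "nat \<Rightarrow> real \<Rightarrow> (complex \<times> nat) set" where
  "frob_index n c = (SIGMA z:{z. poly (Dpoly n c) z = 0}. {..<order z (Dpoly n c)})"

lemma frob_index:
  assumes "n \<ge> 1"
  shows "finite (frob_index n c)" "card (frob_index n c) = 2 * n"
proof -
  have nz: "Dpoly n c \<noteq> 0" and deg: "degree (Dpoly n c) = 2 * n" using Dpoly_monic[OF assms] by auto
  have fin: "finite {z. poly (Dpoly n c) z = 0}" by (rule poly_roots_finite[OF nz])
  thus "finite (frob_index n c)" unfolding frob_index_def by (intro finite_SigmaI) auto
  have "card (frob_index n c) = (\<Sum>z | poly (Dpoly n c) z = 0. order z (Dpoly n c))"
    unfolding frob_index_def using fin by (subst card_SigmaI) auto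
  also have "\<dots> = size (proots (Dpoly n c))"
    using nz by (simp add: size_multiset_overloaded_eq)
  finally show "card (frob_index n c) = 2 * n" by (simp add: size_proots_complex deg)
qed

lemma frobenius_basis:
  assumes n: "n \<ge> 1"
  obtains Y :: "complex \<times> nat \<Rightarrow> nat \<Rightarrow> real \<Rightarrow> complex" where
    "\<And>z m d. (z, m) \<in> frob_index n c \<Longrightarrow> tau_chain n c d \<mu> (Y (z, m))"
    "\<And>z m. (z, m) \<in> frob_index n c \<Longrightarrow> \<exists>B. \<forall>t\<le>0.
        cmod (Y (z, m) 0 (exp t) - exp (z * of_real t) * of_real t ^ m) \<le> B * exp ((Re z + 1) * t)"
proof -
  let ?D = "Dpoly n c"
  obtain as where as: "mset as = proots ?D" using ex_mset by blast
  have D: "?D = (\<Prod>a\<leftarrow>as. [:-a, 1:])"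
  proof -
    have "?D = (\<Prod>x\<in>#proots ?D. [:-x, 1:])"
      using complex_poly_decompose_multiset[of ?D] Dpoly_monic(2)[OF n] by simp
    also have "\<dots> = (\<Prod>a\<leftarrow>as. [:-a, 1:])"
      unfolding as[symmetric] by (simp flip: prod_mset_prod_list mset_map)
    finally show ?thesis .
  qed
  have count: "count_list as z = order z ?D" for z
    using arg_cong[OF as, of "\<lambda>M. count M z"] Dpoly_monic(3)[OF n] by (simp add: count_mset)
  have "\<forall>j\<in>frob_index n c. \<exists>Y. (\<forall>d. tau_chain n c d \<mu> Y) \<and> (\<exists>B. \<forall>t\<le>0.
        cmod (Y 0 (exp t) - exp (fst j * of_real t) * of_real t ^ snd j) \<le> B * exp ((Re (fst j) + 1) * t))"
  proof
    fix j assume "j \<in> frob_index n c"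
    hence "snd j < count_list as (fst j)" by (auto simp: frob_index_def count)
    from frobenius_solution[OF n D this, of \<mu>]
    show "\<exists>Y. (\<forall>d. tau_chain n c d \<mu> Y) \<and> (\<exists>B. \<forall>t\<le>0.
        cmod (Y 0 (exp t) - exp (fst j * of_real t) * of_real t ^ snd j) \<le> B * exp ((Re (fst j) + 1) * t))"
      by metis
  qed
  then obtain Y where "\<forall>j\<in>frob_index n c. (\<forall>d. tau_chain n c d \<mu> (Y j)) \<and> (\<exists>B. \<forall>t\<le>0.
        cmod (Y j 0 (exp t) - exp (fst j * of_real t) * of_real t ^ snd j) \<le> B * exp ((Re (fst j) + 1) * t))"
    by metis
  thus ?thesis by (intro that[of Y]) force+
qed

lemma L2t_zero: "(\<And>t. t < T \<Longrightarrow> f t = 0) \<Longrightarrow> L2t T f"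
  unfolding L2t_def
  by (auto intro!: continuous_on_eq[OF continuous_on_const[of _ 0]] integrable_eq[OF integrable_0])

text \<open>Neither bound uses that every solution is a combination of the \<open>Y j\<close>; for
  the upper one it suffices to count initial data at d/2.\<close>

lemma num_L2_sols_eq_card:
  assumes n: "n \<ge> 1" and d: "d > 0"
  shows "num_L2_sols n c d \<mu> = card {j \<in> frob_index n c. Re (fst j) > -1/2}"
proof -
  define I where "I = frob_index n c"
  define Ip where "Ip = {j \<in> I. Re (fst j) > -1/2}"
  define Im where "Im = {j \<in> I. Re (fst j) \<le> -1/2}"
  have I: "finite I" "card I = 2 * n" using frob_index[OF n] by (auto simp: I_def)
  have fin: "finite Ip" "finite Im" using I by (auto simp: Ip_def Im_def)
  have card: "card Ip + card Im = 2 * n"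
  proof -
    have "card Ip + card Im = card (Ip \<union> Im)"
      by (rule card_Un_disjoint[symmetric]) (use fin in \<open>auto simp: Ip_def Im_def\<close>)
    also have "Ip \<union> Im = I" by (auto simp: Ip_def Im_def)
    finally show ?thesis using I by simp
  qed
  obtain Y where Y: "\<And>z m d. (z, m) \<in> I \<Longrightarrow> tau_chain n c d \<mu> (Y (z, m))"
    and asym: "\<And>z m. (z, m) \<in> I \<Longrightarrow> \<exists>B. \<forall>t\<le>0.
        cmod (Y (z, m) 0 (exp t) - exp (z * of_real t) * of_real t ^ m) \<le> B * exp ((Re z + 1) * t)"
    using frobenius_basis[OF n] unfolding I_def by blast
  define T where "T = min 0 (ln d)"
  have T: "T \<le> 0" "T \<le> ln d" by (auto simp: T_def)
  have expT: "exp t \<in> {0<..<d}" if "t < T" for t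
  proof -
    have "exp t < exp (ln d)" using that T by simp
    thus ?thesis using d by simp
  qed
  have indep: "\<forall>j\<in>J. a j = 0"
    if J: "J \<subseteq> I" and zero: "\<And>x. x \<in> {0<..<d} \<Longrightarrow> (\<Sum>j\<in>J. a j * Y j 0 x) = 0" for J a
  proof (rule frobenius_independent[where Y = "\<lambda>j. Y j 0" and T = T])
    show "finite J" using J I finite_subset by blast
    show "L2t T (\<lambda>t. exp (- complex_of_real (Re z * t)) * (\<Sum>j\<in>J. a j * Y j 0 (exp t)))" for z
      by (rule L2t_zero) (use zero expT in simp)
  qed (use J asym T in auto)
  have not_L2: "\<forall>j\<in>Im. a j = 0" if L2: "is_L2_on d (\<lambda>x. \<Sum>j\<in>Im. a j * Y j 0 x)" for a
  proof (rule frobenius_independent[where Y = "\<lambda>j. Y j 0" and T = T])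
    have chain: "tau_chain n c d \<mu> (\<lambda>k x. \<Sum>j\<in>Im. a j * Y j k x)"
      by (rule tau_chain_lincomb) (use fin Y in \<open>auto simp: Im_def\<close>)
    fix z m assume "(z, m) \<in> Im"
    hence z: "Re z \<le> -1/2" by (simp add: Im_def)
    show "L2t T (\<lambda>t. exp (- complex_of_real (Re z * t)) * (\<Sum>j\<in>Im. a j * Y j 0 (exp t)))"
      by (rule L2t_of_is_L2_on[OF tau_chain_continuous[OF chain n] L2 d z T])
  qed (use fin asym T in \<open>auto simp: Im_def\<close>)
  have lower: "has_indep_L2_sols n c d \<mu> (card Ip)"
  proof -
    obtain g where g: "bij_betw g {..<card Ip} Ip"
      using ex_bij_betw_nat_finite[OF fin(1)] by (auto simp: atLeast0LessThan)
    show ?thesis unfolding has_indep_L2_sols_def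
    proof (intro exI[of _ "\<lambda>i. Y (g i) 0"] conjI allI impI)
      fix i assume "i < card Ip"
      hence "g i \<in> Ip" using g by (auto simp: bij_betw_def)
      then obtain z m where zm: "g i = (z, m)" "(z, m) \<in> I" "Re z > -1/2"
        by (cases "g i") (auto simp: Ip_def)
      show "is_tau_solution n c d \<mu> (Y (g i) 0)"
        unfolding is_tau_solution_altdef using Y[OF zm(2)] zm(1) by auto
      obtain B where "\<And>t. t \<le> 0 \<Longrightarrow>
        cmod (Y (z, m) 0 (exp t) - exp (z * of_real t) * of_real t ^ m) \<le> B * exp ((Re z + 1) * t)"
        using asym[OF zm(2)] by blast
      thus "is_L2_on d (Y (g i) 0)" unfolding zm(1)
        by (intro is_L2_on_frobenius[OF tau_chain_continuous[OF Y[OF zm(2)] n] _ zm(3) d]) auto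
    next
      fix a i assume zero: "\<forall>x\<in>{0<..<d}. (\<Sum>i<card Ip. a i * Y (g i) 0 x) = 0" and i: "i < card Ip"
      define b where "b = a \<circ> inv_into {..<card Ip} g"
      have b: "b (g i) = a i" if "i < card Ip" for i
        using g that by (simp add: b_def bij_betw_def)
      have "\<forall>j\<in>Ip. b j = 0"
      proof (rule indep)
        fix x assume x: "x \<in> {0<..<d}"
        have "(\<Sum>j\<in>Ip. b j * Y j 0 x) = (\<Sum>i<card Ip. b (g i) * Y (g i) 0 x)"
          by (rule sum.reindex_bij_betw[OF g, symmetric])
        also have "\<dots> = (\<Sum>i<card Ip. a i * Y (g i) 0 x)" by (intro sum.cong) (auto simp: b)
        finally show "(\<Sum>j\<in>Ip. b j * Y j 0 x) = 0" using zero x by simp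
      qed (auto simp: Ip_def)
      moreover have "g i \<in> Ip" using g i by (auto simp: bij_betw_def)
      ultimately show "a i = 0" using b[OF i] by simp
    qed
  qed
  have upper: "k \<le> card Ip" if k: "has_indep_L2_sols n c d \<mu> k" for k
  proof (rule ccontr)
    assume "\<not> k \<le> card Ip"
    hence k2: "2 * n < k + card Im" using card by simp
    obtain ys where sol: "\<And>i. i < k \<Longrightarrow> is_tau_solution n c d \<mu> (ys i)"
      and L2: "\<And>i. i < k \<Longrightarrow> is_L2_on d (ys i)"
      and ind: "\<And>a. (\<forall>x\<in>{0<..<d}. (\<Sum>i<k. a i * ys i x) = 0) \<Longrightarrow> \<forall>i<k. a i = 0"
      using k unfolding has_indep_L2_sols_def by metis
    have "\<forall>i. \<exists>Z. i < k \<longrightarrow> (\<forall>x\<in>{0<..<d}. Z 0 x = ys i x) \<and> tau_chain n c d \<mu> Z"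
      using sol unfolding is_tau_solution_altdef by auto
    then obtain Z where Z: "\<And>i x. i < k \<Longrightarrow> x \<in> {0<..<d} \<Longrightarrow> Z i 0 x = ys i x"
      "\<And>i. i < k \<Longrightarrow> tau_chain n c d \<mu> (Z i)" by metis
    \<comment> \<open>More than 2n unknowns against the 2n initial conditions at d/2. In the
      resulting relation the Frobenius part equals a combination of square-integrable solutions, so
      \<open>not_L2\<close> removes it.\<close>
    define J where "J = {..<k} <+> Im"
    define V where "V j = (case j of Inl i \<Rightarrow> Z i | Inr q \<Rightarrow> Y q)" for j
    have J: "finite J" "2 * n < card J" using fin k2 by (auto simp: J_def card_Plus)
    obtain a where a: "\<exists>j\<in>J. a j \<noteq> 0" "\<forall>i<2*n. (\<Sum>j\<in>J. a j * V j i (d / 2)) = 0"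
      using homogeneous_system_nontrivial[OF J, of "\<lambda>j i. V j i (d/2)"] by blast
    have chain: "tau_chain n c d \<mu> (\<lambda>k x. \<Sum>j\<in>J. a j * V j k x)"
      by (rule tau_chain_lincomb) (use J Z Y in \<open>auto simp: J_def V_def Im_def\<close>)
    have zero: "(\<Sum>j\<in>J. a j * V j 0 x) = 0" if "x \<in> {0<..<d}" for x
      using tau_chain_unique[OF chain, of "d/2" x] a(2) that d n by simp
    have sum: "(\<Sum>i<k. a (Inl i) * ys i x) + (\<Sum>q\<in>Im. a (Inr q) * Y q 0 x) = 0"
      if "x \<in> {0<..<d}" for x
    proof -
      have "(\<Sum>j\<in>J. a j * V j 0 x) = (\<Sum>i<k. a (Inl i) * Z i 0 x) + (\<Sum>q\<in>Im. a (Inr q) * Y q 0 x)"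
        unfolding J_def V_def using fin by (subst sum.Plus) (auto simp: o_def)
      also have "(\<Sum>i<k. a (Inl i) * Z i 0 x) = (\<Sum>i<k. a (Inl i) * ys i x)"
        using Z(1) that by (intro sum.cong) auto
      finally show ?thesis using zero[OF that] by simp
    qed
    have "(\<lambda>x. (cmod (\<Sum>i<k. - a (Inl i) * ys i x))\<^sup>2) integrable_on {0<..<d}"
    proof (rule square_integrable_lincomb)
      fix i assume "i \<in> {..<k}"
      hence i: "i < k" by simp
      show "continuous_on {0<..<d} (ys i)"
        using tau_chain_continuous[OF Z(2)[OF i] n] Z(1)[OF i] by (rule continuous_on_eq)
      show "(\<lambda>x. (cmod (ys i x))\<^sup>2) integrable_on {0<..<d}"
        using L2[OF i] by (simp add: is_L2_on_def)
    qed auto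
    hence "is_L2_on d (\<lambda>x. \<Sum>q\<in>Im. a (Inr q) * Y q 0 x)"
      unfolding is_L2_on_def
    proof (rule integrable_eq)
      fix x assume "x \<in> {0<..<d}"
      from sum[OF this] have "(\<Sum>i<k. - a (Inl i) * ys i x) = (\<Sum>q\<in>Im. a (Inr q) * Y q 0 x)"
        by (simp add: sum_negf minus_unique)
      thus "(cmod (\<Sum>i<k. - a (Inl i) * ys i x))\<^sup>2 = (cmod (\<Sum>q\<in>Im. a (Inr q) * Y q 0 x))\<^sup>2"
        by (simp only:)
    qed
    hence a0: "\<forall>q\<in>Im. a (Inr q) = 0" by (rule not_L2)
    hence "\<forall>x\<in>{0<..<d}. (\<Sum>i<k. a (Inl i) * ys i x) = 0" using sum by simp
    hence "\<forall>i<k. a (Inl i) = 0" by (rule ind)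
    thus False using a(1) a0 by (auto simp: J_def)
  qed
  show ?thesis unfolding num_L2_sols_def
    using lower upper by (intro Greatest_equality) (auto simp: Ip_def I_def)
qed

section \<open>Roots in the closed left half plane\<close>

definition p0 :: "nat \<Rightarrow> complex \<Rightarrow> complex" where
  "p0 n z = (\<Prod>j<2*n. of_real (real j + 1/2) - z)"

text \<open>A sum of principal logarithms instead of \<open>Ln\<close> of the product: for Re z <
  1/2 all factors have positive real part, so this is holomorphic there, and its imaginary part is
  not reduced modulo 2 pi.\<close>

definition logp0 :: "nat \<Rightarrow> complex \<Rightarrow> complex" where
  "logp0 n z = (\<Sum>j<2*n. Ln (of_real (real j + 1/2) - z))"

text \<open>Minus the imaginary part of \<open>logp0\<close> at x + iy; the sign makes it increasing
  in y for x \<le> 0.\<close>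

definition phase :: "nat \<Rightarrow> real \<Rightarrow> real \<Rightarrow> real" where
  "phase n x y = (\<Sum>j<2*n. arctan (y / (real j + 1/2 - x)))"

lemma exp_logp0_half:
  assumes "Re z < 1/2"
  shows "exp (logp0 n z) = p0 n z"
  unfolding logp0_def p0_def exp_sum[OF finite_lessThan]
proof (intro prod.cong refl exp_Ln)
  fix j
  have "Re (of_real (real j + 1/2) - z) > 0" using assms by simp
  thus "of_real (real j + 1/2) - z \<noteq> 0" by (metis less_irrefl zero_complex.sel(1))
qed

lemma exp_logp0:
  assumes "Re z \<le> 0"
  shows "exp (logp0 n z) = p0 n z"
  using assms by (intro exp_logp0_half) simp

lemma p0_nonzero: "Re z \<le> 0 \<Longrightarrow> p0 n z \<noteq> 0"
  using exp_logp0[of z n] by (metis exp_not_eq_zero)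

lemma Im_logp0:
  assumes "x \<le> 0"
  shows "Im (logp0 n (Complex x y)) = - phase n x y"
proof -
  have "Im (Ln (of_real (real j + 1/2) - Complex x y)) = - arctan (y / (real j + 1/2 - x))" for j
  proof -
    have pos: "Re (of_real (real j + 1/2) - Complex x y) > 0" using assms by simp
    hence "Im (Ln (of_real (real j + 1/2) - Complex x y)) =
           arctan (Im (of_real (real j + 1/2) - Complex x y) / Re (of_real (real j + 1/2) - Complex x y))"
      using arg_conv_arctan Arg_eq_Im_Ln by (metis less_irrefl zero_complex.sel(1))
    thus ?thesis by (simp flip: arctan_minus)
  qed
  thus ?thesis by (simp add: logp0_def phase_def sum_negf)
qed

lemma logp0_deriv:
  assumes "Re z < 1/2"
  shows "(logp0 n has_field_derivative - (\<Sum>j<2*n. 1 / (of_real (real j + 1/2) - z))) (at z)"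
proof -
  have "(logp0 n has_field_derivative (\<Sum>j<2*n. - (1 / (of_real (real j + 1/2) - z)))) (at z)"
    unfolding logp0_def[abs_def]
  proof (rule DERIV_sum)
    fix j
    have "Re (of_real (real j + 1/2) - z) > 0" using assms by simp
    hence *: "of_real (real j + 1/2) - z \<notin> \<real>\<^sub>\<le>\<^sub>0" by (auto simp: complex_nonpos_Reals_iff)
    have "((\<lambda>z. of_real (real j + 1/2) - z) has_field_derivative (-1)) (at z)"
      by (auto intro!: derivative_eq_intros)
    from DERIV_chain2[OF has_field_derivative_Ln[OF *] this]
    show "((\<lambda>z. Ln (of_real (real j + 1/2) - z)) has_field_derivative - (1 / (of_real (real j + 1/2) - z))) (at z)"
      by (simp only: inverse_eq_divide mult_minus_right mult_1_right)
  qed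
  thus ?thesis by (simp only: sum_negf)
qed

lemma logp0_deriv_Re:
  assumes "Re z < 1/2" "n \<ge> 1"
  shows "Re (\<Sum>j<2*n. 1 / (of_real (real j + 1/2) - z)) > 0"
  unfolding Re_sum
proof (rule sum_pos)
  fix j
  have pos: "Re (of_real (real j + 1/2) - z) > 0" using assms by simp
  hence "of_real (real j + 1/2) - z \<noteq> 0" by (metis less_irrefl zero_complex.sel(1))
  thus "Re (1 / (of_real (real j + 1/2) - z)) > 0"
    using pos unfolding Re_divide by (auto intro!: divide_pos_pos simp: sum_power2_gt_zero_iff complex_eq_iff)
qed (use assms in \<open>auto simp: lessThan_empty_iff\<close>)

text \<open>On the convex half plane, a function whose derivative has negative real part is injective.\<close>

lemma logp0_inj:
  assumes "Re z \<le> 0" "Re w \<le> 0" "logp0 n z = logp0 n w" "n \<ge> 1"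
  shows "z = w"
proof (rule ccontr)
  assume "z \<noteq> w"
  define v where "v = w - z"
  \<comment> \<open>The component of \<open>logp0\<close> in direction v along the segment; its
    derivative is -|v|^2 Re S < 0.\<close>
  define g where "g t = Re (cnj v * logp0 n (z + of_real t * v))" for t
  have "g 1 < g 0"
  proof (rule DERIV_neg_imp_decreasing[where f = g])
    fix t :: real assume t: "0 \<le> t" "t \<le> 1"
    define u where "u = z + of_real t * v"
    have "Re u = (1 - t) * Re z + t * Re w" by (simp add: u_def v_def algebra_simps)
    also have "\<dots> \<le> 0" using assms t by (intro add_nonpos_nonpos mult_nonneg_nonpos) auto
    finally have u: "Re u < 1/2" by simp
    define S where "S = (\<Sum>j<2*n. 1 / (of_real (real j + 1/2) - u))"
    have "((\<lambda>t. z + of_real t * v) has_vector_derivative v) (at t)"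
      by (auto intro!: derivative_eq_intros)
    hence "((\<lambda>t. logp0 n (z + of_real t * v)) has_vector_derivative v * - S) (at t)"
      using field_vector_diff_chain_at[of "\<lambda>t. z + of_real t * v" v t "logp0 n" "- S"]
        logp0_deriv[OF u, of n] by (simp add: u_def S_def o_def)
    hence "((\<lambda>t. cnj v * logp0 n (z + of_real t * v)) has_vector_derivative cnj v * (v * - S)) (at t)"
      by (intro has_vector_derivative_mult_right)
    hence "(g has_real_derivative Re (cnj v * (v * - S))) (at t)"
      unfolding g_def[abs_def] has_real_derivative_iff_has_vector_derivative
      by (rule bounded_linear.has_vector_derivative[OF bounded_linear_Re])
    moreover have "Re (cnj v * (v * - S)) = - ((cmod v)\<^sup>2 * Re S)"
    proof -
      have "cnj v * (v * - S) = - ((v * cnj v) * S)" by simp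
      also have "\<dots> = - (of_real ((cmod v)\<^sup>2) * S)" by (simp only: complex_norm_square)
      finally show ?thesis by (simp only: uminus_complex.sel Re_complex_of_real Im_complex_of_real times_complex.sel)
    qed
    moreover have "(cmod v)\<^sup>2 * Re S > 0"
      using logp0_deriv_Re[OF u assms(4)] \<open>z \<noteq> w\<close> by (simp add: S_def v_def)
    ultimately show "\<exists>y. (g has_real_derivative y) (at t) \<and> y < 0" by auto
  qed simp
  thus False using assms(3) by (simp add: g_def v_def)
qed

lemma phase_strict_mono:
  assumes "x \<le> 0" "y < y'" "n \<ge> 1"
  shows "phase n x y < phase n x y'"
  unfolding phase_def
proof (rule sum_strict_mono)
  fix j
  have "real j + 1/2 - x > 0" using assms by simp
  thus "arctan (y / (real j + 1/2 - x)) < arctan (y' / (real j + 1/2 - x))"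
    using assms(2) by (intro arctan_monotone divide_strict_right_mono)
qed (use assms in \<open>auto simp: lessThan_empty_iff\<close>)

lemma phase_minus: "phase n x (- y) = - phase n x y"
  by (simp add: phase_def arctan_minus sum_negf)

lemma phase_tendsto:
  assumes "x \<le> 0"
  shows "((\<lambda>y. phase n x y) \<longlongrightarrow> real n * pi) at_top"
proof -
  have "((\<lambda>y. phase n x y) \<longlongrightarrow> (\<Sum>j<2*n. pi / 2)) at_top"
    unfolding phase_def
  proof (rule tendsto_sum)
    fix j
    have "filterlim (\<lambda>y. y * (1 / (real j + 1/2 - x))) at_top at_top"
      by (rule filterlim_at_top_mult_tendsto_pos[OF tendsto_const])
         (use assms in \<open>auto intro: filterlim_ident\<close>)
    hence "filterlim (\<lambda>y. y / (real j + 1/2 - x)) at_top at_top" by simp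
    thus "((\<lambda>y. arctan (y / (real j + 1/2 - x))) \<longlongrightarrow> pi / 2) at_top"
      by (rule filterlim_compose[OF tendsto_arctan_at_top])
  qed
  thus ?thesis by simp
qed

lemma phase_bound:
  assumes "n \<ge> 1"
  shows "\<bar>phase n x y\<bar> < real n * pi"
proof -
  have "\<bar>phase n x y\<bar> \<le> (\<Sum>j<2*n. \<bar>arctan (y / (real j + 1/2 - x))\<bar>)"
    unfolding phase_def by (rule sum_abs)
  also have "\<dots> < (\<Sum>j<2*n. pi / 2)"
  proof (rule sum_strict_mono)
    fix j
    show "\<bar>arctan (y / (real j + 1/2 - x))\<bar> < pi / 2"
      using arctan_bounded[of "y / (real j + 1/2 - x)"] by auto
  qed (use assms in \<open>auto simp: lessThan_empty_iff\<close>)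
  finally show ?thesis by simp
qed

lemma phase_continuous_y: "continuous_on A (phase n x)"
  unfolding phase_def[abs_def] divide_inverse by (intro continuous_intros)

lemma phase_continuous_x: "continuous_on {..0} (\<lambda>x. phase n x y)"
  unfolding phase_def[abs_def] by (intro continuous_intros) auto

lemma phase_surj:
  assumes "x \<le> 0" "\<bar>\<theta>\<bar> < real n * pi"
  shows "\<exists>y. phase n x y = \<theta>"
proof -
  have ev: "\<exists>y\<ge>0. \<phi> < phase n x y" if "\<phi> < real n * pi" for \<phi>
  proof -
    have "eventually (\<lambda>y. \<phi> < phase n x y \<and> y \<ge> 0) at_top"
      using order_tendstoD(1)[OF phase_tendsto[OF assms(1)] that] eventually_ge_at_top[of 0]
      by eventually_elim auto
    thus ?thesis by (auto simp: eventually_at_top_linorder)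
  qed
  have \<theta>: "\<theta> < real n * pi" "- \<theta> < real n * pi" using assms(2) by linarith+
  obtain y1 where y1: "y1 \<ge> 0" "\<theta> < phase n x y1" using ev[OF \<theta>(1)] by blast
  obtain y2 where y2: "y2 \<ge> 0" "- \<theta> < phase n x y2" using ev[OF \<theta>(2)] by blast
  have "\<exists>y\<ge>-y2. y \<le> y1 \<and> phase n x y = \<theta>"
    by (rule IVT') (use y1 y2 phase_continuous_y in \<open>auto simp: phase_minus\<close>)
  thus ?thesis by blast
qed

text \<open>The level curve of \<open>phase\<close> at value \<theta>, parametrized by the abscissa
  x.\<close>

definition eta :: "nat \<Rightarrow> real \<Rightarrow> real \<Rightarrow> real" where
  "eta n \<theta> x = (SOME y. phase n x y = \<theta>)"

lemma phase_eta:
  assumes "x \<le> 0" "\<bar>\<theta>\<bar> < real n * pi"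
  shows "phase n x (eta n \<theta> x) = \<theta>"
  unfolding eta_def by (rule someI_ex[OF phase_surj[OF assms]])

lemma phase_less_iff:
  assumes "x \<le> 0" "n \<ge> 1"
  shows "phase n x y < phase n x y' \<longleftrightarrow> y < y'"
  using phase_strict_mono[OF assms(1) _ assms(2)] by (metis linorder_neqE_linordered_idom order_less_asym)

lemma eta_eqI:
  assumes "phase n x y = \<theta>" "x \<le> 0" "n \<ge> 1"
  shows "eta n \<theta> x = y"
proof -
  have "\<bar>\<theta>\<bar> < real n * pi" using assms phase_bound by blast
  from phase_eta[OF assms(2) this] show ?thesis
    using phase_less_iff[OF assms(2,3)] assms(1) by (metis linorder_neqE_linordered_idom less_irrefl)
qed

text \<open>As \<open>phase\<close> increases in y, a lies below the curve at x exactly if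
  \<open>phase n x a\<close> is below \<theta>, and that is an open condition in x.\<close>

lemma eta_continuous:
  assumes \<theta>: "\<bar>\<theta>\<bar> < real n * pi" and n: "n \<ge> 1"
  shows "continuous_on {..0} (eta n \<theta>)"
  unfolding continuous_on_def
proof
  fix x :: real assume x: "x \<in> {..0}"
  show "(eta n \<theta> \<longlongrightarrow> eta n \<theta> x) (at x within {..0})"
  proof (rule order_tendstoI)
    fix a assume a: "a < eta n \<theta> x"
    have lim: "((\<lambda>x. phase n x a) \<longlongrightarrow> phase n x a) (at x within {..0})"
      using phase_continuous_x[of n a] x unfolding continuous_on_def by blast
    have "phase n x a < \<theta>"
      using a phase_strict_mono[of x a "eta n \<theta> x" n] phase_eta[OF _ \<theta>, of x] x n by auto
    from order_tendstoD(2)[OF lim this]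
    have "eventually (\<lambda>u. phase n u a < \<theta> \<and> u \<in> {..0}) (at x within {..0})"
      by (auto simp: eventually_at_filter elim: eventually_mono)
    thus "eventually (\<lambda>u. a < eta n \<theta> u) (at x within {..0})"
    proof eventually_elim
      case (elim u)
      thus ?case using phase_eta[OF _ \<theta>, of u] phase_less_iff[of u n a "eta n \<theta> u"] n by auto
    qed
  next
    fix a assume a: "a > eta n \<theta> x"
    have lim: "((\<lambda>x. phase n x a) \<longlongrightarrow> phase n x a) (at x within {..0})"
      using phase_continuous_x[of n a] x unfolding continuous_on_def by blast
    have "phase n x a > \<theta>"
      using a phase_strict_mono[of x "eta n \<theta> x" a n] phase_eta[OF _ \<theta>, of x] x n by auto
    from order_tendstoD(1)[OF lim this]
    have "eventually (\<lambda>u. phase n u a > \<theta> \<and> u \<in> {..0}) (at x within {..0})"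
      by (auto simp: eventually_at_filter elim: eventually_mono)
    thus "eventually (\<lambda>u. a > eta n \<theta> u) (at x within {..0})"
    proof eventually_elim
      case (elim u)
      thus ?case using phase_eta[OF _ \<theta>, of u] phase_less_iff[of u n "eta n \<theta> u" a] n by auto
    qed
  qed
qed

definition logmod :: "nat \<Rightarrow> real \<Rightarrow> real \<Rightarrow> real" where
  "logmod n \<theta> x = Re (logp0 n (Complex x (eta n \<theta> x)))"

lemma logmod_continuous:
  assumes "\<bar>\<theta>\<bar> < real n * pi" "n \<ge> 1"
  shows "continuous_on {..0} (logmod n \<theta>)"
proof -
  have "continuous_on {z. Re z \<le> 0} (logp0 n)"
    by (intro continuous_at_imp_continuous_on ballI DERIV_isCont[OF logp0_deriv]) auto
  moreover have "continuous_on {..0} (\<lambda>x. Complex x (eta n \<theta> x))"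
    unfolding Complex_eq using eta_continuous[OF assms] by (intro continuous_intros)
  ultimately have "continuous_on {..0} (\<lambda>x. logp0 n (Complex x (eta n \<theta> x)))"
    by (rule continuous_on_compose2) auto
  thus ?thesis unfolding logmod_def[abs_def] by (intro continuous_intros)
qed

lemma logmod_unbounded:
  assumes "n \<ge> 1"
  shows "\<exists>x1\<le>x. x1 \<le> 0 \<and> X \<le> logmod n \<theta> x1"
proof -
  \<comment> \<open>Every factor then has modulus at least exp |X|, so all logarithms are
    nonnegative and the first alone reaches X; using |X| covers negative X.\<close>
  define x1 where "x1 = min x (- exp \<bar>X\<bar>)"
  have x1: "x1 \<le> - exp \<bar>X\<bar>" "x1 \<le> -1" "x1 \<le> x"
    using one_le_exp_iff[of "\<bar>X\<bar>"] by (auto simp: x1_def min_le_iff_disj)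
  let ?w = "\<lambda>j. of_real (real j + 1/2) - Complex x1 (eta n \<theta> x1)"
  have w: "ln (cmod (?w j)) \<ge> 0 \<and> ln (cmod (?w j)) \<ge> \<bar>X\<bar> \<and> ?w j \<noteq> 0" for j
  proof -
    have "cmod (?w j) \<ge> Re (?w j)" by (rule complex_Re_le_cmod)
    moreover have "Re (?w j) = real j + 1/2 - x1" by simp
    ultimately have 1: "cmod (?w j) \<ge> exp \<bar>X\<bar>" using x1 by linarith
    have 2: "cmod (?w j) > 0" using 1 by (meson exp_gt_zero less_le_trans)
    have 3: "ln (cmod (?w j)) \<ge> \<bar>X\<bar>" using 1 2 by (simp add: ln_ge_iff)
    have 4: "ln (cmod (?w j)) \<ge> 0" using 3 abs_ge_zero[of X] by linarith
    have 5: "?w j \<noteq> 0" using 2 by (metis norm_zero less_irrefl)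
    show ?thesis by (intro conjI 3 4 5)
  qed
  have "X \<le> \<bar>X\<bar>" by simp
  also have "\<dots> \<le> Re (Ln (?w 0))" using w[of 0] by simp
  also have "\<dots> \<le> (\<Sum>j<2*n. Re (Ln (?w j)))"
    using assms w by (intro member_le_sum[of 0 "{..<2*n}" "\<lambda>j. Re (Ln (?w j))"]) auto
  also have "\<dots> = logmod n \<theta> x1" by (simp add: logmod_def logp0_def)
  finally show ?thesis using x1 by (intro exI[of _ x1]) auto
qed

text \<open>On each horizontal line the image of the closed half plane is a ray starting at the
  image of the imaginary axis. The ray is filled by the intermediate value theorem along the level
  curve. A value to the left of its start would, by the same theorem, force the start to be attained
  a second time, against injectivity.\<close>

lemma logp0_image:
  assumes n: "n \<ge> 1" and \<theta>: "\<bar>\<theta>\<bar> < real n * pi"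
  shows "(\<exists>z. Re z \<le> 0 \<and> logp0 n z = Complex X (- \<theta>)) \<longleftrightarrow> logmod n \<theta> 0 \<le> X"
proof
  have val: "logp0 n (Complex x (eta n \<theta> x)) = Complex (logmod n \<theta> x) (- \<theta>)" if "x \<le> 0" for x
    using that by (simp add: complex_eq_iff logmod_def Im_logp0 phase_eta \<theta>)
  have IVT: "\<exists>x\<ge>x1. x \<le> x2 \<and> logmod n \<theta> x = Y"
    if "x1 \<le> x2" "x2 \<le> 0" "logmod n \<theta> x2 \<le> Y" "Y \<le> logmod n \<theta> x1" for x1 x2 Y
    by (rule IVT2') (use that in \<open>auto intro: continuous_on_subset[OF logmod_continuous[OF \<theta> n]]\<close>)
  {
    assume "logmod n \<theta> 0 \<le> X"
    moreover obtain x1 where "x1 \<le> 0" "X \<le> logmod n \<theta> x1" using logmod_unbounded[OF n] by blast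
    ultimately obtain x where "x \<le> 0" "logmod n \<theta> x = X" using IVT[of x1 0 X] by auto
    thus "\<exists>z. Re z \<le> 0 \<and> logp0 n z = Complex X (- \<theta>)"
      using val[of x] by (intro exI[of _ "Complex x (eta n \<theta> x)"]) auto
  }
  assume "\<exists>z. Re z \<le> 0 \<and> logp0 n z = Complex X (- \<theta>)"
  then obtain x y where x: "x \<le> 0" and eq: "logp0 n (Complex x y) = Complex X (- \<theta>)"
    by (metis complex.sel(1) complex_surj)
  have "eta n \<theta> x = y" using eq Im_logp0[OF x, of n y] n x by (intro eta_eqI) auto
  hence X: "logmod n \<theta> x = X" using eq by (simp add: logmod_def)
  show "logmod n \<theta> 0 \<le> X"
  proof (rule ccontr)
    assume "\<not> logmod n \<theta> 0 \<le> X"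
    hence lt: "X < logmod n \<theta> 0" by simp
    obtain x1 where x1: "x1 \<le> x" "logmod n \<theta> 0 \<le> logmod n \<theta> x1"
      using logmod_unbounded[OF n, of x] by blast
    obtain x2 where x2: "x2 \<le> x" "logmod n \<theta> x2 = logmod n \<theta> 0"
      using IVT[of x1 x "logmod n \<theta> 0"] x1 x lt X by auto
    have "logp0 n (Complex x2 (eta n \<theta> x2)) = logp0 n (Complex 0 (eta n \<theta> 0))"
      using val[of x2] val[of 0] x2 x by simp
    from logp0_inj[OF _ _ this n] have "Complex x2 (eta n \<theta> x2) = Complex 0 (eta n \<theta> 0)"
      using x2(1) x by simp
    hence "x2 = 0" by (simp only: complex.inject)
    hence "x = 0" using x2(1) x by linarith
    thus False using X lt by (simp only: less_irrefl)
  qed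
qed

section \<open>Moduli of \<open>p0\<close> on the imaginary axis where its phase is a multiple of
  pi\<close>

definition imval :: "nat \<Rightarrow> nat \<Rightarrow> real" where
  "imval n k = exp (logmod n (real k * pi) 0)"

lemma Re_logp0_imag:
  "Re (logp0 n (Complex 0 y)) = (\<Sum>j<2*n. ln (sqrt ((real j + 1/2)\<^sup>2 + y\<^sup>2)))"
proof -
  have "Re (Ln (of_real (real j + 1/2) - Complex 0 y)) = ln (sqrt ((real j + 1/2)\<^sup>2 + y\<^sup>2))" for j
  proof -
    have "Re (of_real (real j + 1/2) - Complex 0 y) > 0" by simp
    hence "of_real (real j + 1/2) - Complex 0 y \<noteq> 0" by (metis less_irrefl zero_complex.sel(1))
    hence "Re (Ln (of_real (real j + 1/2) - Complex 0 y)) = ln (cmod (of_real (real j + 1/2) - Complex 0 y))"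
      by (rule Re_Ln)
    also have "cmod (of_real (real j + 1/2) - Complex 0 y) = sqrt ((real j + 1/2)\<^sup>2 + y\<^sup>2)"
      unfolding cmod_def by simp
    finally show ?thesis .
  qed
  thus ?thesis by (simp add: logp0_def)
qed

lemma Re_logp0_imag_mono:
  assumes "0 \<le> y" "y < y'" "n \<ge> 1"
  shows "Re (logp0 n (Complex 0 y)) < Re (logp0 n (Complex 0 y'))"
  unfolding Re_logp0_imag
proof (rule sum_strict_mono)
  fix j
  have "y\<^sup>2 < y'\<^sup>2" using assms by (intro power_strict_mono) auto
  moreover have "0 < (real j + 1/2)\<^sup>2" by (intro zero_less_power) auto
  ultimately have "0 < sqrt ((real j + 1/2)\<^sup>2 + y\<^sup>2)"
    "sqrt ((real j + 1/2)\<^sup>2 + y\<^sup>2) < sqrt ((real j + 1/2)\<^sup>2 + y'\<^sup>2)"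
    by (auto simp: add_pos_nonneg)
  thus "ln (sqrt ((real j + 1/2)\<^sup>2 + y\<^sup>2)) < ln (sqrt ((real j + 1/2)\<^sup>2 + y'\<^sup>2))"
    by (subst ln_less_cancel_iff) linarith+
qed (use assms in \<open>auto simp: lessThan_empty_iff\<close>)

lemma eta_zero: "n \<ge> 1 \<Longrightarrow> eta n 0 0 = 0"
  by (rule eta_eqI) (auto simp: phase_def)

lemma eta_minus:
  assumes "n \<ge> 1" "\<bar>\<theta>\<bar> < real n * pi"
  shows "eta n (- \<theta>) 0 = - eta n \<theta> 0"
  by (rule eta_eqI) (use assms in \<open>auto simp: phase_minus phase_eta\<close>)

lemma logmod_minus:
  assumes "n \<ge> 1" "\<bar>\<theta>\<bar> < real n * pi"
  shows "logmod n (- \<theta>) 0 = logmod n \<theta> 0"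
  unfolding logmod_def eta_minus[OF assms] Re_logp0_imag by simp

text \<open>Going up the imaginary axis from 0, the phase and the modulus of \<open>p0\<close> both
  increase.\<close>

lemma logmod_mono:
  assumes "n \<ge> 1" "0 \<le> \<theta>" "\<theta> < \<theta>'" "\<theta>' < real n * pi"
  shows "logmod n \<theta> 0 < logmod n \<theta>' 0"
proof -
  have eq: "phase n 0 (eta n \<theta> 0) = \<theta>" "phase n 0 (eta n \<theta>' 0) = \<theta>'"
    using assms by (auto intro!: phase_eta)
  have "phase n 0 0 = 0" by (simp add: phase_def)
  note eq = eq this
  have "eta n \<theta> 0 < eta n \<theta>' 0" using phase_less_iff[of 0 n "eta n \<theta> 0" "eta n \<theta>' 0"] eq assms by simp
  moreover have "\<not> eta n \<theta> 0 < 0" using phase_less_iff[of 0 n "eta n \<theta> 0" 0] eq assms by simp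
  ultimately show ?thesis unfolding logmod_def using assms(1) by (intro Re_logp0_imag_mono) auto
qed

lemma imval_mono:
  assumes "n \<ge> 1" "k < l" "l < n"
  shows "imval n k < imval n l"
  unfolding imval_def using assms by (auto intro!: logmod_mono mult_strict_right_mono)

lemma imval_mono_le:
  assumes "n \<ge> 1" "k \<le> l" "l < n"
  shows "imval n k \<le> imval n l"
  using imval_mono[OF assms(1), of k l] assms by (cases "k = l") auto

lemma imval_pos: "imval n k > 0"
  by (simp add: imval_def)

text \<open>The nonzero ordinate in the second part is what later yields a genuine pair iy,
  -iy.\<close>

lemma imval_witness:
  assumes "n \<ge> 1" "k < n"
  shows "p0 n (Complex 0 (eta n (real k * pi) 0)) = of_real ((-1) ^ k * imval n k)"
    "k \<ge> 1 \<Longrightarrow> eta n (real k * pi) 0 \<noteq> 0"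
proof -
  define y where "y = eta n (real k * pi) 0"
  have \<theta>: "\<bar>real k * pi\<bar> < real n * pi" using assms by (simp add: abs_mult)
  have ph: "phase n 0 y = real k * pi" unfolding y_def by (rule phase_eta[OF _ \<theta>]) simp
  have "logp0 n (Complex 0 y) = Complex (logmod n (real k * pi) 0) (- (real k * pi))"
    by (simp add: complex_eq_iff logmod_def Im_logp0 ph flip: y_def)
  hence "p0 n (Complex 0 y) = exp (Complex (logmod n (real k * pi) 0) (- (real k * pi)))"
    using exp_logp0[of "Complex 0 y" n] by simp
  also have "\<dots> = of_real (imval n k) * cis (- (real k * pi))"
    by (simp add: exp_eq_polar imval_def)
  also have "cis (- (real k * pi)) = (-1) ^ k"
    by (simp add: complex_eq_iff cos_npi sin_npi)
  finally show "p0 n (Complex 0 (eta n (real k * pi) 0)) = of_real ((-1) ^ k * imval n k)"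
    by (simp add: y_def mult.commute)
  show "eta n (real k * pi) 0 \<noteq> 0" if "k \<ge> 1"
    using ph that by (auto simp: y_def[symmetric] phase_def)
qed

lemma prod_half_integers: "(\<Prod>j<k. real j + 1/2) = real (dfact (2 * k - 1)) / 2 ^ k"
proof (induction k)
  case (Suc k)
  show ?case
  proof (cases k)
    case (Suc i)
    have "dfact (2 * Suc k - 1) = (2 * k + 1) * dfact (2 * k - 1)" using Suc by simp
    hence "real (dfact (2 * Suc k - 1)) / 2 ^ Suc k = (real (dfact (2 * k - 1)) / 2 ^ k) * (real k + 1/2)"
      by (simp only: of_nat_mult) (simp add: field_simps)
    thus ?thesis using Suc.IH by simp
  qed simp
qed simp

lemma imval_0:
  assumes "n \<ge> 1"
  shows "imval n 0 = real (dfact (4 * n - 1)) / 2 ^ (2 * n)"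
proof -
  have "of_real (imval n 0) = p0 n 0"
    using imval_witness(1)[OF assms, of 0] assms eta_zero[OF assms] by (simp add: Complex_eq)
  also have "\<dots> = of_real (\<Prod>j<2*n. real j + 1/2)" by (simp add: p0_def)
  finally have "imval n 0 = (\<Prod>j<2*n. real j + 1/2)" by (simp only: of_real_eq_iff)
  thus ?thesis by (simp add: prod_half_integers)
qed

text \<open>Distinct roots are counted; by \<open>order_left_root\<close> below this equals the
  count with multiplicity.\<close>

definition left_count :: "nat \<Rightarrow> real \<Rightarrow> nat" where
  "left_count n r = card {z. Re z \<le> 0 \<and> p0 n z = of_real r}"

lemma left_count_0: "left_count n 0 = 0"
proof -
  have "{z. Re z \<le> 0 \<and> p0 n z = of_real 0} = {}" using p0_nonzero by auto
  thus ?thesis unfolding left_count_def by (simp only: card.empty)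
qed

lemma cos_int_pi: "cos (of_int m * pi) = (if even m then 1 else -1)"
  by (cases m rule: int_cases2) (auto simp: cos_npi)

text \<open>A root corresponds to the logarithm \<open>w m\<close> of r that \<open>logp0\<close>
  takes there. The sign of r fixes the parity of m, the bound on the phase gives |m| < n, and
  injectivity allows one root per m. By conjugation m and -m have the same threshold.\<close>

lemma left_count_eq:
  assumes n: "n \<ge> 1" and r: "r \<noteq> 0"
  shows "left_count n r = card {m::int. \<bar>m\<bar> < int n \<and> (even m \<longleftrightarrow> r > 0) \<and> imval n (nat \<bar>m\<bar>) \<le> \<bar>r\<bar>}"
proof -
  define A where "A = {z. Re z \<le> 0 \<and> p0 n z = of_real r}"
  define B where "B = {m::int. \<bar>m\<bar> < int n \<and> (even m \<longleftrightarrow> r > 0) \<and> imval n (nat \<bar>m\<bar>) \<le> \<bar>r\<bar>}"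
  define w where "w m = Complex (ln \<bar>r\<bar>) (- (of_int m * pi))" for m :: int
  have bnd: "\<bar>of_int m * pi\<bar> < real n * pi \<longleftrightarrow> \<bar>m\<bar> < int n" for m
    by (simp add: abs_mult) linarith
  have thr: "imval n (nat \<bar>m\<bar>) \<le> \<bar>r\<bar> \<longleftrightarrow> logmod n (of_int m * pi) 0 \<le> ln \<bar>r\<bar>" if "\<bar>m\<bar> < int n" for m
  proof -
    have "logmod n (of_int m * pi) 0 = logmod n (real (nat \<bar>m\<bar>) * pi) 0"
    proof (cases "m \<ge> 0")
      case False
      hence "real (nat \<bar>m\<bar>) * pi = - (of_int m * pi)" by simp
      thus ?thesis using logmod_minus[OF n, of "of_int m * pi"] bnd that by simp
    qed simp
    thus ?thesis using r by (simp add: imval_def ln_ge_iff)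
  qed
  have expw: "exp (w m) = of_real r \<longleftrightarrow> (even m \<longleftrightarrow> r > 0)" for m
  proof -
    have "exp (w m) = of_real (\<bar>r\<bar> * (if even m then 1 else -1))"
      using r by (simp add: w_def exp_eq_polar complex_eq_iff cos_int_pi sin_zero_iff_int2)
    also have "\<dots> = of_real r \<longleftrightarrow> (even m \<longleftrightarrow> r > 0)"
      unfolding of_real_eq_iff using r by (auto simp: abs_if)
    finally show ?thesis .
  qed
  have ex: "m \<in> B \<longleftrightarrow> (\<exists>z\<in>A. logp0 n z = w m)" for m
  proof -
    have "(\<exists>z\<in>A. logp0 n z = w m) \<longleftrightarrow> exp (w m) = of_real r \<and> (\<exists>z. Re z \<le> 0 \<and> logp0 n z = w m)"
      unfolding A_def using exp_logp0[of _ n] by (auto; metis)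
    also have "\<dots> \<longleftrightarrow> m \<in> B"
    proof (cases "\<bar>m\<bar> < int n")
      case True
      hence "\<bar>of_int m * pi\<bar> < real n * pi" by (simp only: bnd)
      from logp0_image[OF n this, of "ln \<bar>r\<bar>"] show ?thesis
        using True thr[OF True] by (simp add: B_def expw flip: w_def)
    next
      case False
      have "\<bar>m\<bar> < int n" if "Re z \<le> 0" "logp0 n z = w m" for z
      proof -
        have "\<bar>Im (logp0 n z)\<bar> < real n * pi"
          using Im_logp0[of "Re z" n "Im z"] phase_bound[OF n] that by simp
        thus ?thesis using that(2) by (simp add: w_def bnd)
      qed
      thus ?thesis using False by (auto simp: B_def)
    qed
    finally show ?thesis by blast
  qed
  define g where "g m = (SOME z. z \<in> A \<and> logp0 n z = w m)" for m
  have g: "g m \<in> A \<and> logp0 n (g m) = w m" if "m \<in> B" for m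
  proof -
    have "\<exists>z. z \<in> A \<and> logp0 n z = w m" using ex[of m] that by blast
    from someI_ex[OF this] show ?thesis unfolding g_def .
  qed
  have "bij_betw g B A"
  proof (rule bij_betwI')
    fix m m' assume "m \<in> B" "m' \<in> B"
    hence "logp0 n (g m) = w m" "logp0 n (g m') = w m'" using g by blast+
    moreover have "w m = w m' \<longleftrightarrow> m = m'" by (simp add: w_def)
    ultimately show "g m = g m' \<longleftrightarrow> m = m'" by metis
  next
    fix m assume "m \<in> B"
    thus "g m \<in> A" using g by blast
  next
    fix z assume z: "z \<in> A"
    have e: "exp (logp0 n z) = of_real r" using z exp_logp0[of z n] by (auto simp: A_def)
    have "Im (exp (logp0 n z)) = 0" unfolding e by simp
    hence "sin (Im (logp0 n z)) = 0" by (simp add: Im_exp)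
    then obtain i :: int where i: "Im (logp0 n z) = of_int i * pi" by (auto simp: sin_zero_iff_int2)
    have "cmod (exp (logp0 n z)) = \<bar>r\<bar>" unfolding e by simp
    hence "exp (Re (logp0 n z)) = \<bar>r\<bar>" by simp
    hence "Re (logp0 n z) = ln \<bar>r\<bar>" using ln_exp[of "Re (logp0 n z)"] by (simp only:)
    hence w: "logp0 n z = w (- i)" using i by (simp add: w_def complex_eq_iff)
    hence B: "- i \<in> B" using ex z by blast
    have "z = g (- i)"
    proof (rule logp0_inj[OF _ _ _ n])
      show "Re z \<le> 0" "Re (g (- i)) \<le> 0" using z g[OF B] by (auto simp only: A_def mem_Collect_eq)
      show "logp0 n z = logp0 n (g (- i))" using w g[OF B] by (simp only:)
    qed
    thus "\<exists>m\<in>B. z = g m" using B by blast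
  qed
  thus ?thesis unfolding left_count_def A_def[symmetric] B_def[symmetric] by (simp add: bij_betw_same_card)
qed

lemma card_parity_interval: "card {m::int. \<bar>m\<bar> \<le> int K \<and> (even m \<longleftrightarrow> even K)} = K + 1"
proof -
  have "{m::int. \<bar>m\<bar> \<le> int K \<and> (even m \<longleftrightarrow> even K)} = (\<lambda>i. 2 * int i - int K) ` {..K}" (is "?L = ?R")
  proof (intro equalityI subsetI)
    fix m assume "m \<in> ?L"
    hence m: "\<bar>m\<bar> \<le> int K" "even (m + int K)" by auto
    then obtain j where j: "m + int K = 2 * j" by (elim evenE)
    have "0 \<le> j" "j \<le> int K" using j m by linarith+
    thus "m \<in> ?R" using j by (intro image_eqI[of _ _ "nat j"]) auto
  qed auto
  also have "card \<dots> = K + 1" by (subst card_image) (auto simp: inj_on_def)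
  finally show ?thesis .
qed

text \<open>K is the largest |m| that occurs. The value K + 1 has the wrong parity, so the next
  candidate is K + 2, and integers of the parity of K between -K and K number K + 1.\<close>

lemma left_count_Suc:
  assumes n: "n \<ge> 1" and r: "r \<noteq> 0" and K: "K < n" "even K \<longleftrightarrow> r > 0" "imval n K \<le> \<bar>r\<bar>"
    and nxt: "K + 2 < n \<Longrightarrow> \<bar>r\<bar> < imval n (K + 2)"
  shows "left_count n r = K + 1"
proof -
  have "{m::int. \<bar>m\<bar> < int n \<and> (even m \<longleftrightarrow> r > 0) \<and> imval n (nat \<bar>m\<bar>) \<le> \<bar>r\<bar>} =
        {m. \<bar>m\<bar> \<le> int K \<and> (even m \<longleftrightarrow> even K)}"
  proof (intro Collect_cong iffI)
    fix m :: int assume m: "\<bar>m\<bar> < int n \<and> (even m \<longleftrightarrow> r > 0) \<and> imval n (nat \<bar>m\<bar>) \<le> \<bar>r\<bar>"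
    have "\<bar>m\<bar> \<le> int K"
    proof (rule ccontr)
      assume "\<not> \<bar>m\<bar> \<le> int K"
      moreover have "even m \<longleftrightarrow> even K" using m K by simp
      hence "even (\<bar>m\<bar> + int K)" by auto
      hence "\<bar>m\<bar> \<noteq> int K + 1" by presburger
      ultimately have "K + 2 \<le> nat \<bar>m\<bar>" "nat \<bar>m\<bar> < n" using m by linarith+
      thus False using nxt imval_mono_le[OF n, of "K + 2" "nat \<bar>m\<bar>"] m by simp
    qed
    thus "\<bar>m\<bar> \<le> int K \<and> (even m \<longleftrightarrow> even K)" using m K by simp
  next
    fix m :: int assume m: "\<bar>m\<bar> \<le> int K \<and> (even m \<longleftrightarrow> even K)"
    hence "imval n (nat \<bar>m\<bar>) \<le> imval n K" using K by (intro imval_mono_le[OF n]) auto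
    thus "\<bar>m\<bar> < int n \<and> (even m \<longleftrightarrow> r > 0) \<and> imval n (nat \<bar>m\<bar>) \<le> \<bar>r\<bar>" using m K by auto
  qed
  thus ?thesis using left_count_eq[OF n r] card_parity_interval by simp
qed

lemma left_count_small:
  assumes n: "n \<ge> 1" and pos: "r > 0 \<Longrightarrow> r < imval n 0" and neg: "r < 0 \<Longrightarrow> 1 < n \<Longrightarrow> - r < imval n 1"
  shows "left_count n r = 0"
proof (cases "r = 0")
  case False
  have "False" if m: "\<bar>m\<bar> < int n" "even m \<longleftrightarrow> r > 0" "imval n (nat \<bar>m\<bar>) \<le> \<bar>r\<bar>" for m :: int
  proof (cases "r > 0")
    case True
    moreover have "nat \<bar>m\<bar> < n" using m(1) by linarith
    ultimately show False using pos m imval_mono_le[OF n, of 0 "nat \<bar>m\<bar>"] by auto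
  next
    case F: False
    hence "nat \<bar>m\<bar> \<ge> 1" using m by (cases "m = 0") auto
    moreover have "nat \<bar>m\<bar> < n" using m(1) by linarith
    ultimately show False using neg F \<open>r \<noteq> 0\<close> m imval_mono_le[OF n, of 1 "nat \<bar>m\<bar>"] by auto
  qed
  hence "{m::int. \<bar>m\<bar> < int n \<and> (even m \<longleftrightarrow> r > 0) \<and> imval n (nat \<bar>m\<bar>) \<le> \<bar>r\<bar>} = {}" by blast
  thus ?thesis using left_count_eq[OF n False] by (simp only: card.empty)
qed (simp add: left_count_0)

section \<open>From root counting back to the differential equation\<close>

lemma poly_Dpoly: "poly (Dpoly n c) w = p0 n (w + 1/2) + (-1) ^ n * of_real c"
proof -
  have "p0 n (w + 1/2) = (\<Prod>j<2*n. (-1) * (w - of_nat j))"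
    unfolding p0_def by (intro prod.cong) auto
  \<comment> \<open>The number 2n of sign changes is even.\<close>
  also have "\<dots> = (\<Prod>j<2*n. w - of_nat j)"
    unfolding prod.distrib by simp
  finally show ?thesis by (simp add: Dpoly_def poly_prod)
qed

lemma poly_Dpoly_eq_0_iff:
  assumes "n \<ge> 1"
  shows "poly (Dpoly n c) w = 0 \<longleftrightarrow> p0 n (w + 1/2) = of_real ((-1) ^ (n - 1) * c)"
proof -
  have "(-1 :: complex) ^ n = - ((-1) ^ (n - 1))" using assms by (cases n) auto
  thus ?thesis unfolding poly_Dpoly by simp
qed

text \<open>The derivative of exp(logp0) is -p0 times a sum with positive real part, hence
  nonzero.\<close>

lemma order_left_root:
  assumes n: "n \<ge> 1" and root: "poly (Dpoly n c) w = 0" and w: "Re w \<le> -1/2"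
  shows "order w (Dpoly n c) = 1"
proof -
  define S where "S = (\<Sum>j<2*n. 1 / (of_real (real j + 1/2) - (w + 1/2)))"
  have S: "Re S > 0" unfolding S_def using logp0_deriv_Re[of "w + 1/2" n] w n by simp
  have "((\<lambda>w. exp (logp0 n (w + 1/2)) + (-1) ^ n * of_real c) has_field_derivative
          exp (logp0 n (w + 1/2)) * (- S * 1) + 0) (at w)"
    unfolding S_def
    by (intro DERIV_add DERIV_const DERIV_chain2[OF DERIV_exp] DERIV_chain2[OF logp0_deriv])
       (use w in \<open>auto intro!: derivative_eq_intros\<close>)
  hence "(poly (Dpoly n c) has_field_derivative exp (logp0 n (w + 1/2)) * (- S * 1) + 0) (at w)"
  proof (rule has_field_derivative_transform_within_open)
    show "open {w. Re w < 0}" by (rule open_halfspace_Re_lt)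
    show "w \<in> {w. Re w < 0}" using w by simp
  qed (simp add: poly_Dpoly exp_logp0_half)
  hence "poly (pderiv (Dpoly n c)) w = exp (logp0 n (w + 1/2)) * (- S * 1) + 0"
    using poly_DERIV DERIV_unique by blast
  hence nz: "poly (pderiv (Dpoly n c)) w \<noteq> 0" using S by auto
  have "order w (Dpoly n c) = Suc (order w (pderiv (Dpoly n c)))"
    by (rule order_pderiv[OF Dpoly_monic(3)[OF n] root])
  thus ?thesis using order_0I[OF nz] by simp
qed

lemma num_L2_sols_eq_left_count:
  assumes n: "n \<ge> 1" and d: "d > 0"
  shows "num_L2_sols n c d \<mu> = 2 * n - left_count n ((-1) ^ (n - 1) * c)"
proof -
  define I where "I = frob_index n c"
  have I: "finite I" "card I = 2 * n" using frob_index[OF n] by (auto simp: I_def)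
  define L where "L = {j \<in> I. Re (fst j) \<le> -1/2}"
  have "{j \<in> I. Re (fst j) > -1/2} = I - L" by (auto simp: L_def)
  hence "num_L2_sols n c d \<mu> = card (I - L)"
    using num_L2_sols_eq_card[OF n d] by (simp add: I_def)
  also have "\<dots> = 2 * n - card L" using I by (subst card_Diff_subset) (auto simp: L_def)
  also have "L = (\<lambda>z. (z - 1/2, 0)) ` {z. Re z \<le> 0 \<and> p0 n z = of_real ((-1) ^ (n - 1) * c)}" (is "_ = ?f ` ?Z")
  proof (intro equalityI subsetI)
    fix j assume "j \<in> L"
    then obtain w m where j: "j = (w, m)" "poly (Dpoly n c) w = 0" "m < order w (Dpoly n c)" "Re w \<le> -1/2"
      by (auto simp: L_def I_def frob_index_def)
    have "m = 0" using order_left_root[OF n j(2,4)] j(3) by simp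
    thus "j \<in> ?f ` ?Z" using j poly_Dpoly_eq_0_iff[OF n, of c w]
      by (intro image_eqI[of _ _ "w + 1/2"]) auto
  next
    fix j assume "j \<in> ?f ` ?Z"
    then obtain z where z: "j = (z - 1/2, 0)" "Re z \<le> 0" "p0 n z = of_real ((-1) ^ (n - 1) * c)" by auto
    have root: "poly (Dpoly n c) (z - 1/2) = 0" using poly_Dpoly_eq_0_iff[OF n, of c "z - 1/2"] z by simp
    have "Re (z - 1/2) \<le> -1/2" using z by simp
    from order_left_root[OF n root this] show "j \<in> L" using root z
      by (simp add: L_def I_def frob_index_def)
  qed
  also have "card \<dots> = left_count n ((-1) ^ (n - 1) * c)"
    unfolding left_count_def by (rule card_image) (auto simp: inj_on_def)
  finally show ?thesis .
qed

section \<open>The determinant polynomial\<close>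

lemma det_nat_eq_0_of_kernel:
  fixes A :: "nat \<Rightarrow> nat \<Rightarrow> real"
  assumes ker: "\<And>i. i \<in> {1..m} \<Longrightarrow> (\<Sum>j\<in>{1..m}. w j * A i j) = 0"
    and j0: "j0 \<in> {1..m}" "w j0 \<noteq> 0"
  shows "det_nat m A = 0"
proof -
  let ?S = "{1..m}" and ?P = "{p. p permutes {1..m}}"
  have finP: "finite ?P" by (rule finite_permutations) simp
  \<comment> \<open>The determinant with column j0 replaced by f. Each permutation uses this column
    in one row only, so D is linear; applied to the vanishing combination of columns it leaves w j0
    times the determinant.\<close>
  define D where "D f = (\<Sum>p\<in>?P. of_int (sign p) * (\<Prod>i\<in>?S. if p i = j0 then f i else A i (p i)))" for f
  define R where "R p = (\<Prod>i\<in>?S - {inv p j0}. A i (p i))" for p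
  have D_alt: "D f = (\<Sum>p\<in>?P. of_int (sign p) * (f (inv p j0) * R p))" for f
    unfolding D_def
  proof (intro sum.cong refl arg_cong2[where f = "(*)"])
    fix p assume "p \<in> ?P"
    hence p: "p permutes ?S" by simp
    have inS: "inv p j0 \<in> ?S" using permutes_in_image[OF permutes_inv[OF p]] j0 by blast
    have eq: "p i = j0 \<longleftrightarrow> i = inv p j0" for i using permutes_inv_eq[OF p, of j0 i] by auto
    show "(\<Prod>i\<in>?S. if p i = j0 then f i else A i (p i)) = f (inv p j0) * R p"
      unfolding prod.remove[OF finite_atLeastAtMost inS] R_def eq by (auto intro!: prod.cong)
  qed
  have D_lin: "D (\<lambda>i. \<Sum>j\<in>?S. w j * A i j) = (\<Sum>j\<in>?S. w j * D (\<lambda>i. A i j))"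
    unfolding D_alt sum_distrib_left sum_distrib_right
    by (subst sum.swap) (simp add: mult_ac)
  have D_col: "D (\<lambda>i. A i j) = 0" if j: "j \<in> ?S" "j \<noteq> j0" for j
  proof -
    \<comment> \<open>Columns j and j0 are now equal, so composing with their transposition reverses
      every sign and D equals -D.\<close>
    define t where "t = Transposition.transpose j j0"
    have t: "t permutes ?S" unfolding t_def using j j0 by (intro permutes_swap_id)
    let ?g = "\<lambda>p. of_int (sign p) * (\<Prod>i\<in>?S. if p i = j0 then A i j else A i (p i))"
    have "D (\<lambda>i. A i j) = (\<Sum>p\<in>?P. ?g (t \<circ> p))"
      unfolding D_def by (rule setum_permutations_compose_left[OF t])
    also have "\<dots> = (\<Sum>p\<in>?P. - ?g p)"
    proof (rule sum.cong[OF refl])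
      fix p assume "p \<in> ?P"
      hence p: "p permutes ?S" by simp
      have "sign (t \<circ> p) = sign t * sign p"
        by (rule sign_compose) (use t p in \<open>auto intro: permutes_imp_permutation\<close>)
      moreover have "sign t = -1" unfolding t_def using j by (simp add: sign_swap_id)
      moreover have "(\<Prod>i\<in>?S. if (t \<circ> p) i = j0 then A i j else A i ((t \<circ> p) i)) =
            (\<Prod>i\<in>?S. if p i = j0 then A i j else A i (p i))"
        by (intro prod.cong refl) (auto simp: t_def Transposition.transpose_def)
      ultimately show "?g (t \<circ> p) = - ?g p" by simp
    qed
    also have "\<dots> = - D (\<lambda>i. A i j)" by (simp add: D_def sum_negf)
    finally show ?thesis by simp
  qed
  have "D (\<lambda>i. \<Sum>j\<in>?S. w j * A i j) = D (\<lambda>i. 0)"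
    unfolding D_def using ker by (intro sum.cong refl arg_cong2[where f = "(*)"] prod.cong) auto
  also have "\<dots> = 0" by (simp add: D_alt)
  finally have "0 = (\<Sum>j\<in>?S. w j * D (\<lambda>i. A i j))" using D_lin by simp
  also have "\<dots> = w j0 * D (\<lambda>i. A i j0) + (\<Sum>j\<in>?S - {j0}. w j * D (\<lambda>i. A i j))"
    by (rule sum.remove) (use j0 in auto)
  also have "(\<Sum>j\<in>?S - {j0}. w j * D (\<lambda>i. A i j)) = 0"
    by (intro sum.neutral ballI) (use D_col in auto)
  finally have "D (\<lambda>i. A i j0) = 0" using j0 by simp
  also have "D (\<lambda>i. A i j0) = det_nat m A"
    unfolding D_def det_nat_def by (intro sum.cong refl arg_cong2[where f = "(*)"] prod.cong) auto
  finally show ?thesis .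
qed

lemma poly_det_nat: "poly (det_nat m A) x = det_nat m (\<lambda>i j. poly (A i j) x)"
  by (simp add: det_nat_def poly_sum poly_prod)

lemma linear_factor_mult: "[:- b, 1:] * P = pCons 0 P - smult b (P :: 'a::comm_ring_1 poly)"
  by simp

lemma prod_linear_factors:
  fixes b :: "nat \<Rightarrow> real"
  shows "degree (\<Prod>j\<in>{1..N}. [:- b j, 1:]) = N" "coeff (\<Prod>j\<in>{1..N}. [:- b j, 1:]) N = 1"
    "N \<ge> 1 \<Longrightarrow> coeff (\<Prod>j\<in>{1..N}. [:- b j, 1:]) (N - 1) = - (\<Sum>j\<in>{1..N}. b j)"
proof -
  show deg: "degree (\<Prod>j\<in>{1..N}. [:- b j, 1:]) = N" for N
    by (subst degree_prod_eq_sum_degree) auto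
  have "lead_coeff (\<Prod>j\<in>{1..N}. [:- b j, 1:]) = 1" for N by (simp add: lead_coeff_prod)
  thus lead: "coeff (\<Prod>j\<in>{1..N}. [:- b j, 1:]) N = 1" for N unfolding deg .
  have "coeff (\<Prod>j\<in>{1..Suc N}. [:- b j, 1:]) N = - (\<Sum>j\<in>{1..Suc N}. b j)" for N
  proof (induction N)
    case (Suc N)
    have "(\<Prod>j\<in>{1..Suc (Suc N)}. [:- b j, 1:]) =
          [:- b (Suc (Suc N)), 1:] * (\<Prod>j\<in>{1..Suc N}. [:- b j, 1:])"
      by (simp add: prod.atLeast_Suc_atMost_Suc_shift[symmetric] mult.commute del: mult_pCons_left mult_pCons_right)
    thus ?case using Suc lead[of "Suc N"] unfolding linear_factor_mult by simp
  qed simp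
  thus "N \<ge> 1 \<Longrightarrow> coeff (\<Prod>j\<in>{1..N}. [:- b j, 1:]) (N - 1) = - (\<Sum>j\<in>{1..N}. b j)"
    by (cases N) auto
qed

lemma Dshift_eq: "Dshift n = (\<Prod>j\<in>{1..2*n}. [:- (real j - 1/2), 1:])"
  unfolding Dshift_def by (intro prod.cong refl) (auto simp: of_nat_diff)

text \<open>The coefficient below the leading one is minus the sum of the roots j - 1/2, all
  positive. It enters the top coefficient of \<open>hpoly\<close>.\<close>

lemma qcoeff_top:
  assumes "n \<ge> 1"
  shows "qcoeff n (2 * n - 1) \<noteq> 0" "\<And>k. 2 * n < k \<Longrightarrow> qcoeff n k = 0"
proof -
  have "0 < (\<Sum>j\<in>{1..2*n}. real j - 1/2)"
    by (rule sum_pos) (use assms in auto)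
  thus "qcoeff n (2 * n - 1) \<noteq> 0"
    unfolding qcoeff_def Dshift_eq using assms by (subst prod_linear_factors(3)) auto
  show "qcoeff n k = 0" if "2 * n < k" for k
    unfolding qcoeff_def Dshift_eq using that
    by (intro coeff_eq_0) (simp only: prod_linear_factors(1))
qed

section \<open>Rationality of the coefficients of \<open>hpoly\<close>\<close>

lemma coeff_mult_Rats:
  fixes p q :: "real poly"
  assumes "\<And>i. coeff p i \<in> \<rat>" "\<And>i. coeff q i \<in> \<rat>"
  shows "coeff (p * q) i \<in> \<rat>"
  unfolding coeff_mult using assms by (intro Rats_sum Rats_mult)

lemma coeff_prod_Rats:
  fixes f :: "'a \<Rightarrow> real poly"
  assumes "\<And>x i. x \<in> A \<Longrightarrow> coeff (f x) i \<in> \<rat>"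
  shows "coeff (prod f A) i \<in> \<rat>"
  using assms
proof (induction A arbitrary: i rule: infinite_finite_induct)
  case (insert x A)
  thus ?case by (auto intro!: coeff_mult_Rats)
qed (auto simp: one_pCons coeff_pCons split: nat.splits)

lemma coeff_pCons_Rats: "a \<in> \<rat> \<Longrightarrow> (\<And>i. coeff p i \<in> \<rat>) \<Longrightarrow> coeff (pCons a p) i \<in> \<rat>"
  by (cases i) auto

lemma qcoeff_Rats: "qcoeff n k \<in> \<rat>"
  unfolding qcoeff_def Dshift_def
  by (intro coeff_prod_Rats coeff_pCons_Rats Rats_diff) auto

lemma Hentry_Rats: "coeff (Hentry n i j) k \<in> \<rat>"
  unfolding Hentry_def acoeff_def
  by (auto intro!: coeff_pCons_Rats qcoeff_Rats simp del: coeff_pCons_0)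

lemma hpoly_Rats: "coeff (hpoly n) k \<in> \<rat>"
  unfolding hpoly_def det_nat_def coeff_sum
proof (rule Rats_sum)
  fix p :: "nat \<Rightarrow> nat"
  have "of_int (sign p) = [:real_of_int (sign p):]" by (simp add: of_int_poly)
  hence "\<And>i. coeff (of_int (sign p)) i \<in> (\<rat> :: real set)" by (auto intro!: coeff_pCons_Rats)
  thus "coeff (of_int (sign p) * (\<Prod>i\<in>{1..2*n-1}. Hentry n i (p i))) k \<in> \<rat>"
    by (intro coeff_mult_Rats coeff_prod_Rats Hentry_Rats)
qed

text \<open>The coefficient is read off at prescribed degree bounds instead of actual degrees, so
  products of lower degree simply give 0 and all Leibniz terms are treated alike.\<close>

lemma coeff_prod_degree_bound:
  fixes f :: "'a \<Rightarrow> 'b::comm_ring_1 poly"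
  assumes "finite A" "\<And>i. i \<in> A \<Longrightarrow> degree (f i) \<le> e i"
  shows "degree (prod f A) \<le> sum e A \<and> coeff (prod f A) (sum e A) = (\<Prod>i\<in>A. coeff (f i) (e i))"
  using assms
proof (induction A rule: finite_induct)
  case (insert x A)
  have IH: "degree (prod f A) \<le> sum e A" "coeff (prod f A) (sum e A) = (\<Prod>i\<in>A. coeff (f i) (e i))"
    using insert by auto
  have x: "degree (f x) \<le> e x" using insert by auto
  have "coeff (f x * prod f A) (e x + sum e A) = coeff (f x) (e x) * coeff (prod f A) (sum e A)"
  proof -
    have "coeff (f x * prod f A) (e x + sum e A) =
          (\<Sum>i\<le>e x + sum e A. coeff (f x) i * coeff (prod f A) (e x + sum e A - i))"
      by (rule coeff_mult)
    also have "\<dots> = (\<Sum>i\<in>{e x}. coeff (f x) i * coeff (prod f A) (e x + sum e A - i))"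
    proof (rule sum.mono_neutral_right)
      show "\<forall>i\<in>{..e x + sum e A} - {e x}. coeff (f x) i * coeff (prod f A) (e x + sum e A - i) = 0"
      proof
        fix i assume i: "i \<in> {..e x + sum e A} - {e x}"
        show "coeff (f x) i * coeff (prod f A) (e x + sum e A - i) = 0"
        proof (cases "i < e x")
          case True
          hence "coeff (prod f A) (e x + sum e A - i) = 0" using IH(1) by (intro coeff_eq_0) linarith
          thus ?thesis by simp
        next
          case False
          hence "coeff (f x) i = 0" using x i by (intro coeff_eq_0) auto
          thus ?thesis by simp
        qed
      qed
    qed auto
    finally show ?thesis by simp
  qed
  moreover have "degree (f x * prod f A) \<le> e x + sum e A"
    using degree_mult_le[of "f x" "prod f A"] x IH by linarith
  ultimately show ?case using insert IH by simp
qed simp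

text \<open>Bound for the degree in c of the entries in row i: a_0 sits at 2n - 2j + i = 0, which
  requires i even. Among the rows 1, ..., 2n-1 there are n - 1 even ones, hence the degree of
  \<open>hpoly\<close>.\<close>

definition hexp :: "nat \<Rightarrow> nat" where "hexp i = (if even i then 1 else 0)"

lemma sum_hexp: "n \<ge> 1 \<Longrightarrow> sum hexp {1..2*n-1} = n - 1"
proof (induction n rule: nat_induct_at_least)
  case (Suc n)
  have "{1..2 * Suc n - 1} = insert (2*n) (insert (2*n+1) {1..2*n-1})" using Suc by auto
  thus ?case using Suc by (simp add: hexp_def)
qed (simp add: hexp_def)

lemma degree_Hentry: "degree (Hentry n i j) \<le> hexp i"
proof (cases "2 * int n - 2 * int j + int i = 0")
  case True
  hence "even (int i)" by presburger
  thus ?thesis using True by (simp add: Hentry_def acoeff_def hexp_def)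
qed (auto simp: Hentry_def acoeff_def)

text \<open>Row 2l is sent to column n + l, where the entry is a_0, and row 2l - 1 to column l,
  where it is a_{2n-1}.\<close>

definition hperm :: "nat \<Rightarrow> nat \<Rightarrow> nat" where
  "hperm n i = (if i \<in> {1..2*n-1} then (if even i then n + i div 2 else (i + 1) div 2) else i)"

lemma hperm_permutes: "hperm n permutes {1..2*n-1}"
proof (rule bij_imp_permutes)
  have inj: "inj_on (hperm n) {1..2*n-1}"
  proof (rule inj_onI)
    fix i j assume "i \<in> {1..2*n-1}" "j \<in> {1..2*n-1}" "hperm n i = hperm n j"
    thus "i = j" unfolding hperm_def by (auto split: if_splits elim!: evenE oddE)
  qed
  have "hperm n ` {1..2*n-1} \<subseteq> {1..2*n-1}"
    unfolding hperm_def by (auto elim!: evenE oddE)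
  hence "hperm n ` {1..2*n-1} = {1..2*n-1}" using inj by (intro endo_inj_surj) auto
  thus "bij_betw (hperm n) {1..2*n-1} {1..2*n-1}" using inj by (simp add: bij_betw_def)
qed (auto simp: hperm_def)

text \<open>The rows with even index must supply the entry containing c; in the remaining rows the matrix
  is triangular, so only one permutation contributes to the top coefficient.\<close>

lemma hperm_unique:
  assumes n: "n \<ge> 1" and p: "p permutes {1..2*n-1}"
    and nz: "\<And>i. i \<in> {1..2*n-1} \<Longrightarrow> coeff (Hentry n i (p i)) (hexp i) \<noteq> 0"
  shows "p = hperm n"
proof -
  have inS: "p i \<in> {1..2*n-1} \<longleftrightarrow> i \<in> {1..2*n-1}" for i using permutes_in_image[OF p] .
  have inj: "p i = p j \<longleftrightarrow> i = j" for i j using permutes_inj[OF p] by (auto simp: inj_def)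
  have even: "p (2 * l) = n + l" if l: "1 \<le> l" "l \<le> n - 1" for l
  proof -
    have "coeff (acoeff n (2 * int n - 2 * int (p (2*l)) + int (2*l))) 1 \<noteq> 0"
      using nz[of "2*l"] l n by (auto simp: Hentry_def hexp_def)
    hence "2 * int n - 2 * int (p (2*l)) + int (2*l) = 0"
      by (auto simp: acoeff_def coeff_pCons split: if_splits nat.splits)
    thus ?thesis by linarith
  qed
  have odd_bounds: "l \<le> p (2 * l - 1) \<and> p (2 * l - 1) \<le> n" if l: "1 \<le> l" "l \<le> n" for l
  proof -
    have in1: "2 * l - 1 \<in> {1..2*n-1}" using l by auto
    have "coeff (acoeff n (2 * int n - 2 * int (p (2*l-1)) + int (2*l-1))) 0 \<noteq> 0"
      using nz[OF in1] l by (auto simp: Hentry_def hexp_def)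
    moreover have "2 * int n - 2 * int (p (2*l-1)) + int (2*l-1) \<noteq> 0" using l by presburger
    ultimately have "2 * int n - 2 * int (p (2*l-1)) + int (2*l-1) \<le> 2 * int n"
      by (auto simp: acoeff_def split: if_splits)
    hence 1: "l \<le> p (2*l-1)" using l by linarith
    \<comment> \<open>The columns beyond n are already taken by the even rows.\<close>
    have 2: "p (2*l-1) \<le> n"
    proof (rule ccontr)
      assume gt: "\<not> p (2*l-1) \<le> n"
      define l' where "l' = p (2*l-1) - n"
      have "1 \<le> l'" "l' \<le> n - 1" "p (2*l-1) = n + l'"
        using gt inS[of "2*l-1"] in1 by (auto simp: l'_def)
      hence "p (2*l-1) = p (2*l')" using even by simp
      hence "2*l-1 = 2*l'" using inj by simp
      thus False using l by presburger
    qed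
    from 1 2 show ?thesis by simp
  qed
  \<comment> \<open>Downward induction on l: the columns l + 1, ..., n belong to the later odd rows,
    which leaves only l.\<close>
  have odd: "p (2 * l - 1) = l" if "1 \<le> l" "l \<le> n" for l
    using that
  proof (induction "n - l" arbitrary: l rule: less_induct)
    case less
    show ?case
    proof (rule ccontr)
      assume ne: "p (2 * l - 1) \<noteq> l"
      define l' where "l' = p (2 * l - 1)"
      have l': "l < l'" "l' \<le> n" using odd_bounds[OF less.prems] ne by (auto simp: l'_def)
      have "p (2 * l' - 1) = l'" by (rule less.hyps) (use l' less.prems in auto)
      hence "2 * l' - 1 = 2 * l - 1" using inj by (simp add: l'_def)
      thus False using l' less.prems by linarith
    qed
  qed
  show ?thesis
  proof
    fix i
    show "p i = hperm n i"
    proof (cases "i \<in> {1..2*n-1}")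
      case True
      show ?thesis
      proof (cases "even i")
        case ev: True
        then obtain l where "i = 2 * l" by (elim evenE)
        thus ?thesis using even[of l] True by (auto simp: hperm_def)
      next
        case False
        then obtain l where "i = 2 * l + 1" by (elim oddE)
        thus ?thesis using odd[of "l + 1"] True by (auto simp: hperm_def)
      qed
    next
      case False
      thus ?thesis using permutes_not_in[OF p] by (auto simp: hperm_def)
    qed
  qed
qed

text \<open>Up to sign the coefficient of c^(n-1) is the n-th power of q_{2n-1}: the even rows
  contribute signs, the n odd rows one q_{2n-1} each.\<close>

lemma hpoly_degree:
  assumes n: "n \<ge> 1"
  shows "degree (hpoly n) = n - 1" "hpoly n \<noteq> 0"
proof -
  let ?S = "{1..2*n-1}" and ?P = "{p. p permutes {1..2*n-1}}"
  have finP: "finite ?P" by (rule finite_permutations) simp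
  define t where "t p = of_int (sign p) * (\<Prod>i\<in>?S. Hentry n i (p i))" for p
  have sgn: "of_int (sign p) = [:real_of_int (sign p):]" for p :: "nat \<Rightarrow> nat" by (simp add: of_int_poly)
  have prod: "degree (\<Prod>i\<in>?S. Hentry n i (p i)) \<le> n - 1"
    "coeff (\<Prod>i\<in>?S. Hentry n i (p i)) (n - 1) = (\<Prod>i\<in>?S. coeff (Hentry n i (p i)) (hexp i))" for p
    using coeff_prod_degree_bound[of ?S "\<lambda>i. Hentry n i (p i)" hexp] degree_Hentry sum_hexp[OF n] by auto
  have le: "degree (hpoly n) \<le> n - 1"
    unfolding hpoly_def det_nat_def
  proof (rule degree_sum_le[OF finP])
    fix p
    show "degree (of_int (sign p) * (\<Prod>i\<in>?S. Hentry n i (p i))) \<le> n - 1"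
      unfolding sgn using prod(1)[of p] by (simp add: order.trans[OF degree_smult_le])
  qed
  have "coeff (hpoly n) (n - 1) =
        (\<Sum>p\<in>?P. real_of_int (sign p) * (\<Prod>i\<in>?S. coeff (Hentry n i (p i)) (hexp i)))"
    unfolding hpoly_def det_nat_def coeff_sum sgn
    by (intro sum.cong refl) (simp add: prod(2)[unfolded One_nat_def])
  also have "\<dots> = (\<Sum>p\<in>{hperm n}. real_of_int (sign p) * (\<Prod>i\<in>?S. coeff (Hentry n i (p i)) (hexp i)))"
  proof (rule sum.mono_neutral_right[OF finP])
    show "{hperm n} \<subseteq> ?P" using hperm_permutes[of n] by blast
    show "\<forall>p\<in>?P - {hperm n}. real_of_int (sign p) * (\<Prod>i\<in>?S. coeff (Hentry n i (p i)) (hexp i)) = 0"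
    proof
      fix p assume "p \<in> ?P - {hperm n}"
      then obtain i where "i \<in> ?S" "coeff (Hentry n i (p i)) (hexp i) = 0"
        using hperm_unique[OF n, of p] by blast
      hence "(\<Prod>i\<in>?S. coeff (Hentry n i (p i)) (hexp i)) = 0" by (intro prod_zero) auto
      thus "real_of_int (sign p) * (\<Prod>i\<in>?S. coeff (Hentry n i (p i)) (hexp i)) = 0" by simp
    qed
  qed
  also have "\<dots> \<noteq> 0"
  proof -
    have "coeff (Hentry n i (hperm n i)) (hexp i) \<noteq> 0" if i: "i \<in> ?S" for i
    proof (cases "even i")
      case True
      then obtain l where l: "i = 2 * l" by (elim evenE)
      thus ?thesis using i by (simp add: Hentry_def acoeff_def hperm_def hexp_def)
    next
      case False
      then obtain l where l: "i = 2 * l + 1" by (elim oddE)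
      have "2 * int n - 2 * int (hperm n i) + int i = int (2 * n - 1)"
        using i l n by (simp add: hperm_def of_nat_diff)
      hence "Hentry n i (hperm n i) = acoeff n (int (2 * n - 1))"
        unfolding Hentry_def by (simp only:)
      also have "\<dots> = [:qcoeff n (2 * n - 1):]"
      proof -
        have "int (2 * n - 1) \<noteq> 0" "1 \<le> int (2 * n - 1)" "int (2 * n - 1) \<le> 2 * int n" using n by linarith+
        thus ?thesis by (simp only: acoeff_def nat_int if_False if_True simp_thms)
      qed
      finally have "Hentry n i (hperm n i) = [:qcoeff n (2 * n - 1):]" .
      thus ?thesis using qcoeff_top(1)[OF n] False by (simp add: hexp_def)
    qed
    moreover have "real_of_int (sign (hperm n)) \<noteq> 0" by (simp add: sign_def)
    ultimately show ?thesis by simp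
  qed
  finally have nz: "coeff (hpoly n) (n - 1) \<noteq> 0" .
  thus "hpoly n \<noteq> 0" by auto
  show "degree (hpoly n) = n - 1" using le le_degree[OF nz] by simp
qed

section \<open>Zeros of \<open>hpoly\<close> from purely imaginary roots\<close>

lemma prod_linear_factors_eval:
  "(\<Prod>j\<in>{1..N}. z - complex_of_real (b j)) =
   (\<Sum>k\<le>N. of_real (coeff (\<Prod>j\<in>{1..N}. [:- b j, 1:]) k) * z ^ k)"
proof (induction N)
  case (Suc N)
  define P where "P = (\<Prod>j\<in>{1..N}. [:- b j, 1:])"
  have deg: "degree P = N" unfolding P_def by (rule prod_linear_factors(1))
  have "(\<Prod>j\<in>{1..Suc N}. [:- b j, 1:]) = [:- b (Suc N), 1:] * P"
    by (simp add: P_def mult.commute del: mult_pCons_left mult_pCons_right)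
  hence *: "coeff (\<Prod>j\<in>{1..Suc N}. [:- b j, 1:]) k = coeff (pCons 0 P) k - b (Suc N) * coeff P k" for k
    by (simp only: linear_factor_mult coeff_diff coeff_smult)
  have "(\<Sum>k\<le>Suc N. of_real (coeff (\<Prod>j\<in>{1..Suc N}. [:- b j, 1:]) k) * z ^ k) =
        (\<Sum>k\<le>Suc N. of_real (coeff (pCons 0 P) k) * z ^ k) -
        of_real (b (Suc N)) * (\<Sum>k\<le>Suc N. of_real (coeff P k) * z ^ k)"
    unfolding * sum_distrib_left sum_subtractf[symmetric]
    by (intro sum.cong refl) (simp add: left_diff_distrib mult.assoc)
  also have "(\<Sum>k\<le>Suc N. of_real (coeff (pCons 0 P) k) * z ^ k) = z * (\<Sum>k\<le>N. of_real (coeff P k) * z ^ k)"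
    by (subst sum.atMost_Suc_shift) (simp add: sum_distrib_left mult_ac)
  also have "(\<Sum>k\<le>Suc N. of_real (coeff P k) * z ^ k) = (\<Sum>k\<le>N. of_real (coeff P k) * z ^ k)"
    using deg by (simp add: coeff_eq_0)
  also have "(\<Sum>k\<le>N. of_real (coeff P k) * z ^ k) = (\<Prod>j\<in>{1..N}. z - of_real (b j))"
    using Suc.IH unfolding P_def by (rule sym)
  finally show ?case by (simp add: algebra_simps)
qed simp

lemma p0_eq_sum: "p0 n z = (\<Sum>k\<le>2*n. of_real (qcoeff n k) * z ^ k)"
proof -
  have "p0 n z = (\<Prod>j<2*n. (-1) * (z - of_real (real (Suc j) - 1/2)))"
    unfolding p0_def by (intro prod.cong) auto
  also have "\<dots> = (\<Prod>j<2*n. z - of_real (real (Suc j) - 1/2))"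
    unfolding prod.distrib by simp
  also have "\<dots> = (\<Prod>j\<in>{1..2*n}. z - of_real (real j - 1/2))"
    by (rule prod.reindex_bij_witness[of _ "\<lambda>j. j - 1" Suc]) auto
  finally show ?thesis unfolding prod_linear_factors_eval qcoeff_def Dshift_eq .
qed

lemma sum_even_odd_split:
  fixes f :: "nat \<Rightarrow> 'a::comm_monoid_add"
  shows "(\<Sum>k\<le>2*n. f k) = (\<Sum>s\<le>n. f (2 * s)) + (\<Sum>s<n. f (2 * s + 1))"
  by (induction n) (simp_all add: ac_simps)

text \<open>For a root iy of D(z - 1/2; c), the powers of -y^2 span the kernel of the submatrix
  of H, because the even and the odd part of the polynomial vanish separately.\<close>

lemma hpoly_root:
  assumes n: "n \<ge> 1" and y: "y \<noteq> 0" and root: "p0 n (Complex 0 y) = of_real ((-1) ^ (n - 1) * c)"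
  shows "poly (hpoly n) c = 0"
proof -
  define al where "al k = qcoeff n k + (if k = 0 then (-1) ^ n * c else 0)" for k
  define u where "u = - (y\<^sup>2)"
  define E where "E = (\<Sum>s\<le>n. al (2 * s) * u ^ s)"
  define Od where "Od = (\<Sum>s<n. al (2 * s + 1) * u ^ s)"
  have sg: "(-1 :: real) ^ n = - ((-1) ^ (n - 1))" using n by (cases n) auto
  have al: "poly (acoeff n (int k)) c = al k" if "k \<le> 2 * n" for k
    using that by (auto simp: acoeff_def al_def)
  have sq: "Complex 0 y ^ (2 * s) = of_real (u ^ s)" for s
  proof -
    have "Complex 0 y ^ 2 = of_real u" by (simp add: u_def complex_eq_iff power2_eq_square)
    thus ?thesis by (simp add: power_mult)
  qed
  have "(\<Sum>k\<le>2*n. of_real (al k) * Complex 0 y ^ k) =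
        (\<Sum>k\<le>2*n. of_real (qcoeff n k) * Complex 0 y ^ k) +
        (\<Sum>k\<le>2*n. if k = 0 then of_real ((-1) ^ n * c) else 0)"
    unfolding sum.distrib[symmetric] by (intro sum.cong) (auto simp: al_def algebra_simps)
  also have "\<dots> = 0" unfolding p0_eq_sum[symmetric] root sg by simp
  finally have "0 = (\<Sum>k\<le>2*n. of_real (al k) * Complex 0 y ^ k)" by simp
  also have "\<dots> = of_real E + Complex 0 y * of_real Od"
    unfolding sum_even_odd_split E_def Od_def of_real_sum sum_distrib_left
    by (intro arg_cong2[where f = "(+)"] sum.cong refl)
      (simp_all only: power_add power_one_right sq of_real_mult, simp_all only: mult_ac)
  finally have "Complex E (y * Od) = 0" by (simp add: complex_eq_iff)
  hence E0: "E = 0" and O0: "Od = 0" using y by (auto simp: complex_eq_iff)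
  have "det_nat (2 * n - 1) (\<lambda>i j. poly (Hentry n i j) c) = 0"
  \<comment> \<open>The powers of u are indexed backwards so that the last entry of the kernel
    vector is 1.\<close>
  proof (rule det_nat_eq_0_of_kernel[where w = "\<lambda>j. u ^ (2 * n - 1 - j)" and ?j0.0 = "2 * n - 1"])
    show "2 * n - 1 \<in> {1..2 * n - 1}" using n by auto
    show "u ^ (2 * n - 1 - (2 * n - 1)) \<noteq> 0" by simp
    fix i assume i: "i \<in> {1..2 * n - 1}"
    show "(\<Sum>j\<in>{1..2 * n - 1}. u ^ (2 * n - 1 - j) * poly (Hentry n i j) c) = 0"
    proof (cases "even i")
      case True
      then obtain l where l: "i = 2 * l" by (elim evenE)
      have l1: "1 \<le> l" "l \<le> n - 1" using i l by auto
      \<comment> \<open>In column n + l - s an even row has the entry a_{2s}, an odd row (below)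
        a_{2s+1}. All other entries vanish, and the row sum is u^(n-1-l) times the even or odd
        part.\<close>
      let ?g = "\<lambda>s. n + l - s"
      have "(\<Sum>j\<in>{1..2 * n - 1}. u ^ (2 * n - 1 - j) * poly (Hentry n i j) c) =
            (\<Sum>j\<in>?g ` {..n}. u ^ (2 * n - 1 - j) * poly (Hentry n i j) c)"
      proof (rule sum.mono_neutral_right)
        show "?g ` {..n} \<subseteq> {1..2 * n - 1}" using l1 by auto
        show "\<forall>j\<in>{1..2 * n - 1} - ?g ` {..n}. u ^ (2 * n - 1 - j) * poly (Hentry n i j) c = 0"
        proof
          fix j assume j: "j \<in> {1..2 * n - 1} - ?g ` {..n}"
          have "\<not> (j \<le> n + l \<and> l \<le> j)"
          proof
            assume "j \<le> n + l \<and> l \<le> j"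
            hence "j = ?g (n + l - j)" "n + l - j \<in> {..n}" by auto
            thus False using j by blast
          qed
          hence "Hentry n i j = 0" by (auto simp: Hentry_def acoeff_def l)
          thus "u ^ (2 * n - 1 - j) * poly (Hentry n i j) c = 0" by simp
        qed
      qed simp
      also have "\<dots> = (\<Sum>s\<le>n. u ^ (2 * n - 1 - ?g s) * poly (Hentry n i (?g s)) c)"
        by (subst sum.reindex) (auto simp: inj_on_def)
      also have "\<dots> = (\<Sum>s\<le>n. u ^ (n - 1 - l) * (al (2 * s) * u ^ s))"
      proof (intro sum.cong refl)
        fix s assume s: "s \<in> {..n}"
        have "2 * int n - 2 * int (?g s) + int i = int (2 * s)" using s l by (simp add: of_nat_diff)
        hence "poly (Hentry n i (?g s)) c = al (2 * s)"
          unfolding Hentry_def using al[of "2 * s"] s by (simp only: atMost_iff)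
        moreover have "2 * n - 1 - ?g s = (n - 1 - l) + s" using s l1 by auto
        ultimately show "u ^ (2 * n - 1 - ?g s) * poly (Hentry n i (?g s)) c = u ^ (n - 1 - l) * (al (2 * s) * u ^ s)"
          by (simp add: power_add)
      qed
      also have "\<dots> = u ^ (n - 1 - l) * E" by (simp add: E_def sum_distrib_left)
      finally show ?thesis using E0 by simp
    next
      case False
      then obtain l where l: "i = 2 * l + 1" by (elim oddE)
      have l1: "l \<le> n - 1" using i l by auto
      let ?g = "\<lambda>s. n + l - s"
      have "(\<Sum>j\<in>{1..2 * n - 1}. u ^ (2 * n - 1 - j) * poly (Hentry n i j) c) =
            (\<Sum>j\<in>?g ` {..<n}. u ^ (2 * n - 1 - j) * poly (Hentry n i j) c)"
      proof (rule sum.mono_neutral_right)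
        show "?g ` {..<n} \<subseteq> {1..2 * n - 1}" using l1 n by auto
        show "\<forall>j\<in>{1..2 * n - 1} - ?g ` {..<n}. u ^ (2 * n - 1 - j) * poly (Hentry n i j) c = 0"
        proof
          fix j assume j: "j \<in> {1..2 * n - 1} - ?g ` {..<n}"
          have "\<not> (j \<le> n + l \<and> l < j)"
          proof
            assume "j \<le> n + l \<and> l < j"
            hence "j = ?g (n + l - j)" "n + l - j \<in> {..<n}" by auto
            thus False using j by blast
          qed
          hence "Hentry n i j = 0" unfolding Hentry_def acoeff_def l by auto
          thus "u ^ (2 * n - 1 - j) * poly (Hentry n i j) c = 0" by simp
        qed
      qed simp
      also have "\<dots> = (\<Sum>s<n. u ^ (2 * n - 1 - ?g s) * poly (Hentry n i (?g s)) c)"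
        by (subst sum.reindex) (auto simp: inj_on_def)
      also have "\<dots> = (\<Sum>s<n. u ^ (n - 1 - l) * (al (2 * s + 1) * u ^ s))"
      proof (intro sum.cong refl)
        fix s assume s: "s \<in> {..<n}"
        have "2 * int n - 2 * int (?g s) + int i = int (2 * s + 1)" using s l by (simp add: of_nat_diff)
        hence "poly (Hentry n i (?g s)) c = al (2 * s + 1)"
          unfolding Hentry_def using al[of "2 * s + 1"] s by (simp only: lessThan_iff)
        moreover have "2 * n - 1 - ?g s = (n - 1 - l) + s" using s l1 by auto
        ultimately show "u ^ (2 * n - 1 - ?g s) * poly (Hentry n i (?g s)) c = u ^ (n - 1 - l) * (al (2 * s + 1) * u ^ s)"
          by (simp add: power_add)
      qed
      also have "\<dots> = u ^ (n - 1 - l) * Od" by (simp add: Od_def sum_distrib_left)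
      finally show ?thesis using O0 by simp
    qed
  qed
  thus ?thesis by (simp add: hpoly_def poly_det_nat)
qed

section \<open>Asymptotics of the double factorial\<close>

lemma dfact_pos: "dfact n > 0"
  by (induction n rule: dfact.induct) auto

lemma dfact_odd: "dfact (2 * k + 1) * (2 ^ k * fact k) = fact (2 * k + 1)"
proof (induction k)
  case (Suc k)
  have "dfact (2 * Suc k + 1) * (2 ^ Suc k * fact (Suc k)) =
        (2 * k + 3) * (2 * k + 2) * (dfact (2 * k + 1) * (2 ^ k * fact k))"
    by (simp add: algebra_simps)
  also have "\<dots> = fact (2 * Suc k + 1)"
    unfolding Suc by (simp add: algebra_simps)
  finally show ?case .
qed simp

lemma dfact_4n:
  assumes "n \<ge> 1"
  shows "real (dfact (4 * n - 1)) = fact (4 * n) / (2 ^ (2 * n) * fact (2 * n))"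
proof -
  define k where "k = 2 * n - 1"
  have k: "4 * n - 1 = 2 * k + 1" "2 * n = Suc k" "4 * n = Suc (2 * k + 1)"
    using assms by (auto simp: k_def)
  have "real (dfact (2 * k + 1) * (2 ^ k * fact k)) = real (fact (2 * k + 1))"
    by (simp only: dfact_odd)
  hence "real (dfact (2 * k + 1)) * (2 ^ k * fact k) = fact (2 * k + 1)"
    by (simp only: of_nat_mult of_nat_power of_nat_fact of_nat_numeral)
  hence "real (dfact (2 * k + 1)) = fact (2 * k + 1) / (2 ^ k * fact k)"
    by (intro nonzero_eq_divide_eq[THEN iffD2]) auto
  also have "\<dots> = fact (Suc (2 * k + 1)) / (2 ^ Suc k * fact (Suc k))"
    by (simp add: divide_simps)
  finally show ?thesis using k by metis
qed

text \<open>The constant ln (sqrt (2 pi)) is left inside the error: only differences are used, in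
  which it cancels.\<close>

definition stirling_err :: "nat \<Rightarrow> real" where
  "stirling_err k = ln (fact k) - ((real k + 1/2) * ln (real k) - real k)"

text \<open>With x = 1/k the difference is (k + 1/2) ln(1 + x) - 1. The summand 1/2 cancels the term
  linear in x, which leaves an error of order x^2.\<close>

lemma stirling_err_step:
  assumes "k \<ge> 1"
  shows "\<bar>stirling_err k - stirling_err (Suc k)\<bar> \<le> 1 / real k ^ 2"
proof -
  define x where "x = 1 / real k"
  have x: "0 < x" "x \<le> 1" "real k * x = 1" using assms by (auto simp: x_def)
  have "ln (1 + x) = ln (real (Suc k)) - ln (real k)"
  proof -
    have "1 + x = real (Suc k) / real k" using assms by (simp add: x_def field_simps)
    thus ?thesis using assms by (simp add: ln_div)
  qed
  moreover have "ln (fact (Suc k)) = ln (real (Suc k)) + ln (fact k)"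
    by (simp add: ln_mult del: of_nat_Suc)
  moreover have "real (Suc k) = real k + 1" by simp
  ultimately have eq: "stirling_err k - stirling_err (Suc k) = (real k + 1/2) * ln (1 + x) - 1"
    unfolding stirling_err_def by (simp only:) (simp add: algebra_simps add_divide_distrib diff_divide_distrib)
  have up: "ln (1 + x) \<le> x - x^2/2 + x^3/3"
  proof -
    define f where "f = (\<lambda>t::real. t - t^2/2 + t^3/3 - ln (1 + t))"
    have "f 0 \<le> f x"
    proof (rule DERIV_nonneg_imp_nondecreasing[where f = f])
      fix t :: real assume t: "0 \<le> t" "t \<le> x"
      have "(f has_real_derivative t^3 / (1 + t)) (at t)"
        unfolding f_def using t
        by (auto intro!: derivative_eq_intros simp: field_simps power2_eq_square power3_eq_cube)
      moreover have "t^3 / (1 + t) \<ge> 0" using t by simp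
      ultimately show "\<exists>y. (f has_real_derivative y) (at t) \<and> y \<ge> 0" by blast
    qed (use x in simp)
    thus ?thesis by (simp add: f_def)
  qed
  have lo: "ln (1 + x) \<ge> x - x^2/2"
  proof -
    define f where "f = (\<lambda>t::real. ln (1 + t) - t + t^2/2)"
    have "f 0 \<le> f x"
    proof (rule DERIV_nonneg_imp_nondecreasing[where f = f])
      fix t :: real assume t: "0 \<le> t" "t \<le> x"
      have "(f has_real_derivative t^2 / (1 + t)) (at t)"
        unfolding f_def using t
        by (auto intro!: derivative_eq_intros simp: field_simps power2_eq_square)
      moreover have "t^2 / (1 + t) \<ge> 0" using t by simp
      ultimately show "\<exists>y. (f has_real_derivative y) (at t) \<and> y \<ge> 0" by blast
    qed (use x in simp)
    thus ?thesis by (simp add: f_def)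
  qed
  have kx: "(real k + 1/2) * x = 1 + x/2" using x by (simp add: algebra_simps)
  have "(real k + 1/2) * ln (1 + x) \<le> (real k + 1/2) * (x - x^2/2 + x^3/3)"
    using up by (intro mult_left_mono) auto
  also have "\<dots> = ((real k + 1/2) * x) * (1 - x/2 + x^2/3)"
    by (simp add: algebra_simps power2_eq_square power3_eq_cube)
  also have "\<dots> = 1 + x^2/12 + x^3/6" unfolding kx
    by (simp add: algebra_simps power2_eq_square power3_eq_cube)
  also have "\<dots> \<le> 1 + x^2"
  proof -
    have "x^3 \<le> x^2" using x by (intro power_decreasing) auto
    thus ?thesis using zero_le_power2[of x] by linarith
  qed
  finally have A: "(real k + 1/2) * ln (1 + x) - 1 \<le> x^2" by simp
  have "1 - x^2/4 = ((real k + 1/2) * x) * (1 - x/2)" unfolding kx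
    by (simp add: algebra_simps power2_eq_square)
  also have "\<dots> = (real k + 1/2) * (x - x^2/2)"
    by (simp add: algebra_simps power2_eq_square)
  also have "\<dots> \<le> (real k + 1/2) * ln (1 + x)"
    using lo by (intro mult_left_mono) auto
  finally have B: "(real k + 1/2) * ln (1 + x) - 1 \<ge> -(x^2)"
    using zero_le_power2[of x] by linarith
  from A B show ?thesis unfolding eq by (simp add: x_def abs_le_iff power_divide)
qed

lemma stirling_err_diff:
  assumes "n \<ge> 1"
  shows "\<bar>stirling_err (4 * n) - stirling_err (2 * n)\<bar> \<le> 1 / real n"
proof -
  \<comment> \<open>The denominator is (2n)^2, the bound for the first step; 2n steps give at most
    1/(2n).\<close>
  have "\<bar>stirling_err (2 * n + j) - stirling_err (2 * n)\<bar> \<le> real j / (4 * real n ^ 2)" for j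
  proof (induction j)
    case (Suc j)
    have "\<bar>stirling_err (2 * n + j) - stirling_err (Suc (2 * n + j))\<bar> \<le> 1 / real (2 * n + j) ^ 2"
      using assms by (intro stirling_err_step) auto
    also have "\<dots> \<le> 1 / real (2 * n) ^ 2"
      using assms by (intro divide_left_mono power_mono mult_pos_pos) auto
    finally show ?case using Suc by (simp add: add_divide_distrib)
  qed simp
  from this[of "2 * n"] have "\<bar>stirling_err (4 * n) - stirling_err (2 * n)\<bar> \<le> real (2 * n) / (4 * real n ^ 2)"
    by simp
  also have "\<dots> \<le> 1 / real n" using assms by (simp add: power2_eq_square field_simps)
  finally show ?thesis .
qed

text \<open>The double factorial is (4n)! / (2^(2n) (2n)!), and the claimed equivalent is exactly
  what the Stirling main terms give; only the errors remain.\<close>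

lemma double_factorial_ratio_eq:
  assumes "n \<ge> 1"
  shows "real (dfact (4 * n - 1)) / 2^(2 * n) / (sqrt 2 * (2 / exp 1)^(2 * n) * real n^(2 * n)) =
         exp (stirling_err (4 * n) - stirling_err (2 * n))" (is "?r = _")
proof -
  have pos: "?r > 0" using assms dfact_pos[of "4 * n - 1"] by (intro divide_pos_pos mult_pos_pos) auto
  have n: "real n > 0" using assms by simp
  have "?r = fact (4 * n) / (2 ^ (2 * n) * fact (2 * n)) / 2^(2 * n) /
             (sqrt 2 * (2 / exp 1)^(2 * n) * real n^(2 * n))"
    using dfact_4n[OF assms] by simp
  hence "ln ?r = ln (fact (4 * n)) - (ln (2 ^ (2 * n)) + ln (fact (2 * n))) - ln (2^(2 * n)) -
       (ln (sqrt 2) + ln ((2 / exp 1)^(2 * n)) + ln (real n^(2 * n)))"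
    using n by (simp add: ln_div ln_mult)
  also have "\<dots> = ln (fact (4 * n)) - ln (fact (2 * n)) - 4 * real n * ln 2
       - (ln 2 / 2 + 2 * real n * (ln 2 - 1) + 2 * real n * ln (real n))"
    using n by (simp add: ln_realpow ln_sqrt ln_div)
  also have "\<dots> = stirling_err (4 * n) - stirling_err (2 * n)"
  proof -
    have "ln (real (4 * n)) = 2 * ln 2 + ln (real n)" "ln (real (2 * n)) = ln 2 + ln (real n)"
      using n ln_realpow[of 2 2] by (simp_all add: ln_mult)
    thus ?thesis unfolding stirling_err_def by (simp add: algebra_simps)
  qed
  finally show ?thesis using pos by (metis exp_ln)
qed

lemma double_factorial_asymptotics:
  "(\<lambda>n::nat. real (dfact (4 * n - 1)) / 2^(2 * n)
       / (sqrt 2 * (2 / exp 1)^(2 * n) * real n^(2 * n)) - 1) \<in> O(\<lambda>n. 1 / real n)"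
proof (rule bigoI[of _ 2], rule eventually_mono[OF eventually_ge_at_top[of 1]])
  fix n :: nat assume n: "n \<ge> 1"
  define x where "x = stirling_err (4 * n) - stirling_err (2 * n)"
  have x: "\<bar>x\<bar> \<le> 1 / real n" using stirling_err_diff[OF n] by (simp add: x_def)
  hence "\<bar>x\<bar> \<le> 1" using n by (simp add: order.trans)
  have "\<bar>exp x - 1\<bar> \<le> 2 * \<bar>x\<bar>"
  proof (cases "x \<ge> 0")
    case True
    have "exp x \<le> 1 + x + x^2" using True \<open>\<bar>x\<bar> \<le> 1\<close> by (intro exp_bound) auto
    moreover have "x^2 \<le> x" using True \<open>\<bar>x\<bar> \<le> 1\<close> by (simp add: power2_eq_square mult_left_le)
    moreover have "exp x \<ge> 1" using True by simp
    ultimately show ?thesis using True by simp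
  next
    case False
    have "exp x \<ge> 1 + x" by (rule exp_ge_add_one_self)
    moreover have "exp x \<le> 1" using False by simp
    moreover have "x < 0" using False by simp
    moreover from this have "\<bar>x\<bar> = - x" "\<bar>exp x - 1\<bar> = 1 - exp x" by simp_all
    ultimately show ?thesis by linarith
  qed
  thus "norm (real (dfact (4 * n - 1)) / 2^(2 * n)
       / (sqrt 2 * (2 / exp 1)^(2 * n) * real n^(2 * n)) - 1) \<le> 2 * norm (1 / real n)"
    unfolding double_factorial_ratio_eq[OF n] x_def[symmetric] using x by simp
qed

section \<open>The critical constants\<close>

text \<open>The constants are c = (-1)^(n-1+m) times \<open>imval n m\<close> for 0 \<le> m < n, in
  increasing order: m of the parity of n gives negative values, sorted by decreasing m, and the
  other parity gives positive values, sorted by increasing m.\<close>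

definition crit :: "nat \<Rightarrow> nat \<Rightarrow> real" where
  "crit n k = (if n < 2 * k then imval n (2 * k - n - 1) else - imval n (n - 2 * k))"

lemma crit_mono:
  assumes n: "n \<ge> 2" and k: "1 \<le> k" "k < l" "l \<le> n"
  shows "crit n k < crit n l"
proof -
  have n1: "n \<ge> 1" using n by simp
  consider "n < 2 * k" | "2 * k \<le> n" "n < 2 * l" | "2 * l \<le> n" by linarith
  thus ?thesis
  proof cases
    case 1
    hence "imval n (2 * k - n - 1) < imval n (2 * l - n - 1)" using k by (intro imval_mono[OF n1]) auto
    thus ?thesis using 1 k by (simp add: crit_def)
  next
    case 2
    thus ?thesis using imval_pos[of n "n - 2 * k"] imval_pos[of n "2 * l - n - 1"] by (simp add: crit_def)
  next
    case 3
    hence "imval n (n - 2 * l) < imval n (n - 2 * k)" using k by (intro imval_mono[OF n1]) auto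
    thus ?thesis using 3 k by (simp add: crit_def)
  qed
qed

lemma crit_inj: "n \<ge> 2 \<Longrightarrow> inj_on (crit n) {1..n}"
proof (rule inj_onI)
  fix k l assume "n \<ge> 2" "k \<in> {1..n}" "l \<in> {1..n}" "crit n k = crit n l"
  thus "k = l" using crit_mono[of n k l] crit_mono[of n l k] by (cases k l rule: linorder_cases) auto
qed

lemma ceiling_half: "nat \<lceil>real n / 2\<rceil> = (n + 1) div 2"
proof -
  have "\<lceil>real n / 2\<rceil> = int ((n + 1) div 2)"
  proof (cases "even n")
    case True
    then obtain m where "n = 2 * m" by (elim evenE)
    thus ?thesis by simp
  next
    case False
    then obtain m where m: "n = 2 * m + 1" by (elim oddE)
    have "\<lceil>real n / 2\<rceil> = int m + 1" by (rule ceiling_unique) (simp_all add: m field_simps)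
    thus ?thesis by (simp add: m)
  qed
  thus ?thesis by simp
qed

lemma crit_middle:
  assumes "n \<ge> 1"
  shows "crit n ((n + 1) div 2) = (-1) ^ (n - 1) * imval n 0"
proof (cases "even n")
  case True
  then obtain m where "n = 2 * m" by (elim evenE)
  thus ?thesis using assms by (simp add: crit_def)
next
  case False
  then obtain m where "n = 2 * m + 1" by (elim oddE)
  thus ?thesis by (simp add: crit_def)
qed

lemma crit_root:
  assumes n: "n \<ge> 2" and k: "k \<in> {1..n}" "k \<noteq> (n + 1) div 2"
  shows "poly (hpoly n) (crit n k) = 0"
proof -
  define m where "m = (if n < 2 * k then 2 * k - n - 1 else n - 2 * k)"
  have m: "1 \<le> m" "m < n" using k n by (auto simp: m_def)
  have eq: "(-1) ^ (n - 1) * crit n k = (-1) ^ m * imval n m"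
  proof (cases "n < 2 * k")
    case True
    hence "even ((n - 1) + m)" using n by (simp add: m_def)
    hence "(-1 :: real) ^ (n - 1) = (-1) ^ m" by (simp add: minus_one_power_iff)
    thus ?thesis using True by (simp add: crit_def m_def)
  next
    case False
    hence "odd ((n - 1) + m)" using n by (simp add: m_def)
    hence "(-1 :: real) ^ (n - 1) = - ((-1) ^ m)" by (auto simp: minus_one_power_iff)
    thus ?thesis using False by (simp add: crit_def m_def)
  qed
  show ?thesis
    by (rule hpoly_root[of n "eta n (real m * pi) 0"])
       (use n m imval_witness[of n m] eq in auto)
qed

text \<open>There are n - 1 distinct constants, as many as the degree permits, so no further complex
  zero exists.\<close>

lemma hpoly_roots:
  assumes n: "n \<ge> 2"
  shows "{z. poly (map_poly complex_of_real (hpoly n)) z = 0} =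
         (\<lambda>k. complex_of_real (crit n k)) ` ({1..n} - {(n + 1) div 2})"
proof (rule sym, rule card_subset_eq)
  let ?p = "map_poly complex_of_real (hpoly n)"
  have n1: "n \<ge> 1" using n by simp
  have nz: "?p \<noteq> 0" using hpoly_degree(2)[OF n1] by (simp add: map_poly_eq_0_iff)
  show "finite {z. poly ?p z = 0}" by (rule poly_roots_finite[OF nz])
  have "poly ?p (of_real x) = of_real (poly (hpoly n) x)" for x
    unfolding poly_altdef by (simp add: degree_map_poly coeff_map_poly)
  thus sub: "(\<lambda>k. complex_of_real (crit n k)) ` ({1..n} - {(n + 1) div 2}) \<subseteq> {z. poly ?p z = 0}"
    using crit_root[OF n] by auto
  have "inj_on (\<lambda>k. complex_of_real (crit n k)) ({1..n} - {(n + 1) div 2})"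
  proof (rule inj_onI)
    fix k l assume "k \<in> {1..n} - {(n + 1) div 2}" "l \<in> {1..n} - {(n + 1) div 2}"
      and "complex_of_real (crit n k) = complex_of_real (crit n l)"
    thus "k = l" using inj_onD[OF crit_inj[OF n], of k l] by (simp only: of_real_eq_iff Diff_iff)
  qed
  hence "card ((\<lambda>k. complex_of_real (crit n k)) ` ({1..n} - {(n + 1) div 2})) = card ({1..n} - {(n + 1) div 2})"
    by (rule card_image)
  also have "\<dots> = card {1..n} - 1"
    by (rule card_Diff_singleton) (use n in auto)
  also have "\<dots> = n - 1" by simp
  finally have c: "card ((\<lambda>k. complex_of_real (crit n k)) ` ({1..n} - {(n + 1) div 2})) = n - 1" .
  have "card {z. poly ?p z = 0} \<le> degree ?p" by (rule card_poly_roots_bound[OF nz])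
  also have "\<dots> = n - 1" by (simp add: degree_map_poly hpoly_degree(1)[OF n1])
  finally show "card ((\<lambda>k. complex_of_real (crit n k)) ` ({1..n} - {(n + 1) div 2})) = card {z. poly ?p z = 0}"
    using c card_mono[OF poly_roots_finite[OF nz] sub] by simp
qed

section \<open>Root counts between consecutive constants\<close>

lemma neg_one_power_sign:
  assumes "n \<ge> 1"
  shows "(-1 :: real) ^ (n - 1) * c > 0 \<longleftrightarrow> (if even n then c < 0 else c > 0)"
  using assms by (auto simp: minus_one_power_iff)

lemma left_count_pos:
  assumes n: "n \<ge> 1" and k: "n < 2 * k" "k \<le> n" and c: "crit n k \<le> c" and up: "k < n \<Longrightarrow> c < crit n (k + 1)"
  shows "left_count n ((-1) ^ (n - 1) * c) = 2 * k - n"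
proof -
  define r where "r = (-1) ^ (n - 1) * c"
  have c0: "c > 0" using c k imval_pos[of n "2 * k - n - 1"] by (simp add: crit_def)
  have r: "r \<noteq> 0" "\<bar>r\<bar> = c" using c0 by (auto simp: r_def abs_mult power_abs)
  have "left_count n r = (2 * k - n - 1) + 1"
  proof (rule left_count_Suc[OF n r(1)])
    show "2 * k - n - 1 < n" using k n by simp
    show "even (2 * k - n - 1) \<longleftrightarrow> 0 < r"
      unfolding r_def neg_one_power_sign[OF n] using k c0 by auto
    show "imval n (2 * k - n - 1) \<le> \<bar>r\<bar>" using c k r by (simp add: crit_def)
    assume *: "2 * k - n - 1 + 2 < n"
    have "2 * (k + 1) - n - 1 = 2 * k - n - 1 + 2" using k by simp
    thus "\<bar>r\<bar> < imval n (2 * k - n - 1 + 2)" using up * k r by (simp add: crit_def)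
  qed
  thus ?thesis using k by (simp add: r_def)
qed

text \<open>The case k = 0, where c has no lower bound, is the unbounded range c \<le>
  c_n^(1).\<close>

lemma left_count_neg:
  assumes n: "n \<ge> 2" and k: "2 * (k + 1) \<le> n" and c: "c \<le> crit n (k + 1)" and lo: "k \<ge> 1 \<Longrightarrow> crit n k < c"
  shows "left_count n ((-1) ^ (n - 1) * c) = n - 2 * k - 1"
proof -
  have n1: "n \<ge> 1" using n by simp
  define r where "r = (-1) ^ (n - 1) * c"
  have c0: "c < 0" "imval n (n - 2 * (k + 1)) \<le> - c"
    using c k imval_pos[of n "n - 2 * (k + 1)"] by (auto simp: crit_def)
  have r: "r \<noteq> 0" "\<bar>r\<bar> = - c" using c0 by (auto simp: r_def abs_mult power_abs)
  have "left_count n r = (n - 2 * (k + 1)) + 1"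
  proof (rule left_count_Suc[OF n1 r(1)])
    show "n - 2 * (k + 1) < n" using n by simp
    show "even (n - 2 * (k + 1)) \<longleftrightarrow> 0 < r"
      unfolding r_def neg_one_power_sign[OF n1] using k c0 by auto
    show "imval n (n - 2 * (k + 1)) \<le> \<bar>r\<bar>" using c0 r by simp
    assume *: "n - 2 * (k + 1) + 2 < n"
    hence "k \<ge> 1" using k by simp
    moreover have "n - 2 * k = n - 2 * (k + 1) + 2" using k by simp
    ultimately show "\<bar>r\<bar> < imval n (n - 2 * (k + 1) + 2)" using lo r k by (simp add: crit_def)
  qed
  thus ?thesis using k by (simp add: r_def)
qed

text \<open>One endpoint is the threshold for m = 0 and the other that for |m| = 1; which is which
  depends on the parity of n.\<close>

lemma left_count_middle:
  assumes n: "n \<ge> 2" and c: "crit n (n div 2) < c" "c < crit n (n div 2 + 1)"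
  shows "left_count n ((-1) ^ (n - 1) * c) = 0"
proof (rule left_count_small)
  show n1: "n \<ge> 1" using n by simp
  have 1: "crit n (n div 2) = - imval n (n - 2 * (n div 2))" "crit n (n div 2 + 1) = imval n (2 * (n div 2) + 1 - n)"
    by (auto simp: crit_def)
  show "(-1) ^ (n - 1) * c < imval n 0" if "(-1) ^ (n - 1) * c > 0"
    using that c n unfolding 1 by (cases "even n") (auto elim!: evenE oddE simp: minus_one_power_iff)
  show "- ((-1) ^ (n - 1) * c) < imval n 1" if "(-1) ^ (n - 1) * c < 0"
    using that c n unfolding 1 by (cases "even n") (auto elim!: evenE oddE simp: minus_one_power_iff)
qed

theorem theorem4p6:
  shows
   "(\<forall>n::nat. n \<ge> 2 \<longrightarrow>
      (\<exists>C :: nat \<Rightarrow> real.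
         (\<forall>k\<in>{1..<n}. C k < C (Suc k)) \<and>
         \<comment> \<open>(a)\<close>
         (\<forall>(c::real) (d::real) (\<mu>::complex). d > 0 \<longrightarrow>
            (c \<ge> C n \<longrightarrow> num_L2_sols n c d \<mu> = n) \<and>
            (\<forall>k. n div 2 < k \<and> k \<le> n - 1 \<and> C k \<le> c \<and> c < C (k + 1) \<longrightarrow>
                 num_L2_sols n c d \<mu> = n + 2 * (n - k)) \<and>
            (\<forall>k. k = n div 2 \<and> C k < c \<and> c < C (k + 1) \<longrightarrow>
                 num_L2_sols n c d \<mu> = 2 * n) \<and>
            (\<forall>k. 1 \<le> k \<and> k < n div 2 \<and> C k < c \<and> c \<le> C (k + 1) \<longrightarrow>
                 num_L2_sols n c d \<mu> = n + 2 * k + 1) \<and>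
            (c \<le> C 1 \<longrightarrow> num_L2_sols n c d \<mu> = n + 1)) \<and>
         \<comment> \<open>(b)\<close>
         C (nat \<lceil>real n / 2\<rceil>) = (-1)^(n - 1) * real (dfact (4 * n - 1)) / 2^(2 * n) \<and>
         \<comment> \<open>(c)\<close>
         degree (hpoly n) = n - 1 \<and>
         (\<forall>i. coeff (hpoly n) i \<in> \<rat>) \<and>
         {z::complex. poly (map_poly complex_of_real (hpoly n)) z = 0} =
           (\<lambda>k. complex_of_real (C k)) ` ({1..n} - {nat \<lceil>real n / 2\<rceil>}) \<and>
         C n \<ge> real (dfact (4 * n - 1)) / 2^(2 * n))) \<and>
    (\<lambda>n::nat. real (dfact (4 * n - 1)) / 2^(2 * n)
              / (sqrt 2 * (2 / exp 1)^(2 * n) * real n^(2 * n)) - 1)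
      \<in> O(\<lambda>n. 1 / real n) \<and>
    \<comment> \<open>(ii)\<close>
    (\<forall>(c::real) (d::real) (\<mu>::complex). d > 0 \<longrightarrow>
       (c \<ge> 3/4 \<longrightarrow> num_L2_sols 1 c d \<mu> = 1) \<and>
       (c < 3/4 \<longrightarrow> num_L2_sols 1 c d \<mu> = 2))"
proof (intro conjI allI impI)
  fix n :: nat assume n: "n \<ge> 2"
  hence n1: "n \<ge> 1" by simp
  show "\<exists>C :: nat \<Rightarrow> real.
         (\<forall>k\<in>{1..<n}. C k < C (Suc k)) \<and>
         (\<forall>(c::real) (d::real) (\<mu>::complex). d > 0 \<longrightarrow>
            (c \<ge> C n \<longrightarrow> num_L2_sols n c d \<mu> = n) \<and>
            (\<forall>k. n div 2 < k \<and> k \<le> n - 1 \<and> C k \<le> c \<and> c < C (k + 1) \<longrightarrow>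
                 num_L2_sols n c d \<mu> = n + 2 * (n - k)) \<and>
            (\<forall>k. k = n div 2 \<and> C k < c \<and> c < C (k + 1) \<longrightarrow>
                 num_L2_sols n c d \<mu> = 2 * n) \<and>
            (\<forall>k. 1 \<le> k \<and> k < n div 2 \<and> C k < c \<and> c \<le> C (k + 1) \<longrightarrow>
                 num_L2_sols n c d \<mu> = n + 2 * k + 1) \<and>
            (c \<le> C 1 \<longrightarrow> num_L2_sols n c d \<mu> = n + 1)) \<and>
         C (nat \<lceil>real n / 2\<rceil>) = (-1)^(n - 1) * real (dfact (4 * n - 1)) / 2^(2 * n) \<and>
         degree (hpoly n) = n - 1 \<and>
         (\<forall>i. coeff (hpoly n) i \<in> \<rat>) \<and>
         {z::complex. poly (map_poly complex_of_real (hpoly n)) z = 0} =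
           (\<lambda>k. complex_of_real (C k)) ` ({1..n} - {nat \<lceil>real n / 2\<rceil>}) \<and>
         C n \<ge> real (dfact (4 * n - 1)) / 2^(2 * n)"
  proof (intro exI[of _ "crit n"] conjI ballI allI impI)
    fix k assume "k \<in> {1..<n}"
    thus "crit n k < crit n (Suc k)" by (intro crit_mono[OF n]) auto
  next
    fix c d :: real and \<mu> :: complex assume d: "d > 0"
    note num = num_L2_sols_eq_left_count[OF n1 d, of c \<mu>]
    show "num_L2_sols n c d \<mu> = n" if "c \<ge> crit n n"
    proof -
      have "left_count n ((-1) ^ (n - 1) * c) = 2 * n - n"
        by (rule left_count_pos[OF n1]) (use that n in auto)
      thus ?thesis unfolding num by simp
    qed
    show "num_L2_sols n c d \<mu> = n + 2 * (n - k)"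
      if k: "n div 2 < k \<and> k \<le> n - 1 \<and> crit n k \<le> c \<and> c < crit n (k + 1)" for k
    proof -
      from k have "n div 2 < k" "k \<le> n - 1" by simp_all
      hence k': "n < 2 * k" "k \<le> n" by presburger+
      have "left_count n ((-1) ^ (n - 1) * c) = 2 * k - n"
        by (rule left_count_pos[OF n1 k']) (use k in auto)
      thus ?thesis unfolding num using k' by simp
    qed
    show "num_L2_sols n c d \<mu> = 2 * n"
      if "k = n div 2 \<and> crit n k < c \<and> c < crit n (k + 1)" for k
    proof -
      have "left_count n ((-1) ^ (n - 1) * c) = 0"
        by (rule left_count_middle[OF n]) (use that in auto)
      thus ?thesis unfolding num by simp
    qed
    show "num_L2_sols n c d \<mu> = n + 2 * k + 1"
      if k: "1 \<le> k \<and> k < n div 2 \<and> crit n k < c \<and> c \<le> crit n (k + 1)" for k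
    proof -
      from k have "k < n div 2" by simp
      hence k': "2 * (k + 1) \<le> n" by presburger
      have "left_count n ((-1) ^ (n - 1) * c) = n - 2 * k - 1"
        by (rule left_count_neg[OF n k']) (use k in auto)
      thus ?thesis unfolding num using k' by simp
    qed
    show "num_L2_sols n c d \<mu> = n + 1" if "c \<le> crit n 1"
    proof -
      have "left_count n ((-1) ^ (n - 1) * c) = n - 2 * 0 - 1"
        by (rule left_count_neg[OF n]) (use that n in auto)
      thus ?thesis unfolding num using n by simp
    qed
  next
    show "crit n (nat \<lceil>real n / 2\<rceil>) = (-1)^(n - 1) * real (dfact (4 * n - 1)) / 2^(2 * n)"
      unfolding ceiling_half crit_middle[OF n1] imval_0[OF n1] by simp
    show "degree (hpoly n) = n - 1" by (rule hpoly_degree(1)[OF n1])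
    show "coeff (hpoly n) i \<in> \<rat>" for i by (rule hpoly_Rats)
    show "{z::complex. poly (map_poly complex_of_real (hpoly n)) z = 0} =
           (\<lambda>k. complex_of_real (crit n k)) ` ({1..n} - {nat \<lceil>real n / 2\<rceil>})"
      unfolding ceiling_half by (rule hpoly_roots[OF n])
    have "crit n n = imval n (n - 1)" using n by (simp add: crit_def)
    thus "crit n n \<ge> real (dfact (4 * n - 1)) / 2^(2 * n)"
      using imval_mono_le[OF n1, of 0 "n - 1"] n imval_0[OF n1] by simp
  qed
next
  show "(\<lambda>n::nat. real (dfact (4 * n - 1)) / 2^(2 * n)
              / (sqrt 2 * (2 / exp 1)^(2 * n) * real n^(2 * n)) - 1)
      \<in> O(\<lambda>n. 1 / real n)"
    by (rule double_factorial_asymptotics)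
next
  fix c d :: real and \<mu> :: complex assume d: "d > 0"
  have "dfact 3 = 3" by (simp add: numeral_3_eq_3)
  \<comment> \<open>For n = 1 only m = 0 satisfies |m| < n, so 3!!/2^2 = 3/4 is the single
    threshold.\<close>
  hence im: "imval 1 0 = 3/4" using imval_0[of 1] by simp
  have num: "num_L2_sols 1 c d \<mu> = 2 - left_count 1 c"
    using num_L2_sols_eq_left_count[OF _ d, of 1 c \<mu>] by simp
  show "num_L2_sols 1 c d \<mu> = 1" if "c \<ge> 3/4"
  proof -
    have "left_count 1 c = 0 + 1" by (rule left_count_Suc) (use that im in auto)
    thus ?thesis unfolding num by simp
  qed
  show "num_L2_sols 1 c d \<mu> = 2" if "c < 3/4"
  proof -
    have "left_count 1 c = 0" by (rule left_count_small) (use that im in auto)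
    thus ?thesis unfolding num by simp
  qed
qed

end
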